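(* For every positive integer $n\notin\{4,6\}$ there exists an $N_\infty$ Latin square of order $n$.
   Context: A Latin square of order $n$ is an $n\times n$ matrix on $n$ symbols in which each symbol occurs exactly once in each row and each column. A subsquare of order $k$ of a Latin square $L$ is a $k\times k$ submatrix (on some $k$ rows and $k$ columns, not necessarily contiguous) that is itself a Latin square. A subsquare of order $k\in\{2,3,\dots,n-1\}$ is proper. A Latin square with no proper subsquare is called $N_\infty$. *)

theory Defs
  imports Main
begin

text \<open>
  Rows and columns are indexed by arbitrary finite sets, so that the same predicate
  applies to a full matrix and to a submatrix on non-contiguous rows and columns;
  \<open>S\<close> is the set of the \<open>k\<close> symbols used.
\<close>

definition latin_on :: "nat \<Rightarrow> 'r set \<Rightarrow> 'c set \<Rightarrow> ('r \<Rightarrow> 'c \<Rightarrow> 's) \<Rightarrow> bool" where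
  "latin_on k R C L \<longleftrightarrow>
     finite R \<and> card R = k \<and> finite C \<and> card C = k \<and>
     (\<exists>S. finite S \<and> card S = k \<and>
        (\<forall>r\<in>R. \<forall>c\<in>C. L r c \<in> S) \<and>
        (\<forall>r\<in>R. \<forall>s\<in>S. \<exists>!c. c \<in> C \<and> L r c = s) \<and>
        (\<forall>c\<in>C. \<forall>s\<in>S. \<exists>!r. r \<in> R \<and> L r c = s))"

text \<open>Values of \<open>L\<close> outside \<open>{..<n} \<times> {..<n}\<close> are irrelevant.\<close>

definition latin_square :: "nat \<Rightarrow> (nat \<Rightarrow> nat \<Rightarrow> 's) \<Rightarrow> bool" where
  "latin_square n L \<longleftrightarrow> latin_on n {..<n} {..<n} L"

definition subsquare ::
    "nat \<Rightarrow> (nat \<Rightarrow> nat \<Rightarrow> 's) \<Rightarrow> nat \<Rightarrow> nat set \<Rightarrow> nat set \<Rightarrow> bool" where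
  "subsquare n L k R C \<longleftrightarrow> R \<subseteq> {..<n} \<and> C \<subseteq> {..<n} \<and> latin_on k R C L"

definition proper_subsquare ::
    "nat \<Rightarrow> (nat \<Rightarrow> nat \<Rightarrow> 's) \<Rightarrow> nat \<Rightarrow> nat set \<Rightarrow> nat set \<Rightarrow> bool" where
  "proper_subsquare n L k R C \<longleftrightarrow> subsquare n L k R C \<and> 2 \<le> k \<and> k < n"

definition N_infinity :: "nat \<Rightarrow> (nat \<Rightarrow> nat \<Rightarrow> 's) \<Rightarrow> bool" where
  "N_infinity n L \<longleftrightarrow> latin_square n L \<and> \<not> (\<exists>k R C. proper_subsquare n L k R C)"

end

theory Submission
  imports Defs "HOL-Computational_Algebra.Primes"
begin

text \<open>
  An order \<open>n\<close> is written as \<open>m a\<close> and the square has rows \<open>(i, r)\<close>, columns \<open>(j, s)\<close> and symbols \<open>(y, x)\<close>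
  with \<open>i, j, y\<close> in the integers modulo \<open>m\<close> and \<open>r, s, x < a\<close>. Here \<open>y = i + j\<close>, except that \<open>y = i + j + 1\<close> for
  the rows \<open>r \<in> B\<close> in the column \<open>s = t\<close>, and \<open>x\<close> is read off a square \<open>F i y\<close> of order \<open>a\<close> without proper
  subsquares. A subsquare of the product meets every block in the same number of cells, up to the perturbation
  by \<open>B\<close> and \<open>t\<close>. Since the \<open>F i y\<close> have no proper subsquares, that number is \<open>1\<close> or \<open>a\<close>; the perturbation
  excludes \<open>a\<close>. When it is \<open>1\<close>, the subsquare is stable under a translation by \<open>m div q\<close> for a prime \<open>q\<close>,
  or it is a single \<open>2 \<times> 2\<close> square that mixes rows inside and outside \<open>B\<close>. Both are excluded by letting \<open>F i y\<close>
  depend on the leading base-\<open>q\<close> digits of \<open>i\<close> and \<open>y\<close>.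

  Every order has a suitable factor \<open>a\<close>: a prime \<open>a \<ge> 5\<close>, with the cyclic square, or one of
  \<open>9, 12, 15, 16, 18, 25\<close>, with squares found by computer search. Only the orders \<open>1, 2, 3, 8\<close> are left.
\<close>

section \<open>Latin squares and subsquares\<close>

text \<open>The set \<open>X\<close> keeps the perturbed square Latin: in column \<open>t\<close>
  each \<open>F i y\<close> puts exactly the symbols of \<open>X\<close> into the rows of
  \<open>B\<close>, so the symbol itself tells whether the block index was raised by 1.

  Digits are essential because a product with a fixed factor contains copies of the cyclic square of
  order \<open>m\<close>, one cell per block, even after the perturbation. A translation by
  \<open>m div q\<close> moves the leading digit for \<open>q\<close> and fixes those for all other
  primes, so one parity over the odd primes can defeat each of them separately. The argument
  compares a symbol block of digit 0 with two others and needs \<open>q \<ge> 3\<close>; for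
  \<open>q = 2\<close> it is replaced by four squares chosen by the top bits of row block and symbol
  block.

  A second obstacle is \<open>q = a\<close> for a cyclic factor, whose row permutations are
  themselves \<open>q\<close>-cycles. Then both active and inactive rows outside \<open>B\<close>
  have to be found, which for odd \<open>m\<close> takes \<open>q \<ge> 7\<close>. This is why odd
  multiples of 5 other than 5 itself, when no larger prime divides them, rest on squares of order 15
  and 25.\<close>

abbreviation has_N_infinity :: "nat \<Rightarrow> bool" where
  "has_N_infinity n \<equiv> \<exists>L :: nat \<Rightarrow> nat \<Rightarrow> nat. N_infinity n L"

definition square :: "nat \<Rightarrow> (nat \<Rightarrow> nat \<Rightarrow> nat) \<Rightarrow> bool" where
  "square a G \<longleftrightarrow>
     (\<forall>r<a. bij_betw (G r) {..<a} {..<a}) \<and> (\<forall>s<a. bij_betw (\<lambda>r. G r s) {..<a} {..<a})"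

text \<open>It is enough to ask that the entries lie in a set of the right size: in a Latin square
  each row of \<open>R\<close> is injective on \<open>C\<close> and so fills \<open>N\<close>, which
  makes the submatrix Latin. For blocks of a larger subsquare this form is easy to supply.\<close>

definition subfree :: "nat \<Rightarrow> (nat \<Rightarrow> nat \<Rightarrow> nat) \<Rightarrow> bool" where
  "subfree a G \<longleftrightarrow>
     (\<forall>R C N. R \<subseteq> {..<a} \<longrightarrow> C \<subseteq> {..<a} \<longrightarrow> finite N \<longrightarrow> card R = card C \<longrightarrow> card N = card C \<longrightarrow>
        (\<forall>r\<in>R. \<forall>s\<in>C. G r s \<in> N) \<longrightarrow> card C < 2 \<or> a \<le> card C)"

lemma squareD:
  assumes "square a G"
  shows "\<And>r s. r < a \<Longrightarrow> s < a \<Longrightarrow> G r s < a"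
    and "\<And>r s s'. r < a \<Longrightarrow> s < a \<Longrightarrow> s' < a \<Longrightarrow> G r s = G r s' \<Longrightarrow> s = s'"
    and "\<And>r r' s. r < a \<Longrightarrow> r' < a \<Longrightarrow> s < a \<Longrightarrow> G r s = G r' s \<Longrightarrow> r = r'"
    and "\<And>r x. r < a \<Longrightarrow> x < a \<Longrightarrow> \<exists>s<a. G r s = x"
    and "\<And>s x. s < a \<Longrightarrow> x < a \<Longrightarrow> \<exists>r<a. G r s = x"
proof -
  fix r s assume "r < a" "s < a"
  then show "G r s < a" using assms unfolding square_def bij_betw_def by blast
next
  fix r s s' assume "r < a" "s < a" "s' < a" "G r s = G r s'"
  then show "s = s'" using assms unfolding square_def bij_betw_def inj_on_def by blast
next
  fix r r' s assume "r < a" "r' < a" "s < a" "G r s = G r' s"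
  then show "r = r'" using assms unfolding square_def bij_betw_def inj_on_def by blast
next
  fix r x assume "r < a" "x < a"
  then have "x \<in> G r ` {..<a}" using assms unfolding square_def bij_betw_def by blast
  then show "\<exists>s<a. G r s = x" by auto
next
  fix s x assume "s < a" "x < a"
  then have "x \<in> (\<lambda>r. G r s) ` {..<a}" using assms unfolding square_def bij_betw_def by blast
  then show "\<exists>r<a. G r s = x" by auto
qed

lemma latin_on_bij:
  assumes "latin_on k R C L"
  shows "\<exists>N. finite R \<and> card R = k \<and> finite C \<and> card C = k \<and> finite N \<and> card N = k \<and>
    (\<forall>r\<in>R. bij_betw (L r) C N) \<and> (\<forall>c\<in>C. bij_betw (\<lambda>r. L r c) R N)"
proof -
  from assms have fin: "finite R" "card R = k" "finite C" "card C = k"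
    and "\<exists>S. finite S \<and> card S = k \<and> (\<forall>r\<in>R. \<forall>c\<in>C. L r c \<in> S) \<and>
      (\<forall>r\<in>R. \<forall>s\<in>S. \<exists>!c. c \<in> C \<and> L r c = s) \<and> (\<forall>c\<in>C. \<forall>s\<in>S. \<exists>!r. r \<in> R \<and> L r c = s)"
    unfolding latin_on_def by simp_all
  then obtain S where S: "finite S" "card S = k" "\<And>r c. r \<in> R \<Longrightarrow> c \<in> C \<Longrightarrow> L r c \<in> S"
    and rw: "\<And>r s. r \<in> R \<Longrightarrow> s \<in> S \<Longrightarrow> \<exists>!c. c \<in> C \<and> L r c = s"
    and cl: "\<And>c s. c \<in> C \<Longrightarrow> s \<in> S \<Longrightarrow> \<exists>!r. r \<in> R \<and> L r c = s"
    by (elim exE conjE) simp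
  have row: "bij_betw (L r) C S" if r: "r \<in> R" for r
  proof (rule bij_betwI')
    fix c c' assume "c \<in> C" "c' \<in> C"
    then show "(L r c = L r c') = (c = c')" using ex1_implies_ex rw[OF r S(3)[OF r, of c]] by auto
  next
    fix x assume "x \<in> S"
    from rw[OF r this] show "\<exists>c\<in>C. x = L r c" by auto
  qed (use S(3) r in auto)
  have col: "bij_betw (\<lambda>r. L r c) R S" if c: "c \<in> C" for c
  proof (rule bij_betwI')
    fix r r' assume "r \<in> R" "r' \<in> R"
    then show "(L r c = L r' c) = (r = r')" using cl[OF c S(3)[of r, OF _ c]] by auto
  next
    fix x assume "x \<in> S"
    from cl[OF c this] show "\<exists>r\<in>R. x = L r c" by auto
  qed (use S(3) c in auto)
  show ?thesis by (intro exI[of _ S] conjI ballI fin S(1,2) row col)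
qed

lemma latin_onI:
  assumes "finite R" "card R = k" "finite C" "card C = k" "finite N" "card N = k"
    and row: "\<And>r. r \<in> R \<Longrightarrow> bij_betw (L r) C N" and col: "\<And>c. c \<in> C \<Longrightarrow> bij_betw (\<lambda>r. L r c) R N"
  shows "latin_on k R C L"
proof -
  have v: "L r c \<in> N" if "r \<in> R" "c \<in> C" for r c using row[OF that(1)] that(2) by (auto simp: bij_betw_def)
  have r1: "\<exists>!c. c \<in> C \<and> L r c = s" if "r \<in> R" "s \<in> N" for r s
  proof -
    have "inj_on (L r) C" "s \<in> L r ` C" using row[OF that(1)] that(2) by (auto simp: bij_betw_def)
    then show ?thesis by (auto dest: inj_onD)
  qed
  have c1: "\<exists>!r. r \<in> R \<and> L r c = s" if "c \<in> C" "s \<in> N" for c s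
  proof -
    have "inj_on (\<lambda>r. L r c) R" "s \<in> (\<lambda>r. L r c) ` R" using col[OF that(1)] that(2) by (auto simp: bij_betw_def)
    then show ?thesis by (auto dest: inj_onD)
  qed
  show ?thesis unfolding latin_on_def
    by (intro conjI exI[of _ N] ballI assms(1-6) v r1 c1)
qed

text \<open>The product has pairs as rows, columns and symbols, while \<open>N_infinity\<close>
  speaks of \<open>{..<n}\<close>. Renumbering by bijections \<open>f\<close>, \<open>g\<close>,
  \<open>h\<close> carries a subsquare of the renumbered matrix back to one of
  \<open>L\<close>.\<close>

lemma N_infinityI:
  fixes L :: "'r \<Rightarrow> 'c \<Rightarrow> 's"
  assumes L: "latin_on n X Y L"
    and sub: "\<And>k R C. R \<subseteq> X \<Longrightarrow> C \<subseteq> Y \<Longrightarrow> latin_on k R C L \<Longrightarrow> 2 \<le> k \<Longrightarrow> k < n \<Longrightarrow> False"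
  shows "has_N_infinity n"
proof -
  obtain N where N: "finite X" "card X = n" "finite Y" "card Y = n" "finite N" "card N = n"
    "\<forall>r\<in>X. bij_betw (L r) Y N" "\<forall>c\<in>Y. bij_betw (\<lambda>r. L r c) X N"
    using latin_on_bij[OF L] by blast
  obtain f where f: "bij_betw f {..<n} X"
    using ex_bij_betw_nat_finite[OF N(1)] N(2) by (auto simp: lessThan_atLeast0)
  obtain g where g: "bij_betw g {..<n} Y"
    using ex_bij_betw_nat_finite[OF N(3)] N(4) by (auto simp: lessThan_atLeast0)
  obtain h :: "'s \<Rightarrow> nat" where h: "bij_betw h N {..<n}"
    using ex_bij_betw_finite_nat[OF N(5)] N(6) by (auto simp: lessThan_atLeast0)
  define L' where "L' r c = h (L (f r) (g c))" for r c
  have fX: "f r \<in> X" and gY: "g r \<in> Y" if "r < n" for r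
    using bij_betwE[OF f] bij_betwE[OF g] that by auto
  have val: "L (f r) (g c) \<in> N" if "r < n" "c < n" for r c
    using N(7) fX[OF that(1)] gY[OF that(2)] by (auto simp: bij_betw_def)
  have lat: "latin_square n L'"
    unfolding latin_square_def
  proof (rule latin_onI[where N = "{..<n}"])
    fix r assume "r \<in> {..<n}"
    then have "bij_betw (L (f r)) Y N" using N(7) fX by auto
    from bij_betw_trans[OF bij_betw_trans[OF g this] h]
    show "bij_betw (L' r) {..<n} {..<n}" by (simp add: L'_def[abs_def] comp_def)
  next
    fix c assume "c \<in> {..<n}"
    then have "bij_betw (\<lambda>r. L r (g c)) X N" using N(8) gY by auto
    from bij_betw_trans[OF bij_betw_trans[OF f this] h]
    show "bij_betw (\<lambda>r. L' r c) {..<n} {..<n}" by (simp add: L'_def[abs_def] comp_def)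
  qed auto
  have "\<not> proper_subsquare n L' k R C" for k R C
  proof
    assume "proper_subsquare n L' k R C"
    then have R: "R \<subseteq> {..<n}" and C: "C \<subseteq> {..<n}" and sq: "latin_on k R C L'" and k: "2 \<le> k" "k < n"
      by (auto simp: proper_subsquare_def subsquare_def)
    obtain S where S: "finite R" "card R = k" "finite C" "card C = k" "finite S" "card S = k"
      "\<forall>r\<in>R. bij_betw (L' r) C S" "\<forall>c\<in>C. bij_betw (\<lambda>r. L' r c) R S"
      using latin_on_bij[OF sq] by blast
    have injf: "inj_on f R" and injg: "inj_on g C"
      using f g R C by (auto simp: bij_betw_def inj_on_subset)
    have valRC: "L (f r) (g c) \<in> N" if "r \<in> R" "c \<in> C" for r c
    proof -
      have "r < n" "c < n" using that R C by auto
      then show ?thesis by (rule val)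
    qed
    have S': "S \<subseteq> h ` N"
    proof -
      have "R \<noteq> {}" using S(2) k by auto
      then obtain r where "r \<in> R" by blast
      then have "S = L' r ` C" using S(7) by (auto simp: bij_betw_def)
      then show ?thesis using valRC[OF \<open>r \<in> R\<close>] by (auto simp: L'_def)
    qed
    define hi where "hi = inv_into N h"
    have hi: "inj_on hi S" using S' by (simp add: hi_def inj_on_inv_into)
    have hiL: "hi (L' r c) = L (f r) (g c)" if "r \<in> R" "c \<in> C" for r c
      unfolding hi_def L'_def by (rule inv_into_f_f[OF bij_betw_imp_inj_on[OF h] valRC[OF that]])
    have "latin_on k (f ` R) (g ` C) L"
    proof (rule latin_onI[where N = "hi ` S"])
      fix r' assume "r' \<in> f ` R"
      then obtain r where r: "r \<in> R" "r' = f r" by auto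
      have "bij_betw (L' r) C S" using S(7) r by blast
      from bij_betw_trans[OF this inj_on_imp_bij_betw[OF hi]]
      have b: "inj_on (hi \<circ> L' r) C" "(hi \<circ> L' r) ` C = hi ` S" by (auto simp: bij_betw_def)
      have eq: "(hi \<circ> L' r) c = L r' (g c)" if "c \<in> C" for c using hiL r that by simp
      have "inj_on (L r' \<circ> g) C" using b(1) eq by (simp add: inj_on_def)
      moreover have "(L r' \<circ> g) ` C = hi ` S" unfolding b(2)[symmetric] using eq by (intro image_cong) simp_all
      ultimately show "bij_betw (L r') (g ` C) (hi ` S)"
        by (simp add: bij_betw_def inj_on_imageI image_comp)
    next
      fix c' assume "c' \<in> g ` C"
      then obtain c where c: "c \<in> C" "c' = g c" by auto
      have "bij_betw (\<lambda>r. L' r c) R S" using S(8) c by blast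
      from bij_betw_trans[OF this inj_on_imp_bij_betw[OF hi]]
      have b: "inj_on (hi \<circ> (\<lambda>r. L' r c)) R" "(hi \<circ> (\<lambda>r. L' r c)) ` R = hi ` S" by (auto simp: bij_betw_def)
      have eq: "(hi \<circ> (\<lambda>r. L' r c)) r = L (f r) c'" if "r \<in> R" for r using hiL c that by simp
      have "inj_on ((\<lambda>r. L r c') \<circ> f) R" using b(1) eq by (simp add: inj_on_def)
      moreover have "((\<lambda>r. L r c') \<circ> f) ` R = hi ` S" unfolding b(2)[symmetric] using eq by (intro image_cong) simp_all
      ultimately show "bij_betw (\<lambda>r. L r c') (f ` R) (hi ` S)"
        by (simp add: bij_betw_def inj_on_imageI image_comp)
    qed (simp_all add: S card_image injf injg hi)
    moreover have "f ` R \<subseteq> X" "g ` C \<subseteq> Y" using R C fX gY by auto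
    ultimately show False using sub k by metis
  qed
  then show ?thesis using lat unfolding N_infinity_def by blast
qed

section \<open>The twisted product\<close>

definition period :: "int set \<Rightarrow> int \<Rightarrow> bool" where
  "period Y d \<longleftrightarrow> (\<forall>y. y \<in> Y \<longleftrightarrow> y + d \<in> Y)"

lemma periodD: "period Y d \<Longrightarrow> y + d \<in> Y \<longleftrightarrow> y \<in> Y"
  by (simp add: period_def)

lemma period_add: "period Y d \<Longrightarrow> period Y e \<Longrightarrow> period Y (d + e)"
  by (simp add: period_def flip: add.assoc)

lemma period_uminus: "period Y d \<Longrightarrow> period Y (- d)"
proof -
  assume d: "period Y d"
  have "y \<in> Y \<longleftrightarrow> y + - d \<in> Y" for y using periodD[OF d, of "y + - d"] by simp
  then show ?thesis by (simp add: period_def)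
qed

lemma period_mult: "period Y d \<Longrightarrow> period Y (u * d)"
proof -
  assume d: "period Y d"
  have nat: "period Y (int n * d)" for n
  proof (induction n)
    case 0
    show ?case by (simp add: period_def)
  next
    case (Suc n)
    then show ?case using period_add[OF d, of "int n * d"] by (simp add: algebra_simps)
  qed
  show ?thesis
  proof (cases "u \<ge> 0")
    case True
    then show ?thesis using nat[of "nat u"] by simp
  next
    case False
    then show ?thesis using period_uminus[OF nat[of "nat (- u)"]] by simp
  qed
qed

text \<open>Periods form a group, so by Bezout \<open>gcd d m\<close> is one. It is a proper divisor
  of \<open>m\<close>, and \<open>m div q\<close> is a multiple of it for every prime
  \<open>q\<close> dividing the cofactor.\<close>

lemma period_prime:
  assumes d: "period Y d" and nd: "\<not> m dvd d" and m: "0 < m" and per_m: "period Y m"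
  obtains q where "prime q" "q dvd m" "period Y (m div q)"
proof -
  obtain u v where uv: "u * d + v * m = gcd d m" using bezout_int by blast
  have per: "period Y (gcd d m)"
    using period_add[OF period_mult[OF d, of u] period_mult[OF per_m, of v]] uv by simp
  obtain e where e: "m = gcd d m * e" by (meson dvdE gcd_dvd2)
  have g: "gcd d m > 0" using m by simp
  have "e > 0" using e m g by (metis zero_less_mult_pos)
  moreover have "e \<noteq> 1"
  proof
    assume "e = 1"
    then have "gcd d m = m" using e by simp
    then show False using nd by (metis gcd_dvd1)
  qed
  ultimately obtain q where q: "prime q" "q dvd e" using prime_divisor_exists[of e] by auto
  then obtain f where f: "e = q * f" by blast
  have mq: "m = q * (gcd d m * f)" using e f by (simp add: algebra_simps)
  have "q \<noteq> 0" using q by auto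
  then have "m div q = gcd d m * f" using mq by (metis nonzero_mult_div_cancel_left)
  then have "period Y (m div q)" using period_mult[OF per, of f] by (simp add: mult.commute)
  moreover have "q dvd m" using mq by (metis dvd_triv_left)
  ultimately show ?thesis using that q by blast
qed

text \<open>Descending from \<open>j\<close> reaches every smaller integer, in particular
  \<open>l - w * m\<close> for large \<open>w\<close>; the period then leads back up to
  \<open>l\<close>.\<close>

lemma closed_pred_all:
  assumes per: "period E m" and m: "0 < (m :: int)" and pred: "\<And>j. j \<in> E \<Longrightarrow> j - 1 \<in> E" and j: "j \<in> E"
  shows "l \<in> E"
proof -
  have down: "j - int n \<in> E" for n
  proof (induction n)
    case (Suc n)
    then show ?case using pred[of "j - int n"] by (simp add: algebra_simps)
  qed (simp add: j)
  define w where "w = \<bar>l\<bar> + \<bar>j\<bar>"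
  have "w \<le> w * m" using m w_def mult_left_mono[of 1 m w] by simp
  then have "j + w * m - l \<ge> 0" using w_def by linarith
  then have "j - int (nat (j + w * m - l)) \<in> E" by (intro down)
  moreover have "j - int (nat (j + w * m - l)) = l + (- w) * m" using \<open>j + w * m - l \<ge> 0\<close> by simp
  ultimately show ?thesis using periodD[OF period_mult[OF per, of "- w"], of l] by metis
qed

text \<open>\<open>transversal\<close> speaks of one row, one column and one symbol in each block
  along cosets of the multiples of \<open>m div q\<close>. \<open>mixed\<close> describes a 2 x 2
  subsquare whose two row blocks, and whose two symbol blocks, are \<open>(m + 1) div 2\<close>
  apart: the row outside \<open>B\<close> meets \<open>s\<close> in the upper symbol block and
  \<open>t\<close> in the lower one, the row in \<open>B\<close> the other way round.\<close>

locale twisted_product =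
  fixes m :: int and a :: nat and F :: "int \<Rightarrow> int \<Rightarrow> nat \<Rightarrow> nat \<Rightarrow> nat"
    and B :: "nat set" and t :: nat and X :: "nat set"
  assumes m: "1 < m" and a: "2 < a" and t: "t < a"
    and B: "B \<subseteq> {..<a}" "B \<noteq> {}" "B \<noteq> {..<a}"
    and sq: "\<And>i y. square a (F i y)" and sf: "\<And>i y. subfree a (F i y)"
    and X: "\<And>i y. (\<lambda>r. F i y r t) ` B = X"
    and transversal: "\<And>q i j \<rho> \<sigma> \<xi>. prime q \<Longrightarrow> q dvd m \<Longrightarrow> (\<And>k. \<rho> k < a) \<Longrightarrow> (\<And>k. \<sigma> k < a) \<Longrightarrow>
      (\<And>u v. F ((i + u * (m div q)) mod m) ((i + j + (u + v) * (m div q)) mod m)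
           (\<rho> ((i + u * (m div q)) mod m)) (\<sigma> ((j + v * (m div q)) mod m)) =
         \<xi> ((i + j + (u + v) * (m div q)) mod m)) \<Longrightarrow> False"
    and mixed: "\<And>i y r r' s. odd m \<Longrightarrow> r < a \<Longrightarrow> r \<notin> B \<Longrightarrow> r' \<in> B \<Longrightarrow> s < a \<Longrightarrow> s \<noteq> t \<Longrightarrow>
      F i ((y + (m + 1) div 2) mod m) r s = F ((i - (m + 1) div 2) mod m) ((y + (m + 1) div 2) mod m) r' t \<Longrightarrow>
      F ((i - (m + 1) div 2) mod m) y r' s = F i y r t \<Longrightarrow> False"
begin

definition \<delta> :: "nat \<Rightarrow> nat \<Rightarrow> int" where
  "\<delta> r s = (if r \<in> B \<and> s = t then 1 else 0)"

definition P :: "int \<times> nat \<Rightarrow> int \<times> nat \<Rightarrow> int \<times> nat" where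
  "P \<rho> \<gamma> = (let y = (fst \<rho> + fst \<gamma> + \<delta> (snd \<rho>) (snd \<gamma>)) mod m in (y, F (fst \<rho>) y (snd \<rho>) (snd \<gamma>)))"

definition Z :: "(int \<times> nat) set" where
  "Z = {0..<m} \<times> {..<a}"

lemma P_pair: "P (i, r) (j, s) = ((i + j + \<delta> r s) mod m, F i ((i + j + \<delta> r s) mod m) r s)"
  by (simp add: P_def Let_def)

lemma finite_Z: "finite Z" and card_Z: "card Z = nat m * a"
  by (simp_all add: Z_def card_cartesian_product)

lemma mod_eqD: "x \<in> {0..<m} \<Longrightarrow> y \<in> {0..<m} \<Longrightarrow> (z + x) mod m = (z + y) mod m \<Longrightarrow> x = y"
proof -
  assume x: "x \<in> {0..<m}" "y \<in> {0..<m}" and "(z + x) mod m = (z + y) mod m"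
  then have "(z + x - z) mod m = (z + y - z) mod m" by (metis mod_diff_left_eq)
  then show "x = y" using x by simp
qed

lemma F_lt: "r < a \<Longrightarrow> s < a \<Longrightarrow> F i y r s < a"
  using squareD(1)[OF sq] .

lemma P_in: "\<rho> \<in> Z \<Longrightarrow> \<gamma> \<in> Z \<Longrightarrow> P \<rho> \<gamma> \<in> Z"
  using m F_lt by (auto simp: Z_def P_def Let_def)

lemma in_X: "r < a \<Longrightarrow> F i y r t \<in> X \<longleftrightarrow> r \<in> B"
proof
  assume "r < a" "F i y r t \<in> X"
  then have "F i y r t \<in> (\<lambda>r. F i y r t) ` B" by (simp only: X)
  then obtain r' where "r' \<in> B" "F i y r t = F i y r' t" by blast
  then show "r \<in> B" using squareD(3)[OF sq, of r r' t i y] \<open>r < a\<close> B(1) t by auto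
next
  assume "r \<in> B"
  then show "F i y r t \<in> X" using X[of i y] by blast
qed

lemma row_inj: "\<rho> \<in> Z \<Longrightarrow> inj_on (P \<rho>) Z"
proof (rule inj_onI)
  fix \<gamma> \<gamma>' assume \<rho>: "\<rho> \<in> Z" and \<gamma>: "\<gamma> \<in> Z" "\<gamma>' \<in> Z" and eq: "P \<rho> \<gamma> = P \<rho> \<gamma>'"
  obtain i r j s j' s' where p: "\<rho> = (i, r)" "\<gamma> = (j, s)" "\<gamma>' = (j', s')" by (metis surj_pair)
  have lt: "r < a" "s < a" "s' < a" "j \<in> {0..<m}" "j' \<in> {0..<m}" using \<rho> \<gamma> p by (auto simp: Z_def)
  have y: "(i + j + \<delta> r s) mod m = (i + j' + \<delta> r s') mod m" using eq p by (simp add: P_pair)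
  then have "s = s'" using eq p squareD(2)[OF sq lt(1-3)] by (simp add: P_pair)
  moreover have "j = j'" using mod_eqD[OF lt(4,5), of "i + \<delta> r s"] y \<open>s = s'\<close> by (simp add: algebra_simps)
  ultimately show "\<gamma> = \<gamma>'" using p by simp
qed

lemma col_inj: "\<gamma> \<in> Z \<Longrightarrow> inj_on (\<lambda>\<rho>. P \<rho> \<gamma>) Z"
proof (rule inj_onI)
  fix \<rho> \<rho>' assume \<gamma>: "\<gamma> \<in> Z" and \<rho>: "\<rho> \<in> Z" "\<rho>' \<in> Z" and eq: "P \<rho> \<gamma> = P \<rho>' \<gamma>"
  obtain i r i' r' j s where p: "\<rho> = (i, r)" "\<rho>' = (i', r')" "\<gamma> = (j, s)" by (metis surj_pair)
  have lt: "r < a" "r' < a" "s < a" "i \<in> {0..<m}" "i' \<in> {0..<m}" using \<rho> \<gamma> p by (auto simp: Z_def)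
  have y: "(i + j + \<delta> r s) mod m = (i' + j + \<delta> r' s) mod m" using eq p by (simp add: P_pair)
  then have x: "F i ((i + j + \<delta> r s) mod m) r s = F i' ((i + j + \<delta> r s) mod m) r' s" using eq p by (simp add: P_pair)
  \<comment> \<open>In column \<open>t\<close> the equal symbols lie both in \<open>X\<close> or
    both outside, so the two rows lie both in \<open>B\<close> or both outside.\<close>
  have "\<delta> r s = \<delta> r' s"
  proof (cases "s = t")
    case True
    then have "r \<in> B \<longleftrightarrow> r' \<in> B" using x in_X lt by metis
    then show ?thesis by (simp add: \<delta>_def)
  qed (simp add: \<delta>_def)
  then have "i = i'" using mod_eqD[OF lt(4,5), of "j + \<delta> r s"] y by (simp add: algebra_simps)
  then have "r = r'" using x squareD(3)[OF sq lt(1-3)] by simp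
  then show "\<rho> = \<rho>'" using p \<open>i = i'\<close> by simp
qed

lemma latin_P: "latin_on (nat m * a) Z Z P"
proof (rule latin_onI[where N = Z])
  show "bij_betw (P \<rho>) Z Z" if "\<rho> \<in> Z" for \<rho>
    using row_inj[OF that] P_in[OF that] finite_Z by (simp add: bij_betw_def endo_inj_surj image_subsetI)
  show "bij_betw (\<lambda>\<rho>. P \<rho> \<gamma>) Z Z" if "\<gamma> \<in> Z" for \<gamma>
    using col_inj[OF that] P_in[OF _ that] finite_Z by (simp add: bij_betw_def endo_inj_surj image_subsetI)
qed (simp_all add: finite_Z card_Z)

end

lemma card_1_eq: "card A = 1 \<Longrightarrow> x \<in> A \<Longrightarrow> y \<in> A \<Longrightarrow> x = y"
  by (auto simp: card_1_singleton_iff)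

lemma mod_add3: "(x mod m + y mod m + z) mod m = (x + y + z) mod (m :: int)"
  by (metis mod_add_eq mod_add_left_eq)

lemma mod_add_diff_mod: "(x + (i mod m - i)) mod m = x mod (m :: int)"
proof -
  have "x + (i mod m - i) = x + m * (- (i div m))" using mult_div_mod_eq[of m i] by (simp add: algebra_simps)
  then show ?thesis by (simp only: mod_mult_self2)
qed

section \<open>Block decomposition of a subsquare\<close>

locale twisted_subsquare = twisted_product +
  fixes R C N :: "(int \<times> nat) set"
  assumes RZ: "R \<subseteq> Z" and CZ: "C \<subseteq> Z"
    and row: "\<And>\<rho>. \<rho> \<in> R \<Longrightarrow> bij_betw (P \<rho>) C N"
    and col: "\<And>\<gamma>. \<gamma> \<in> C \<Longrightarrow> bij_betw (\<lambda>\<rho>. P \<rho> \<gamma>) R N"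
    and cards: "card R = card C" "2 \<le> card C" "card C < nat m * a"
begin

definition Rf :: "int \<Rightarrow> nat set" where "Rf i = {r. (i mod m, r) \<in> R}"
definition Cf :: "int \<Rightarrow> nat set" where "Cf j = {s. (j mod m, s) \<in> C}"
definition Nf :: "int \<Rightarrow> nat set" where "Nf y = {x. (y mod m, x) \<in> N}"

text \<open>Block \<open>j\<close> as met by a row \<open>(i, r)\<close> in symbols \<open>(i + j, x)\<close>: rows in \<open>B\<close> take column \<open>t\<close> from block \<open>j - 1\<close>.\<close>

definition Df :: "nat \<Rightarrow> int \<Rightarrow> nat set" where "Df r j = {s. ((j - \<delta> r s) mod m, s) \<in> C}"

definition Y :: "int set" where "Y = {y. Nf y \<noteq> {}}"

abbreviation G :: "int \<Rightarrow> int \<Rightarrow> nat \<Rightarrow> nat \<Rightarrow> nat" where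
  "G i y \<equiv> F (i mod m) (y mod m)"

lemma Rf_lt: "r \<in> Rf i \<Longrightarrow> r < a" and Cf_lt: "s \<in> Cf j \<Longrightarrow> s < a" and Df_lt: "s \<in> Df r j \<Longrightarrow> s < a"
  using RZ CZ by (auto simp: Rf_def Cf_def Df_def Z_def)

lemma Rf_sub: "Rf i \<subseteq> {..<a}" and Cf_sub: "Cf j \<subseteq> {..<a}" and Df_sub: "Df r j \<subseteq> {..<a}"
  using Rf_lt Cf_lt Df_lt by auto

lemma finite_Rf: "finite (Rf i)" and finite_Cf: "finite (Cf j)" and finite_Df: "finite (Df r j)"
  by (rule finite_subset[OF Rf_sub] finite_subset[OF Cf_sub] finite_subset[OF Df_sub], simp)+

lemma Rf_mod: "Rf (i mod m) = Rf i" and Cf_mod: "Cf (j mod m) = Cf j" and Nf_mod: "Nf (y mod m) = Nf y"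
  by (simp_all add: Rf_def Cf_def Nf_def)

lemma Df_mod: "Df r (j mod m) = Df r j"
  by (simp add: Df_def mod_diff_left_eq)

lemma Df_1: "r \<notin> B \<Longrightarrow> Df r j = Cf j"
  by (simp add: Df_def Cf_def \<delta>_def)

lemma Df_not_t: "s \<noteq> t \<Longrightarrow> s \<in> Df r j \<longleftrightarrow> s \<in> Cf j"
  by (simp add: Df_def Cf_def \<delta>_def)

lemma Df_0_t: "r \<in> B \<Longrightarrow> t \<in> Df r j \<longleftrightarrow> t \<in> Cf (j - 1)"
  by (simp add: Df_def Cf_def \<delta>_def)

lemma Df_0: "r \<in> B \<Longrightarrow> r' \<in> B \<Longrightarrow> Df r j = Df r' j"
  by (simp add: Df_def \<delta>_def)

lemma row_block: "r \<in> Rf i \<Longrightarrow> bij_betw (G i (i + j) r) (Df r j) (Nf (i + j))"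
proof -
  assume r: "r \<in> Rf i"
  then have r': "(i mod m, r) \<in> R" by (simp add: Rf_def)
  have "inj_on (G i (i + j) r) (Df r j)"
    using squareD(2)[OF sq] Rf_lt[OF r] Df_lt by (meson inj_onI)
  moreover have "G i (i + j) r s \<in> Nf (i + j)" if "s \<in> Df r j" for s
  proof -
    have "P (i mod m, r) ((j - \<delta> r s) mod m, s) \<in> N"
      using bij_betwE[OF row[OF r']] that by (simp add: Df_def)
    moreover have "(i mod m + (j - \<delta> r s) mod m + \<delta> r s) mod m = (i + j) mod m" by (simp add: mod_add3)
    ultimately show ?thesis by (simp add: P_pair Nf_def)
  qed
  moreover have "x \<in> G i (i + j) r ` Df r j" if "x \<in> Nf (i + j)" for x
  proof -
    have "((i + j) mod m, x) \<in> P (i mod m, r) ` C"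
      using row[OF r'] that by (simp add: bij_betw_def Nf_def)
    then obtain j' s where c: "(j', s) \<in> C" "((i + j) mod m, x) = P (i mod m, r) (j', s)" by auto
    then have y: "(i + j) mod m = (i mod m + j' + \<delta> r s) mod m" and x: "x = G i (i + j) r s"
      by (simp_all add: P_pair)
    have "j' mod m = (j - \<delta> r s) mod m"
    proof -
      have "(i + j - i - \<delta> r s) mod m = (i mod m + j' + \<delta> r s - i - \<delta> r s) mod m"
        using y by (metis mod_diff_left_eq)
      also have "i mod m + j' + \<delta> r s - i - \<delta> r s = j' + (i mod m - i)" by simp
      also have "(j' + (i mod m - i)) mod m = j' mod m" by (rule mod_add_diff_mod)
      finally show ?thesis by simp
    qed
    moreover have "j' mod m = j'" using c CZ by (auto simp: Z_def)
    ultimately have "s \<in> Df r j" using c by (simp add: Df_def)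
    then show ?thesis using x by blast
  qed
  ultimately show ?thesis by (auto simp: bij_betw_def)
qed

text \<open>A column keeps its block structure only if all rows of the subsquare shift it by the
  same amount \<open>d\<close>. This holds for every \<open>s \<noteq> t\<close>, and for
  \<open>t\<close> when the rows are all inside or all outside \<open>B\<close>.\<close>

lemma col_block:
  assumes s: "s \<in> Cf j" and d: "\<And>i r. (i, r) \<in> R \<Longrightarrow> \<delta> r s = d"
  shows "bij_betw (\<lambda>r. G i (i + j + d) r s) (Rf i) (Nf (i + j + d))"
proof -
  have s': "(j mod m, s) \<in> C" using s by (simp add: Cf_def)
  have "inj_on (\<lambda>r. G i (i + j + d) r s) (Rf i)"
    using squareD(3)[OF sq] Cf_lt[OF s] Rf_lt by (meson inj_onI)
  moreover have "G i (i + j + d) r s \<in> Nf (i + j + d)" if r: "r \<in> Rf i" for r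
  proof -
    have "(i mod m, r) \<in> R" using r by (simp add: Rf_def)
    then have "P (i mod m, r) (j mod m, s) \<in> N" "\<delta> r s = d" using bij_betwE[OF col[OF s']] d by auto
    then show ?thesis by (simp add: P_pair Nf_def mod_add3)
  qed
  moreover have "x \<in> (\<lambda>r. G i (i + j + d) r s) ` Rf i" if "x \<in> Nf (i + j + d)" for x
  proof -
    have "((i + j + d) mod m, x) \<in> (\<lambda>\<rho>. P \<rho> (j mod m, s)) ` R"
      using col[OF s'] that by (simp add: bij_betw_def Nf_def)
    then obtain i' r where c: "(i', r) \<in> R" "((i + j + d) mod m, x) = P (i', r) (j mod m, s)" by auto
    have dr: "\<delta> r s = d" using c d by blast
    then have y: "(i + j + d) mod m = (i' + j mod m + d) mod m" and x: "x = F i' ((i + j + d) mod m) r s"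
      using c by (simp_all add: P_pair)
    have "(i + j + d - j - d) mod m = (i' + j mod m + d - j - d) mod m" using y by (metis mod_diff_left_eq)
    then have "i mod m = (i' + (j mod m - j)) mod m" by (simp add: algebra_simps)
    also have "\<dots> = i' mod m" by (rule mod_add_diff_mod)
    finally have "i mod m = i' mod m" .
    moreover have "i' mod m = i'" using c RZ by (auto simp: Z_def)
    ultimately have "r \<in> Rf i" "x = G i (i + j + d) r s" using c x by (simp_all add: Rf_def)
    then show ?thesis by blast
  qed
  ultimately show ?thesis by (auto simp: bij_betw_def)
qed

lemma col_block_not_t: "s \<in> Cf j \<Longrightarrow> s \<noteq> t \<Longrightarrow> bij_betw (\<lambda>r. G i (i + j) r s) (Rf i) (Nf (i + j))"
  using col_block[of s j 0 i] by (simp add: \<delta>_def)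

lemma row_block_card: "r \<in> Rf i \<Longrightarrow> card (Df r j) = card (Nf (i + j))"
  using bij_betw_same_card[OF row_block] .

lemma col_block_card: "s \<in> Cf j \<Longrightarrow> s \<noteq> t \<Longrightarrow> card (Rf i) = card (Nf (i + j))"
  using bij_betw_same_card[OF col_block_not_t] .

lemma finite_C: "finite C"
  by (rule finite_subset[OF CZ finite_Z])

lemma R_ne: "R \<noteq> {}" and C_ne: "C \<noteq> {}"
  using cards by auto

lemma finite_N: "finite N"
proof -
  obtain \<rho> where "\<rho> \<in> R" using R_ne by blast
  from row[OF this] show ?thesis using finite_C by (metis bij_betw_finite)
qed

lemma finite_Nf: "finite (Nf y)"
proof -
  have "Nf y \<subseteq> snd ` N" by (force simp: Nf_def)
  then show ?thesis using finite_N finite_subset by blast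
qed

section \<open>Subsquares whose rows all see the same blocks\<close>

lemma period_Y_m: "period Y m"
  by (simp add: period_def Y_def Nf_def)

text \<open>Since each symbol block met has a single symbol, any choice of a row from
  \<open>A i\<close> and a column from \<open>D j\<close> has an entry that depends on
  \<open>i + j\<close> only. The families are left general because \<open>no_mixed\<close> selects
  only the rows outside \<open>B\<close>.\<close>

lemma no_transversal:
  assumes q: "prime q" "q dvd m"
    and A: "\<And>u. A (i + u * (m div q)) \<noteq> {}" "\<And>i. A i \<subseteq> {..<a}" "\<And>i. A (i mod m) = A i"
    and D: "\<And>v. D (j + v * (m div q)) \<noteq> {}" "\<And>j. D j \<subseteq> {..<a}" "\<And>j. D (j mod m) = D j"
    and in_N: "\<And>i j r s. r \<in> A i \<Longrightarrow> s \<in> D j \<Longrightarrow> G i (i + j) r s \<in> Nf (i + j)"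
    and card_N: "\<And>i j r s. r \<in> A i \<Longrightarrow> s \<in> D j \<Longrightarrow> card (Nf (i + j)) = 1"
  shows False
proof -
  let ?g = "m div q"
  \<comment> \<open>Blocks off the coset may be empty; the value 0 keeps the choice below
    \<open>a\<close> everywhere, as \<open>transversal\<close> demands.\<close>
  define \<rho> where "\<rho> k = (if A k = {} then 0 else SOME r. r \<in> A k)" for k
  define \<sigma> where "\<sigma> k = (if D k = {} then 0 else SOME r. r \<in> D k)" for k
  define \<xi> where "\<xi> k = (SOME x. x \<in> Nf k)" for k
  have \<rho>: "\<rho> k \<in> A k" if "A k \<noteq> {}" for k using that some_in_eq by (auto simp: \<rho>_def)
  have \<sigma>: "\<sigma> k \<in> D k" if "D k \<noteq> {}" for k using that some_in_eq by (auto simp: \<sigma>_def)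
  have "\<rho> k < a" for k
  proof (cases "A k = {}")
    case True then show ?thesis using a by (simp add: \<rho>_def)
  next
    case False then show ?thesis using \<rho>[of k] A(2)[of k] by auto
  qed
  moreover have "\<sigma> k < a" for k
  proof (cases "D k = {}")
    case True then show ?thesis using a by (simp add: \<sigma>_def)
  next
    case False then show ?thesis using \<sigma>[of k] D(2)[of k] by auto
  qed
  moreover have "F ((i + u * ?g) mod m) ((i + j + (u + v) * ?g) mod m)
      (\<rho> ((i + u * ?g) mod m)) (\<sigma> ((j + v * ?g) mod m)) = \<xi> ((i + j + (u + v) * ?g) mod m)" for u v
  proof -
    let ?i = "i + u * ?g" and ?j = "j + v * ?g"
    have y: "i + j + (u + v) * ?g = ?i + ?j" by (simp add: algebra_simps)
    have r: "\<rho> (?i mod m) \<in> A ?i" using \<rho>[of "?i mod m"] A by simp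
    have s: "\<sigma> (?j mod m) \<in> D ?j" using \<sigma>[of "?j mod m"] D by simp
    have "\<xi> ((?i + ?j) mod m) \<in> Nf (?i + ?j)"
      unfolding \<xi>_def Nf_mod using in_N[OF r s] some_in_eq by blast
    with card_N[OF r s] in_N[OF r s] show ?thesis unfolding y by (rule card_1_eq)
  qed
  ultimately show False using transversal[of q \<rho> \<sigma> i j \<xi>] q by blast
qed

text \<open>\<open>D j\<close> is the column block as every row of the subsquare sees it. Counting
  along rows and columns gives all nonempty blocks the same size \<open>c\<close>, and one block is
  then a subsquare of a single \<open>F i y\<close>, so \<open>c\<close> is 1 or at least
  \<open>a\<close>. The last premise rules out full blocks, a translation-stable transversal rules
  out 1.\<close>

lemma exact:
  assumes rb: "\<And>i j r. r \<in> Rf i \<Longrightarrow> bij_betw (G i (i + j) r) (D j) (Nf (i + j))"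
    and cb: "\<And>i j s. s \<in> D j \<Longrightarrow> bij_betw (\<lambda>r. G i (i + j) r s) (Rf i) (Nf (i + j))"
    and D: "\<And>j. D j \<subseteq> {..<a}" "\<And>j. D (j mod m) = D j" "D j0 \<noteq> {}"
    and full: "(\<forall>i. Rf i \<noteq> {..<a}) \<or> (\<forall>j. D j \<noteq> {..<a})"
  shows False
proof -
  obtain i0 r0 where "(i0, r0) \<in> R" using R_ne by auto
  then have i0: "r0 \<in> Rf i0" using RZ by (auto simp: Rf_def Z_def)
  define c where "c = card (D j0)"
  have finD: "finite (D j)" for j using D(1) finite_subset by blast
  have c_pos: "c > 0" using D(3) finD by (simp add: c_def card_gt_0_iff)
  have cD: "card (D j) = card (Nf (i + j))" if "r \<in> Rf i" for i j r
    using bij_betw_same_card[OF rb[OF that]] .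
  have cR: "card (Rf i) = card (Nf (i + j))" if "s \<in> D j" for i j s
    using bij_betw_same_card[OF cb[OF that]] .
  have Rf_c: "card (Rf i) = c" if r: "r \<in> Rf i" for i r
    using cD[OF r, of j0] cR[of _ j0 i] D(3) by (auto simp: c_def)
  have Df_c: "card (D j) = c" if s: "s \<in> D j" for j s
    using cD[OF i0, of j] cR[OF s, of i0] Rf_c[OF i0] by simp
  have N_c: "card (Nf (i + j)) = c" if "r \<in> Rf i" "s \<in> D j" for i j r s
    using cD[OF that(1), of j] Df_c[OF that(2)] by simp
  have in_N: "G i (i + j) r s \<in> Nf (i + j)" if "r \<in> Rf i" "s \<in> D j" for i j r s
    using bij_betwE[OF rb[OF that(1)]] that(2) by blast
  obtain s0 where s0: "s0 \<in> D j0" using D(3) by blast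
  have "c < 2 \<or> a \<le> c"
  proof -
    have "card (D j0) < 2 \<or> a \<le> card (D j0)"
    proof (rule sf[of "i0 mod m" "(i0 + j0) mod m", unfolded subfree_def, rule_format])
      show "Rf i0 \<subseteq> {..<a}" by (rule Rf_sub)
      show "card (Rf i0) = card (D j0)" using Rf_c[OF i0] by (simp add: c_def)
      show "card (Nf (i0 + j0)) = card (D j0)" using N_c[OF i0 s0] by (simp add: c_def)
    qed (use D(1) finite_Nf in_N in auto)
    then show ?thesis by (simp add: c_def)
  qed
  then show False
  proof
    assume "a \<le> c"
    then have "Rf i0 = {..<a}" "D j0 = {..<a}"
      using card_subset_eq[OF _ Rf_sub[of i0]] card_subset_eq[OF _ D(1)[of j0]] Rf_c[OF i0]
        card_mono[OF _ Rf_sub[of i0]] card_mono[OF _ D(1)[of j0]] by (auto simp: c_def)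
    then show False using full by blast
  next
    assume "c < 2"
    then have c1: "c = 1" using c_pos by simp
    have I: "Rf i \<noteq> {} \<longleftrightarrow> i + j \<in> Y" if ne: "D j \<noteq> {}" for i j
    proof -
      obtain s where "s \<in> D j" using ne by blast
      from cb[OF this, of i] show ?thesis by (auto simp: Y_def bij_betw_def)
    qed
    have J: "D j \<noteq> {} \<longleftrightarrow> i + j \<in> Y" if ne: "Rf i \<noteq> {}" for i j
    proof -
      obtain r where "r \<in> Rf i" using ne by blast
      from rb[OF this, of j] show ?thesis by (auto simp: Y_def bij_betw_def)
    qed
    obtain i r where ir: "(i, r) \<in> R" "(i, r) \<noteq> (i0, r0)"
    proof -
      have "\<not> R \<subseteq> {(i0, r0)}" using cards card_mono[of "{(i0, r0)}" R] by auto
      then show ?thesis using that by auto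
    qed
    have Ri: "r \<in> Rf i" using ir RZ by (auto simp: Rf_def Z_def)
    have "i \<noteq> i0"
    proof
      assume "i = i0"
      then have "r = r0" using card_1_eq[of "Rf i"] Rf_c[OF Ri] c1 Ri i0 by simp
      then show False using ir \<open>i = i0\<close> by simp
    qed
    moreover have "i mod m = i" "i0 mod m = i0" using ir(1) \<open>(i0, r0) \<in> R\<close> RZ by (auto simp: Z_def)
    ultimately have nd: "\<not> m dvd i - i0" by (metis mod_eq_dvd_iff)
    \<comment> \<open>\<open>Y\<close> shifted back by \<open>i\<close> and by \<open>i0\<close> is
      in both cases the set of \<open>j\<close> with \<open>D j\<close> nonempty.\<close>
    have per: "period Y (i - i0)"
      unfolding period_def
    proof
      fix y
      have "y \<in> Y \<longleftrightarrow> D (y - i0) \<noteq> {}" using J[of i0 "y - i0"] i0 by auto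
      also have "\<dots> \<longleftrightarrow> y + (i - i0) \<in> Y" using J[of i "y - i0"] Ri by (auto simp: algebra_simps)
      finally show "y \<in> Y \<longleftrightarrow> y + (i - i0) \<in> Y" .
    qed
    have "0 < m" using m by simp
    then obtain q where q: "prime q" "q dvd m" "period Y (m div q)"
      using period_prime[OF per nd _ period_Y_m] by blast
    have base: "i0 + j0 \<in> Y" using I[OF D(3)] i0 by auto
    show False
    proof (rule no_transversal[of q Rf i0 D j0])
      show "Rf (i0 + u * (m div q)) \<noteq> {}" for u
        using I[OF D(3), of "i0 + u * (m div q)"] periodD[OF period_mult[OF q(3)], of "i0 + j0" u] base
        by (simp add: algebra_simps)
      show "D (j0 + v * (m div q)) \<noteq> {}" for v
        using J[of i0 "j0 + v * (m div q)"] i0 periodD[OF period_mult[OF q(3)], of "i0 + j0" v] base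
        by (auto simp: algebra_simps)
      show "card (Nf (i + j)) = 1" if "r \<in> Rf i" "s \<in> D j" for i j r s using N_c[OF that] c1 by simp
    qed (use q Rf_sub Rf_mod D in_N in auto)
  qed
qed


text \<open>With rows of one kind only, or without column \<open>t\<close>, the perturbation merely
  relabels column blocks, or does nothing, and \<open>exact\<close> applies. Its premise on full
  blocks holds because every row block misses a row, or every column block misses
  \<open>t\<close>.\<close>

lemma not_exact:
  shows "\<exists>i r. r \<in> Rf i \<and> r \<notin> B" and "\<exists>i r. r \<in> Rf i \<and> r \<in> B" and "\<exists>j. t \<in> Cf j"
proof -
  obtain j s where "(j, s) \<in> C" using C_ne by auto
  then have s: "s \<in> Cf j" using CZ by (auto simp: Cf_def Z_def)
  have R_Rf: "(i, r) \<in> R \<Longrightarrow> r \<in> Rf i" for i r using RZ by (auto simp: Rf_def Z_def)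
  show "\<exists>i r. r \<in> Rf i \<and> r \<notin> B"
  proof (rule ccontr)
    assume none: "\<not> ?thesis"
    obtain b where b: "b \<in> B" using B by blast
    have Db: "Df r = Df b" if "r \<in> Rf i" for r i
    proof
      have "r \<in> B" using none that by blast
      then show "Df r l = Df b l" for l using b by (rule Df_0)
    qed
    have sh: "s \<in> Df b l \<Longrightarrow> s \<in> Cf (l - \<delta> b s)" for s l by (simp add: Df_def Cf_def)
    have \<delta>b: "\<delta> r s = \<delta> b s" if "(i, r) \<in> R" for r s i using none R_Rf[OF that] b by (auto simp: \<delta>_def)
    have "s \<in> Df b (j + \<delta> b s)" using s by (simp add: Df_def Cf_def)
    then show False
    proof (intro exact[of "Df b" "j + \<delta> b s"])
      fix i l r assume "r \<in> Rf i"
      then show "bij_betw (G i (i + l) r) (Df b l) (Nf (i + l))" using row_block[of r i l] Db[of r i] by simp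
    next
      fix i l s assume "s \<in> Df b l"
      then show "bij_betw (\<lambda>r. G i (i + l) r s) (Rf i) (Nf (i + l))"
        using col_block[OF sh, of s l "\<delta> b s" i] \<delta>b by simp
    next
      show "(\<forall>i. Rf i \<noteq> {..<a}) \<or> (\<forall>j. Df b j \<noteq> {..<a})" using none B by blast
    qed (use Df_sub Df_mod in auto)
  qed
  have one: False if r: "\<forall>i r. r \<in> Rf i \<longrightarrow> Df r = Cf"
    and d: "\<forall>i r j s. (i, r) \<in> R \<longrightarrow> s \<in> Cf j \<longrightarrow> \<delta> r s = 0"
    and f: "(\<forall>i. Rf i \<noteq> {..<a}) \<or> (\<forall>j. Cf j \<noteq> {..<a})"
    using s
  proof (intro exact[of Cf j])
    fix i l r assume "r \<in> Rf i"
    then show "bij_betw (G i (i + l) r) (Cf l) (Nf (i + l))" using row_block[of r i l] r by auto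
  next
    fix i l s assume "s \<in> Cf l"
    then show "bij_betw (\<lambda>r. G i (i + l) r s) (Rf i) (Nf (i + l))"
      using col_block[of s l 0 i] d by simp
  qed (use Cf_sub Cf_mod f in auto)
  show "\<exists>i r. r \<in> Rf i \<and> r \<in> B"
  proof (rule ccontr)
    assume none: "\<not> ?thesis"
    show False
    proof (rule one)
      show "\<forall>i r. r \<in> Rf i \<longrightarrow> Df r = Cf"
      proof (intro allI impI ext)
        fix i r l assume "r \<in> Rf i"
        then have "r \<notin> B" using none by blast
        then show "Df r l = Cf l" by (rule Df_1)
      qed
      show "\<forall>i r j s. (i, r) \<in> R \<longrightarrow> s \<in> Cf j \<longrightarrow> \<delta> r s = 0" using none R_Rf by (auto simp: \<delta>_def)
      show "(\<forall>i. Rf i \<noteq> {..<a}) \<or> (\<forall>j. Cf j \<noteq> {..<a})" using none B by blast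
    qed
  qed
  show "\<exists>j. t \<in> Cf j"
  proof (rule ccontr)
    assume none: "\<not> ?thesis"
    show False
    proof (rule one)
      show "\<forall>i r. r \<in> Rf i \<longrightarrow> Df r = Cf"
      proof (intro allI impI ext set_eqI)
        fix r l s
        show "s \<in> Df r l \<longleftrightarrow> s \<in> Cf l"
          using none Df_1[of r l] Df_0_t[of r l] Df_not_t[of s r l] by (cases "s = t"; cases "r \<in> B") simp_all
      qed
      show "\<forall>i r j s. (i, r) \<in> R \<longrightarrow> s \<in> Cf j \<longrightarrow> \<delta> r s = 0" using none by (auto simp: \<delta>_def)
      show "(\<forall>i. Rf i \<noteq> {..<a}) \<or> (\<forall>j. Cf j \<noteq> {..<a})" using none t by blast
    qed
  qed
qed

text \<open>Every row of a subsquare uses all of \<open>N\<close>. In columns of type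
  \<open>t\<close>, a row of \<open>B\<close> would place all of \<open>N\<close> in
  \<open>X\<close> and a row outside \<open>B\<close> all of it outside \<open>X\<close>, yet both
  kinds of rows occur.\<close>

lemma ex_not_t: "\<exists>j s. s \<in> Cf j \<and> s \<noteq> t"
proof (rule ccontr)
  assume none: "\<not> ?thesis"
  have all_t: "s = t" if js: "(j, s) \<in> C" for j s
  proof -
    have "s \<in> Cf j" using js CZ by (auto simp: Cf_def Z_def)
    then show ?thesis using none by blast
  qed
  have X_iff: "snd z \<in> X \<longleftrightarrow> r \<in> B" if r: "r \<in> Rf i" and z: "z \<in> N" for i r z
  proof -
    have "z \<in> P (i mod m, r) ` C" using row[of "(i mod m, r)"] r z by (simp add: Rf_def bij_betw_def)
    then obtain j s where "(j, s) \<in> C" "z = P (i mod m, r) (j, s)" by auto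
    moreover from this have "s = t" by (blast intro: all_t)
    ultimately show ?thesis using in_X[OF Rf_lt[OF r]] by (metis P_pair snd_conv)
  qed
  obtain \<rho> \<gamma> where "\<rho> \<in> R" "\<gamma> \<in> C" using R_ne C_ne by blast
  then have "P \<rho> \<gamma> \<in> N" using bij_betwE[OF row] by blast
  then show False using not_exact(1,2) X_iff by blast
qed

text \<open>Rows of both kinds occur. They see the same columns, except that rows in
  \<open>B\<close> see \<open>t\<close> one block later. Any column other than \<open>t\<close>
  links the counts, so that row blocks have size \<open>c1\<close> when they contain a row outside
  \<open>B\<close> and \<open>c0\<close> when they contain a row of \<open>B\<close>. Each order
  relation between \<open>c1\<close> and \<open>c0\<close> has its own contradiction.\<close>

lemma no_mixed: False
proof -
  define I1 where "I1 = {i. \<exists>r. r \<in> Rf i \<and> r \<notin> B}"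
  define I0 where "I0 = {i. \<exists>r. r \<in> Rf i \<and> r \<in> B}"
  define J' where "J' = {j. \<exists>s. s \<in> Cf j \<and> s \<noteq> t}"
  define E where "E = {j. t \<in> Cf j}"
  obtain b where b: "b \<in> B" using B by blast
  let ?C0 = "Df b"
  obtain i1 i0 where i1: "i1 \<in> I1" and i0: "i0 \<in> I0" using not_exact by (auto simp: I1_def I0_def)
  obtain j' where j': "j' \<in> J'" using ex_not_t by (auto simp: J'_def)
  obtain e where e: "e \<in> E" using not_exact by (auto simp: E_def)
  have I: "Rf i \<noteq> {} \<longleftrightarrow> i \<in> I1 \<or> i \<in> I0" for i by (auto simp: I1_def I0_def)
  have row1: "card (Nf (i + j)) = card (Cf j)" if "i \<in> I1" for i j
  proof -
    obtain r where "r \<in> Rf i" "r \<notin> B" using \<open>i \<in> I1\<close> unfolding I1_def by blast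
    then show ?thesis using row_block_card[of r i j] Df_1[of r j] by simp
  qed
  have row0: "card (Nf (i + j)) = card (?C0 j)" if "i \<in> I0" for i j
  proof -
    obtain r where "r \<in> Rf i" "r \<in> B" using \<open>i \<in> I0\<close> unfolding I0_def by blast
    then show ?thesis using row_block_card[of r i j] Df_0[of r b j] b by simp
  qed
  have colJ: "card (Rf i) = card (Nf (i + j))" if "j \<in> J'" for i j
  proof -
    obtain s where "s \<in> Cf j" "s \<noteq> t" using \<open>j \<in> J'\<close> unfolding J'_def by blast
    then show ?thesis by (rule col_block_card)
  qed
  define c1 where "c1 = card (Rf i1)"
  define c0 where "c0 = card (Rf i0)"
  have C1: "card (Cf j) = c1" if "j \<in> J'" for j
    using row1[OF i1, of j] colJ[OF that, of i1] by (simp add: c1_def)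
  have C0: "card (?C0 j) = c0" if "j \<in> J'" for j
    using row0[OF i0, of j] colJ[OF that, of i0] by (simp add: c0_def)
  have R1: "card (Rf i) = c1" if "i \<in> I1" for i
    using row1[OF that, of j'] colJ[OF j', of i] C1[OF j'] by simp
  have R0: "card (Rf i) = c0" if "i \<in> I0" for i
    using row0[OF that, of j'] colJ[OF j', of i] C0[OF j'] by simp
  have pos: "c1 > 0" "c0 > 0" using I i1 i0 finite_Rf unfolding c1_def c0_def by (metis card_gt_0_iff)+
  have C0_t: "t \<in> ?C0 j \<longleftrightarrow> t \<in> Cf (j - 1)" for j by (rule Df_0_t[OF b])
  have same: "?C0 j - {t} = Cf j - {t}" for j using Df_not_t by blast
  have gen: "card A = card (A - {t}) + (if t \<in> A then 1 else 0)" if "finite A" for A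
    using card.remove[OF that, of t] by simp
  \<comment> \<open>\<open>w\<close> counts the columns other than \<open>t\<close>, which both
    kinds of rows see alike; so the two sizes differ by at most 1.\<close>
  have cdiff: "\<exists>w. card (Cf j) = w + (if t \<in> Cf j then 1 else 0) \<and> card (?C0 j) = w + (if t \<in> ?C0 j then 1 else 0)" for j
    using gen[OF finite_Cf, of j] gen[OF finite_Df, of b j, unfolded same] by blast
  have R1D: "r \<in> Rf i \<Longrightarrow> r \<notin> B \<Longrightarrow> s \<in> Cf j \<Longrightarrow> G i (i + j) r s \<in> Nf (i + j)" for i j r s
    using bij_betwE[OF row_block[of r i j]] Df_1 by blast
  have R0D: "r \<in> Rf i \<Longrightarrow> r \<in> B \<Longrightarrow> s \<in> ?C0 j \<Longrightarrow> G i (i + j) r s \<in> Nf (i + j)" for i j r s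
    using bij_betwE[OF row_block[of r i j]] Df_0[OF _ b] by blast
  have E_per: "period E m" by (simp add: period_def E_def Cf_def)
  have m0: "0 < m" using m by simp
  have J'_C0: "j \<in> J'" if "s \<in> ?C0 j" "s \<noteq> t" for j s using that Df_not_t by (auto simp: J'_def)
  have subsq: "card (Rf i) < 2 \<or> a \<le> card (Rf i)"
    if "K \<subseteq> {..<a}" "card (Rf i) = card K" "card (Nf y) = card K"
      "\<And>r s. r \<in> Rf i \<Longrightarrow> s \<in> K \<Longrightarrow> G i y r s \<in> Nf y" for i y K
    using sf[of "i mod m" "y mod m", unfolded subfree_def, rule_format, of "Rf i" K "Nf y"] that Rf_sub finite_Nf
    by simp
  consider "c1 = c0" | "c1 > c0" | "c0 > c1" by linarith
  then show False
  proof cases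
    case 1
    have tC: "t \<in> Cf j \<longleftrightarrow> t \<in> ?C0 j" if "j \<in> J'" for j
      using cdiff[of j] unfolding C1[OF that] C0[OF that] using 1 by (auto split: if_splits)
    show False
    proof (cases "\<forall>j. Cf j \<noteq> {} \<longrightarrow> j \<in> J'")
      case True
      \<comment> \<open>A block of \<open>J'\<close> that contains \<open>t\<close> passes it on to
        its predecessor, so \<open>t\<close> is in every block. All rows then see the same blocks,
        of size at least 2 and hence \<open>a\<close>, which makes \<open>C\<close> the whole of
        \<open>Z\<close>.\<close>
      have "j \<in> E" for j
      proof (rule closed_pred_all[OF E_per m0 _ e])
        fix j assume "j \<in> E"
        then have "j \<in> J'" using True by (auto simp: E_def)
        then show "j - 1 \<in> E" using tC[of j] C0_t[of j] \<open>j \<in> E\<close> by (simp add: E_def)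
      qed
      then have tall: "t \<in> Cf j" and J'all: "j \<in> J'" for j using True by (auto simp: E_def)
      have C0C: "?C0 j = Cf j" for j using same[of j] tall[of j] tC[OF J'all, of j] by blast
      have sub: "card (Rf i1) < 2 \<or> a \<le> card (Rf i1)"
      proof (rule subsq[of "Cf j'" _ "i1 + j'"])
        show "card (Rf i1) = card (Cf j')" using C1[OF j'] by (simp add: c1_def)
        show "card (Nf (i1 + j')) = card (Cf j')" by (rule row1[OF i1])
        show "G i1 (i1 + j') r s \<in> Nf (i1 + j')" if "r \<in> Rf i1" "s \<in> Cf j'" for r s
          using R1D[OF that(1) _ that(2)] R0D[OF that(1), of s j'] that(2) C0C by blast
      qed (rule Cf_sub)
      have "c1 \<ge> 2"
      proof -
        obtain s where "s \<in> Cf j'" "s \<noteq> t" using j' by (auto simp: J'_def)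
        then have "card {s, t} \<le> card (Cf j')" using tall finite_Cf by (intro card_mono) auto
        then show ?thesis using C1[OF j'] \<open>s \<noteq> t\<close> by simp
      qed
      then have "a \<le> c1" using sub by (simp add: c1_def)
      then have full: "Cf j = {..<a}" for j
        using card_subset_eq[OF _ Cf_sub[of j]] card_mono[OF _ Cf_sub[of j]] C1[OF J'all, of j] by simp
      have "Z \<subseteq> C"
      proof
        fix z assume "z \<in> Z"
        then obtain j s where z: "z = (j, s)" "0 \<le> j" "j < m" "s < a" by (auto simp: Z_def)
        then have "s \<in> Cf j" using full by simp
        then show "z \<in> C" using z by (simp add: Cf_def)
      qed
      then have "card Z \<le> card C" using finite_C card_mono by blast
      then show False using cards card_Z by simp
    next
      case False
      \<comment> \<open>A block that consists of \<open>t\<close> alone carries one symbol for a row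
        outside \<open>B\<close>, and this forces size 1 everywhere.\<close>
      then obtain j0 where j0: "Cf j0 \<noteq> {}" "j0 \<notin> J'" by blast
      then have "Cf j0 = {t}" by (auto simp: J'_def)
      then have "card (Nf (i1 + j0)) = 1" using row1[OF i1, of j0] by simp
      then have "card (Rf (i1 + j0 - j')) = 1" using colJ[OF j', of "i1 + j0 - j'"] by simp
      then have c: "c1 = 1" "c0 = 1" using I[of "i1 + j0 - j'"] R1 R0 1 by fastforce+
      have disj: "i \<notin> I0" if "i \<in> I1" for i
      proof
        assume "i \<in> I0"
        then obtain r r' where "r \<in> Rf i" "r \<notin> B" "r' \<in> Rf i" "r' \<in> B"
          using \<open>i \<in> I1\<close> by (auto simp: I1_def I0_def)
        then show False using card_1_eq[of "Rf i" r r'] R1[OF \<open>i \<in> I1\<close>] c by simp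
      qed
      have J'_E: "j \<notin> E" if "j \<in> J'" for j
      proof
        assume "j \<in> E"
        then obtain s where "s \<in> Cf j" "s \<noteq> t" "t \<in> Cf j"
          using \<open>j \<in> J'\<close> by (auto simp: J'_def E_def)
        then show False using card_1_eq[of "Cf j" s t] C1[OF \<open>j \<in> J'\<close>] c by simp
      qed
      have J'_E1: "j - 1 \<notin> E" if "j \<in> J'" for j using J'_E[OF that] tC[OF that] C0_t by (simp add: E_def)
      have J: "Cf j \<noteq> {} \<longleftrightarrow> j \<in> J' \<or> j \<in> E" for j by (auto simp: J'_def E_def)
      have J0: "?C0 j \<noteq> {} \<longleftrightarrow> j \<in> J' \<or> j - 1 \<in> E" for j
        using C0_t[of j] same[of j] unfolding J'_def E_def by blast
      have Ydef: "y \<in> Y \<longleftrightarrow> 0 < card (Nf y)" for y using finite_Nf by (simp add: Y_def card_gt_0_iff)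
      have Y1: "i + j \<in> Y \<longleftrightarrow> j \<in> J' \<or> j \<in> E" if "i \<in> I1" for i j
        using row1[OF that, of j] J[of j] finite_Cf[of j] by (simp add: Ydef card_gt_0_iff)
      have Y0: "i + j \<in> Y \<longleftrightarrow> j \<in> J' \<or> j - 1 \<in> E" if "i \<in> I0" for i j
        using row0[OF that, of j] J0[of j] finite_Df[of b j] by (simp add: Ydef card_gt_0_iff)
      have YJ: "i + j \<in> Y \<longleftrightarrow> i \<in> I1 \<or> i \<in> I0" if "j \<in> J'" for i j
        using colJ[OF that, of i] I[of i] finite_Rf[of i] Ydef[of "i + j"] by (metis card_gt_0_iff)
      have N1: "card (Nf y) = 1" if "y \<in> Y" for y
        using YJ[OF j', of "y - j'"] colJ[OF j', of "y - j'"] R1 R0 c that by auto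
      \<comment> \<open>Such a period would let the rows of block \<open>i\<close> and those of
        block \<open>i'\<close> see the same nonempty blocks. As \<open>J'\<close> misses
        \<open>E\<close>, this closes \<open>E\<close> under predecessors, and \<open>E\<close>
        would swallow \<open>J'\<close>.\<close>
      have caseA: False if per: "period Y (i - i')" and i: "i \<in> I1" "i' \<in> I0" for i i'
      proof -
        have eq: "j \<in> J' \<or> j \<in> E \<longleftrightarrow> j \<in> J' \<or> j - 1 \<in> E" for j
          using Y1[OF i(1), of j] Y0[OF i(2), of j] periodD[OF per, of "i' + j"] by (simp add: algebra_simps)
        have "j' \<in> E"
        proof (rule closed_pred_all[OF E_per m0 _ e])
          fix j assume "j \<in> E"
          then show "j - 1 \<in> E" using eq[of j] J'_E by blast
        qed
        then show False using J'_E[OF j'] by blast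
      qed
      show False
      proof (cases "\<exists>d. period Y d \<and> \<not> m dvd d")
        case True
        then obtain d where d: "period Y d" "\<not> m dvd d" by blast
        obtain q where q: "prime q" "q dvd m" "period Y (m div q)"
          by (rule period_prime[OF d m0 period_Y_m])
        let ?g = "m div q"
        \<comment> \<open>Every index in the coset of \<open>i1\<close> lies in \<open>I1\<close> or
          \<open>I0\<close>, and \<open>caseA\<close> excludes \<open>I0\<close>. So the rows
          outside \<open>B\<close> alone form a transversal that is stable under
          translation.\<close>
        have I1_stable: "i1 + u * ?g \<in> I1" for u
        proof -
          have "i1 + u * ?g + j' \<in> Y"
            using periodD[OF period_mult[OF q(3)], of "i1 + j'" u] YJ[OF j', of i1] i1 by (simp add: algebra_simps)
          moreover have "i1 + u * ?g \<notin> I0"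
          proof
            assume "i1 + u * ?g \<in> I0"
            then show False using caseA[OF _ i1, of "i1 + u * ?g"] period_mult[OF q(3), of "- u"] by simp
          qed
          ultimately show ?thesis using YJ[OF j', of "i1 + u * ?g"] by blast
        qed
        show False
        proof (rule no_transversal[of q "\<lambda>i. Rf i - B" i1 Cf j'])
          show "Rf (i1 + u * ?g) - B \<noteq> {}" for u using I1_stable[of u] by (auto simp: I1_def)
          show "Cf (j' + v * ?g) \<noteq> {}" for v
            using periodD[OF period_mult[OF q(3)], of "i1 + j'" v] Y1[OF i1, of j'] Y1[OF i1, of "j' + v * ?g"] j' J
            by (simp add: algebra_simps)
          show "card (Nf (i + j)) = 1" if "r \<in> Rf i - B" "s \<in> Cf j" for i j r s
            using R1D[of r i s j] that N1[of "i + j"] by (auto simp: Y_def)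
        qed (use q Rf_sub Rf_mod Cf_sub Cf_mod R1D in auto)
      next
        case False
        then have triv: "m dvd d" if "period Y d" for d using that by blast
        have per1: "period Y (i - i1)" if "i \<in> I1" for i
        proof -
          have "y \<in> Y \<longleftrightarrow> y + (i - i1) \<in> Y" for y
            using Y1[OF i1, of "y - i1"] Y1[OF that, of "y - i1"] by (simp add: algebra_simps)
          then show ?thesis by (simp add: period_def)
        qed
        have per0: "period Y (i - i0)" if "i \<in> I0" for i
        proof -
          have "y \<in> Y \<longleftrightarrow> y + (i - i0) \<in> Y" for y
            using Y0[OF i0, of "y - i0"] Y0[OF that, of "y - i0"] by (simp add: algebra_simps)
          then show ?thesis by (simp add: period_def)
        qed
        have perJ: "period Y (j - j')" if "j \<in> J'" for j
        proof -
          have "y \<in> Y \<longleftrightarrow> y + (j - j') \<in> Y" for y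
            using YJ[OF j', of "y - j'"] YJ[OF that, of "y - j'"] by (simp add: algebra_simps)
          then show ?thesis by (simp add: period_def)
        qed
        define d where "d = i1 - i0"
        have nd: "\<not> m dvd d"
        proof
          assume "m dvd d"
          then obtain k where "d = k * m" by (metis dvd_def mult.commute)
          then show False using caseA[OF _ i1 i0] period_mult[OF period_Y_m, of k] by (simp add: d_def)
        qed
        \<comment> \<open>With trivial periods only, \<open>I1\<close>, \<open>I0\<close> and
          \<open>J'\<close> are single classes modulo \<open>m\<close>, and \<open>Y\<close>
          consists of the classes of \<open>i1 + j'\<close> and \<open>i0 + j'\<close>. Row block
          \<open>i1\<close> must reach the second through \<open>t\<close> in block
          \<open>j' - d\<close>, and row block \<open>i0\<close> the first through \<open>t\<close>
          in block \<open>j' + d - 1\<close>, raised by 1.\<close>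
        have E1: "j' - d \<in> E"
        proof -
          have "i1 + (j' - d) \<in> Y" using YJ[OF j', of i0] i0 by (simp add: d_def algebra_simps)
          moreover have "j' - d \<notin> J'" using triv[OF perJ, of "j' - d"] nd by auto
          ultimately show ?thesis using Y1[OF i1] by blast
        qed
        have E2: "j' + d - 1 \<in> E"
        proof -
          have "i0 + (j' + d) \<in> Y" using YJ[OF j', of i1] i1 by (simp add: d_def algebra_simps)
          moreover have "j' + d \<notin> J'" using triv[OF perJ, of "j' + d"] nd by auto
          ultimately show ?thesis using Y0[OF i0] by blast
        qed
        \<comment> \<open>Seen from \<open>i1\<close>, block \<open>j' + d - 1\<close> also yields
          an element of \<open>Y\<close>, in the class of \<open>i1 + j'\<close> or of
          \<open>i0 + j'\<close>. The former would put \<open>t\<close> into block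
          \<open>j'\<close>; the latter is the claim.\<close>
        have dm: "m dvd 2 * d - 1"
        proof -
          let ?i = "i1 + (j' + d - 1) - j'"
          have "?i + j' \<in> Y" using Y1[OF i1, of "j' + d - 1"] E2 by (simp add: algebra_simps)
          then have "?i \<in> I1 \<or> ?i \<in> I0" using YJ[OF j'] by blast
          then show ?thesis
          proof
            assume "?i \<in> I1"
            from triv[OF per1[OF this]] have "m dvd d - 1" by (simp add: algebra_simps)
            then obtain k where "d - 1 = k * m" by (metis dvd_def mult.commute)
            then have "j' + d - 1 = j' + k * m" by simp
            then have "j' \<in> E" using E2 periodD[OF period_mult[OF E_per], of j' k] by metis
            then show ?thesis using J'_E j' by blast
          next
            assume "?i \<in> I0"
            from triv[OF per0[OF this]] show ?thesis by (simp add: d_def algebra_simps)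
          qed
        qed
        have odd: "odd m"
        proof
          assume "even m"
          then have "even (2 * d - 1)" using dm by (rule dvd_trans)
          then show False by simp
        qed
        \<comment> \<open>The inverse of 2 modulo \<open>m\<close>, to which \<open>d\<close> is
          therefore congruent. What is left is the 2 x 2 subsquare described by
          \<open>mixed\<close>.\<close>
        define h where "h = (m + 1) div 2"
        have h2: "2 * h = m + 1" using odd by (auto simp: h_def elim: oddE)
        have "m dvd 2 * (d - h)"
        proof -
          have "2 * (d - h) = (2 * d - 1) - m" using h2 by simp
          also have "m dvd \<dots>" by (rule dvd_diff[OF dm dvd_refl])
          finally show ?thesis .
        qed
        then have dh: "m dvd d - h" using odd by (metis coprime_dvd_mult_right_iff coprime_right_2_iff_odd)
        obtain r r' s where r: "r \<in> Rf i1" "r \<notin> B" and r': "r' \<in> Rf i0" "r' \<in> B" and s: "s \<in> Cf j'" "s \<noteq> t"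
          using i1 i0 j' by (auto simp: I1_def I0_def J'_def)
        define y where "y = i0 + j'"
        have i0h: "(i1 mod m - h) mod m = i0 mod m"
        proof -
          have "(i1 - h) mod m = i0 mod m" using dh by (simp add: mod_eq_dvd_iff d_def algebra_simps)
          then show ?thesis by (simp add: mod_diff_left_eq)
        qed
        have yh: "(y mod m + h) mod m = (i1 + j') mod m"
        proof -
          have "i1 + j' - (y + h) = d - h" by (simp add: y_def d_def)
          then have "(i1 + j') mod m = (y + h) mod m" using dh by (simp only: mod_eq_dvd_iff)
          then show ?thesis by (simp add: mod_add_left_eq)
        qed
        show False
        proof (rule mixed[of r r' s "i1 mod m" "y mod m"])
          have "G i1 (i1 + j') r s \<in> Nf (i1 + j')" by (rule R1D[OF r s(1)])
          moreover have "G i0 (i0 + (j' + d)) r' t \<in> Nf (i0 + (j' + d))"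
            using R0D[OF r', of t "j' + d"] C0_t E2 by (simp add: E_def)
          moreover have "i0 + (j' + d) = i1 + j'" by (simp add: d_def)
          ultimately have "G i1 (i1 + j') r s \<in> Nf (i1 + j')" "G i0 (i1 + j') r' t \<in> Nf (i1 + j')" by simp_all
          moreover have "card (Nf (i1 + j')) = 1" using N1 YJ[OF j'] i1 by blast
          ultimately show "F (i1 mod m) ((y mod m + (m + 1) div 2) mod m) r s =
            F ((i1 mod m - (m + 1) div 2) mod m) ((y mod m + (m + 1) div 2) mod m) r' t"
            unfolding h_def[symmetric] i0h yh by (blast intro: card_1_eq)
          have "s \<in> ?C0 j'" using s Df_not_t by blast
          then have "G i0 y r' s \<in> Nf y" unfolding y_def by (rule R0D[OF r'])
          moreover have "G i1 (i1 + (j' - d)) r t \<in> Nf (i1 + (j' - d))"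
            using R1D[OF r, of t "j' - d"] E1 by (simp add: E_def)
          moreover have "i1 + (j' - d) = y" by (simp add: d_def y_def)
          ultimately have "G i0 y r' s \<in> Nf y" "G i1 y r t \<in> Nf y" by simp_all
          moreover have "card (Nf y) = 1" using N1 YJ[OF j'] i0 by (simp add: y_def)
          ultimately show "F ((i1 mod m - (m + 1) div 2) mod m) (y mod m) r' s = F (i1 mod m) (y mod m) r t"
            unfolding h_def[symmetric] i0h by (blast intro: card_1_eq)
        qed (use odd r r' s Rf_lt Cf_lt in auto)
      qed
    qed
  next
    case 2
    have tJ: "t \<in> Cf j \<and> t \<notin> ?C0 j \<and> c1 = c0 + 1" if "j \<in> J'" for j
      using cdiff[of j] unfolding C1[OF that] C0[OF that] using 2 by (auto split: if_splits)
    \<comment> \<open>Seen from rows in \<open>B\<close>, block \<open>j' + 1\<close> holds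
      \<open>t\<close> and, not being in \<open>J'\<close>, nothing else. This forces
      \<open>c0 = 1\<close> and \<open>c1 = 2\<close>, and then the rows of block \<open>i1\<close>
      are all outside \<open>B\<close> and carry a 2 x 2 subsquare of a single
      \<open>F i y\<close>.\<close>
    have "t \<in> ?C0 (j' + 1)" using tJ[OF j'] C0_t[of "j' + 1"] by simp
    then have "j' + 1 \<notin> J'" using tJ by blast
    then have "?C0 (j' + 1) = {t}" using \<open>t \<in> ?C0 (j' + 1)\<close> J'_C0 by blast
    then have "card (Nf (i0 + (j' + 1))) = 1" using row0[OF i0, of "j' + 1"] by simp
    then have "card (Rf (i0 + 1)) = 1" using colJ[OF j', of "i0 + 1"] by (simp add: algebra_simps)
    then have "c1 = 1 \<or> c0 = 1" using I[of "i0 + 1"] R1 R0 by force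
    then have c: "c0 = 1" "c1 = 2" using tJ[OF j'] pos by auto
    have nB: "r \<notin> B" if "r \<in> Rf i1" for r
    proof
      assume "r \<in> B"
      then have "i1 \<in> I0" using that by (auto simp: I0_def)
      then show False using R1[OF i1] R0 c by fastforce
    qed
    have "card (Rf i1) < 2 \<or> a \<le> card (Rf i1)"
    proof (rule subsq[of "Cf j'" _ "i1 + j'"])
      show "card (Rf i1) = card (Cf j')" using C1[OF j'] by (simp add: c1_def)
      show "card (Nf (i1 + j')) = card (Cf j')" by (rule row1[OF i1])
      show "G i1 (i1 + j') r s \<in> Nf (i1 + j')" if "r \<in> Rf i1" "s \<in> Cf j'" for r s
        using R1D that nB by blast
    qed (rule Cf_sub)
    then show False using c a by (simp add: c1_def)
  next
    case 3
    have tJ: "t \<notin> Cf j \<and> t \<in> ?C0 j \<and> c0 = c1 + 1" if "j \<in> J'" for j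
      using cdiff[of j] unfolding C1[OF that] C0[OF that] using 3 by (auto split: if_splits)
    \<comment> \<open>The mirror image: seen from rows outside \<open>B\<close>, block
      \<open>j' - 1\<close> holds only \<open>t\<close>.\<close>
    have tj: "t \<in> Cf (j' - 1)" using tJ[OF j'] C0_t[of j'] by simp
    then have "j' - 1 \<notin> J'" using tJ by blast
    then have "Cf (j' - 1) = {t}" using tj unfolding J'_def by blast
    then have "card (Nf (i1 + (j' - 1))) = 1" using row1[OF i1, of "j' - 1"] by simp
    then have "card (Rf (i1 - 1)) = 1" using colJ[OF j', of "i1 - 1"] by (simp add: algebra_simps)
    then have "c1 = 1 \<or> c0 = 1" using I[of "i1 - 1"] R1 R0 by force
    then have c: "c1 = 1" "c0 = 2" using tJ[OF j'] pos by auto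
    have nB: "r \<in> B" if "r \<in> Rf i0" for r
    proof (rule ccontr)
      assume "r \<notin> B"
      then have "i0 \<in> I1" using that by (auto simp: I1_def)
      then show False using R0[OF i0] R1 c by fastforce
    qed
    have "card (Rf i0) < 2 \<or> a \<le> card (Rf i0)"
    proof (rule subsq[of "?C0 j'" _ "i0 + j'"])
      show "card (Rf i0) = card (?C0 j')" using C0[OF j'] by (simp add: c0_def)
      show "card (Nf (i0 + j')) = card (?C0 j')" by (rule row0[OF i0])
      show "G i0 (i0 + j') r s \<in> Nf (i0 + j')" if "r \<in> Rf i0" "s \<in> ?C0 j'" for r s
        using R0D that nB by blast
    qed (rule Df_sub)
    then show False using c a by (simp add: c0_def)
  qed
qed

end

theorem (in twisted_product) N_infinity_exists: "has_N_infinity (nat m * a)"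
proof (rule N_infinityI[OF latin_P])
  fix k R C assume sub: "R \<subseteq> Z" "C \<subseteq> Z" and "latin_on k R C P" and k: "2 \<le> k" "k < nat m * a"
  then obtain N where "card R = k" "card C = k" "\<forall>r\<in>R. bij_betw (P r) C N" "\<forall>c\<in>C. bij_betw (\<lambda>r. P r c) R N"
    using latin_on_bij by blast
  then interpret twisted_subsquare m a F B t X R C N
    using sub k by unfold_locales auto
  show False by (rule no_mixed)
qed

section \<open>Digits\<close>

text \<open>For a prime \<open>q\<close> dividing \<open>m\<close>, this is the leading digit of
  \<open>i\<close> modulo the exact power of \<open>q\<close> in \<open>m\<close>, so it depends on
  \<open>i mod m\<close> only. The leading one is taken because \<open>m div q\<close> is divisible
  by all lower powers of \<open>q\<close>: translation by it permutes the \<open>q\<close> values in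
  one cycle.\<close>

definition digit :: "int \<Rightarrow> int \<Rightarrow> int \<Rightarrow> int" where
  "digit m q i = (i div q ^ (multiplicity q m - 1)) mod q"

lemma digit_add:
  assumes "q > 0"
  shows "digit m q (i + z * q ^ (multiplicity q m - 1)) = (digit m q i + z) mod q"
  using assms by (simp add: digit_def mod_simps add.commute)

lemma prime_power_split:
  fixes m q :: int
  assumes m: "m > 0" and q: "prime q" "q dvd m"
  obtains c where "m = q ^ (multiplicity q m - 1) * (q * c)" "coprime c q"
proof -
  have nu: "\<not> is_unit q" using q by auto
  obtain c where c: "m = q ^ multiplicity q m * c" "\<not> q dvd c"
    using multiplicity_decompose'[of m q] m nu by auto
  have "multiplicity q m > 0" using q m prime_multiplicity_gt_zero_iff[OF prime_imp_prime_elem[OF q(1)], of m] by simp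
  then obtain e where e: "multiplicity q m = Suc e" using gr0_conv_Suc by blast
  have "q ^ multiplicity q m * c = q ^ e * (q * c)" unfolding e by (simp add: mult_ac)
  moreover have "multiplicity q m - 1 = e" using e by simp
  ultimately have "m = q ^ (multiplicity q m - 1) * (q * c)" using c(1) by metis
  moreover have "coprime c q" using prime_imp_coprime[OF q(1) c(2)] by (simp add: coprime_commute)
  ultimately show ?thesis using that by blast
qed

lemma digit_cong:
  fixes m q :: int
  assumes m: "m > 0" and q: "prime q" "q dvd m" and d: "q ^ multiplicity q m dvd d"
  shows "digit m q (i + u * d) = digit m q i"
proof -
  have q0: "q > 0" using q prime_gt_0_int by blast
  have "multiplicity q m > 0" using q m prime_multiplicity_gt_zero_iff[OF prime_imp_prime_elem[OF q(1)], of m] by simp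
  then obtain e where e: "multiplicity q m = Suc e" using gr0_conv_Suc by blast
  obtain k where "d = q ^ multiplicity q m * k" using d by blast
  then have "i + u * d = i + (u * k * q) * q ^ (multiplicity q m - 1)" using e by (simp add: mult_ac)
  then have "digit m q (i + u * d) = (digit m q i + u * k * q) mod q" using digit_add[OF q0] by (simp only:)
  then show ?thesis by (simp add: digit_def)
qed

lemma digit_mod:
  assumes "m > 0" "prime q" "q dvd m"
  shows "digit m q (i mod m) = digit m q i"
proof -
  have "i mod m = i + (- (i div m)) * m" using div_mult_mod_eq[of i m] by (simp add: algebra_simps)
  then show ?thesis using digit_cong[OF assms, of m i "- (i div m)"] by (simp add: multiplicity_dvd)
qed

text \<open>Division by \<open>q\<close> leaves the full power of \<open>q'\<close> in
  \<open>m div q\<close>, so the translation is invisible to the digit for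
  \<open>q'\<close>.\<close>

lemma digit_other:
  fixes m q q' :: int
  assumes m: "m > 0" and q: "prime q" "q dvd m" and q': "prime q'" "q' dvd m" "q' \<noteq> q"
  shows "digit m q' (i + u * (m div q)) = digit m q' i"
proof (rule digit_cong[OF m q'(1,2)])
  have "coprime q' q" using q(1) q'(1,3) by (simp add: primes_coprime)
  then have "coprime (q' ^ multiplicity q' m) q" by simp
  moreover have "q' ^ multiplicity q' m dvd q * (m div q)" using q(2) by (simp add: multiplicity_dvd)
  ultimately show "q' ^ multiplicity q' m dvd m div q" by (simp add: coprime_dvd_mult_right_iff)
qed

lemma digit_step:
  fixes m q :: int
  assumes m: "m > 0" and q: "prime q" "q dvd m"
  obtains c where "coprime c q" "\<And>i u. digit m q (i + u * (m div q)) = (digit m q i + u * c) mod q"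
proof -
  have q0: "q > 0" using q prime_gt_0_int by blast
  obtain c where c: "m = q ^ (multiplicity q m - 1) * (q * c)" "coprime c q" by (rule prime_power_split[OF m q])
  have "m = q * (q ^ (multiplicity q m - 1) * c)" using c(1) by (simp add: mult_ac)
  then have "m div q = q ^ (multiplicity q m - 1) * c"
    using q0 by (metis nonzero_mult_div_cancel_left less_irrefl)
  then have "u * (m div q) = (u * c) * q ^ (multiplicity q m - 1)" for u by (simp add: mult_ac)
  then have "digit m q (i + u * (m div q)) = (digit m q i + u * c) mod q" for i u
    using digit_add[OF q0, of m i "u * c"] by (simp only:)
  then show ?thesis using that c(2) by blast
qed

lemma digit_eq_iff:
  fixes m q :: int
  assumes "m > 0" "prime q" "q dvd m"
  shows "digit m q (i + u * (m div q)) = digit m q (i + v * (m div q)) \<longleftrightarrow> q dvd u - v"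
proof -
  obtain c where c: "coprime c q" "\<And>i u. digit m q (i + u * (m div q)) = (digit m q i + u * c) mod q"
    using digit_step[OF assms] by blast
  have "digit m q i + u * c - (digit m q i + v * c) = c * (u - v)" by (simp add: algebra_simps)
  moreover have "coprime q c" using c(1) by (simp add: coprime_commute)
  ultimately show ?thesis unfolding c(2) mod_eq_dvd_iff by (simp only: coprime_dvd_mult_right_iff)
qed

text \<open>Each step moves the digit by a unit \<open>c\<close> modulo \<open>q\<close>; an inverse
  of \<open>c\<close> from Bezout tells how many steps lead to \<open>d\<close>.\<close>

lemma digit_hit:
  fixes m q :: int
  assumes "m > 0" "prime q" "q dvd m" and d: "0 \<le> d" "d < q"
  obtains u where "digit m q (i + u * (m div q)) = d"
proof -
  obtain c where c: "coprime c q" "\<And>i u. digit m q (i + u * (m div q)) = (digit m q i + u * c) mod q"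
    using digit_step[OF assms(1-3)] by blast
  obtain c' k where "c' * c + k * q = 1" using bezout_int[of c q] c(1) by auto
  then have "c * c' - 1 = q * (- k)" by (simp add: algebra_simps)
  then have "q dvd c * c' - 1" by simp
  then have "q dvd (c * c' - 1) * (d - digit m q i)" by simp
  moreover have "(c * c' - 1) * (d - digit m q i) = digit m q i + (d - digit m q i) * c' * c - d"
    by (simp add: algebra_simps)
  ultimately have "(digit m q i + (d - digit m q i) * c' * c) mod q = d mod q" by (simp only: mod_eq_dvd_iff)
  then show ?thesis using that[of "(d - digit m q i) * c'"] c(2) d by simp
qed

text \<open>
  A transversal stable under translation by \<open>m div q\<close> runs through all digits of \<open>i\<close> at a symbol block with digit \<open>0\<close>.
  Some of its rows are then active and some are not, which no transversal of a fixed square tolerates.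
\<close>

definition active :: "int \<Rightarrow> int \<Rightarrow> int \<Rightarrow> int \<Rightarrow> bool" where
  "active m q i y \<longleftrightarrow> 2 * digit m q i + 1 < q \<and> digit m q y = 0"

definition parity_except :: "int \<Rightarrow> int \<Rightarrow> int \<Rightarrow> int \<Rightarrow> bool" where
  "parity_except m p i y \<longleftrightarrow> odd (card {q. prime q \<and> odd q \<and> q dvd m \<and> q \<noteq> p \<and> active m q i y})"

text \<open>A parity merges the demands of all odd primes into one bit. A translation by
  \<open>m div q\<close> can change only the summand of \<open>q\<close>, so each prime can be
  treated as if it were alone.\<close>

definition eps :: "int \<Rightarrow> int \<Rightarrow> int \<Rightarrow> bool" where
  "eps m i y \<longleftrightarrow> odd (card {q. prime q \<and> odd q \<and> q dvd m \<and> active m q i y})"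

lemma active_mod:
  assumes "m > 0" "prime q" "q dvd m"
  shows "active m q (i mod m) y = active m q i y" and "active m q i (y mod m) = active m q i y"
  by (simp_all add: active_def digit_mod[OF assms])

lemma eps_mod:
  assumes "m > 0"
  shows "eps m (i mod m) y = eps m i y" and "eps m i (y mod m) = eps m i y"
proof -
  have "{q. prime q \<and> odd q \<and> q dvd m \<and> active m q (i mod m) y} = {q. prime q \<and> odd q \<and> q dvd m \<and> active m q i y}"
    using active_mod(1)[OF assms] by blast
  then show "eps m (i mod m) y = eps m i y" by (simp add: eps_def)
  have "{q. prime q \<and> odd q \<and> q dvd m \<and> active m q i (y mod m)} = {q. prime q \<and> odd q \<and> q dvd m \<and> active m q i y}"
    using active_mod(2)[OF assms] by blast
  then show "eps m i (y mod m) = eps m i y" by (simp add: eps_def)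
qed

lemma parity_except_step:
  assumes m: "m > 0" and q: "prime q" "q dvd m"
  shows "parity_except m q (i + u * (m div q)) (y + w * (m div q)) = parity_except m q i y"
proof -
  have "active m q' (i + u * (m div q)) (y + w * (m div q)) = active m q' i y"
    if "prime q'" "q' dvd m" "q' \<noteq> q" for q' by (simp add: active_def digit_other[OF m q that])
  then have "{q'. prime q' \<and> odd q' \<and> q' dvd m \<and> q' \<noteq> q \<and> active m q' (i + u * (m div q)) (y + w * (m div q))} =
    {q'. prime q' \<and> odd q' \<and> q' dvd m \<and> q' \<noteq> q \<and> active m q' i y}" by blast
  then show ?thesis by (simp add: parity_except_def)
qed

lemma eps_split:
  assumes m: "m > 0" and q: "prime q" "q dvd m" "odd q"
  shows "eps m i y = (parity_except m q i y \<noteq> active m q i y)"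
proof -
  let ?S = "{q. prime q \<and> odd q \<and> q dvd m \<and> active m q i y}"
  let ?S' = "{q'. prime q' \<and> odd q' \<and> q' dvd m \<and> q' \<noteq> q \<and> active m q' i y}"
  have fin: "finite ?S'" using m by (intro finite_subset[OF _ finite_divisors_int[of m]]) auto
  show ?thesis
  proof (cases "active m q i y")
    case True
    then have S: "?S = insert q ?S'" using q by blast
    have nq: "q \<notin> ?S'" by blast
    have "card ?S = Suc (card ?S')" by (subst S) (rule card_insert_disjoint[OF fin nq])
    then show ?thesis using True by (simp add: eps_def parity_except_def)
  next
    case False
    then have "?S = ?S'" by blast
    then show ?thesis using False by (simp add: eps_def parity_except_def)
  qed
qed

lemma eps_step_even:
  assumes m: "m > 0" and q: "prime q" "q dvd m" "even q"
  shows "eps m (i + u * (m div q)) (y + w * (m div q)) = eps m i y"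
proof -
  have "{q'. prime q' \<and> odd q' \<and> q' dvd m \<and> active m q' a b} =
    {q'. prime q' \<and> odd q' \<and> q' dvd m \<and> q' \<noteq> q \<and> active m q' a b}" for a b using q(3) by blast
  then have "eps m a b = parity_except m q a b" for a b by (simp add: eps_def parity_except_def)
  then show ?thesis using parity_except_step[OF m q(1,2)] by blast
qed

section \<open>Twisted products from row patterns\<close>

text \<open>A transversal stable under translation by \<open>m div q\<close> yields rows \<open>\<rho> u\<close> in which two symbols follow each other like this.\<close>

definition no_cycle :: "int \<Rightarrow> nat \<Rightarrow> (nat \<Rightarrow> nat \<Rightarrow> nat) \<Rightarrow> bool" where
  "no_cycle q a A \<longleftrightarrow> (\<forall>x x' \<rho> \<sigma>. x \<noteq> x' \<longrightarrow> (\<forall>u::int. \<rho> u < a \<and> \<sigma> u < a \<and> A (\<rho> u) (\<sigma> u) = x \<and>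
     A (\<rho> (u + 1)) (\<sigma> u) = x' \<and> \<rho> (u + q) = \<rho> u) \<longrightarrow> False)"

lemma square_permute_rows:
  assumes "square a A" and \<pi>: "bij_betw \<pi> {..<a} {..<a}"
  shows "square a (\<lambda>r. A (\<pi> r))"
  unfolding square_def
proof (intro conjI allI impI)
  fix r assume "r < a"
  then have "\<pi> r < a" using bij_betwE[OF \<pi>] by auto
  then show "bij_betw (A (\<pi> r)) {..<a} {..<a}" using assms(1) by (simp add: square_def)
next
  fix s assume "s < a"
  then have "bij_betw (\<lambda>r. A r s) {..<a} {..<a}" using assms(1) by (simp add: square_def)
  from bij_betw_trans[OF \<pi> this] show "bij_betw (\<lambda>r. A (\<pi> r) s) {..<a} {..<a}" by (simp add: comp_def)
qed

lemma subfree_permute_rows: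
  assumes "subfree a A" and \<pi>: "bij_betw \<pi> {..<a} {..<a}"
  shows "subfree a (\<lambda>r. A (\<pi> r))"
  unfolding subfree_def
proof (intro allI impI)
  fix R C N assume R: "R \<subseteq> {..<a}" and C: "C \<subseteq> {..<a}" and N: "finite N" "card N = card C"
    and RC: "card R = card C" and v: "\<forall>r\<in>R. \<forall>s\<in>C. A (\<pi> r) s \<in> N"
  have "inj_on \<pi> R" using \<pi> R by (meson bij_betw_def inj_on_subset)
  then have "card (\<pi> ` R) = card C" using RC by (simp add: card_image)
  moreover have "\<pi> ` R \<subseteq> {..<a}" using \<pi> R by (auto simp: bij_betw_def)
  ultimately show "card C < 2 \<or> a \<le> card C"
    using assms(1)[unfolded subfree_def, rule_format, of "\<pi> ` R" C N] C N v by blast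
qed

lemma subfree_no_intercalate:
  assumes "subfree a A" "2 < a" "r < a" "r' < a" "r \<noteq> r'" "s < a" "s' < a" "s \<noteq> s'"
    and "A r s = A r' s'" "A r s' = A r' s" "A r s \<noteq> A r s'"
  shows False
proof -
  have "card {s, s'} < 2 \<or> a \<le> card {s, s'}"
    by (rule assms(1)[unfolded subfree_def, rule_format, of "{r, r'}" "{s, s'}" "{A r s, A r s'}"])
      (use assms in auto)
  then show False using assms by simp
qed

text \<open>The squares \<open>\<Phi> b c\<close> are selected by the bits of row block and symbol
  block, and coincide when \<open>m\<close> is odd. The permutation \<open>\<gamma>\<close> serves
  the odd primes: it moves every row, so that a change of activity shows, and it preserves
  \<open>B\<close>, so that \<open>X\<close> stays the same. \<open>dead2\<close> defeats
  transversals for \<open>q = 2\<close>. \<open>K\<close> excludes mixed 2 x 2 subsquares where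
  \<open>\<gamma>\<close> acts in exactly one of the two symbol blocks; when it acts in both or in
  none, \<open>sf\<close> does so.\<close>

locale pattern =
  fixes m :: int and a :: nat and \<Phi> :: "bool \<Rightarrow> bool \<Rightarrow> nat \<Rightarrow> nat \<Rightarrow> nat"
    and \<gamma> :: "nat \<Rightarrow> nat" and B :: "nat set" and t :: nat and X :: "nat set"
  assumes m: "1 < m" and a: "2 < a" and t: "t < a"
    and B: "B \<subseteq> {..<a}" "B \<noteq> {}" "B \<noteq> {..<a}"
    and sq: "\<And>b c. square a (\<Phi> b c)" and sf: "\<And>b c. subfree a (\<Phi> b c)"
    and X: "\<And>b c. (\<lambda>r. \<Phi> b c r t) ` B = X"
    and \<gamma>: "bij_betw \<gamma> {..<a} {..<a}" "\<And>r. r < a \<Longrightarrow> \<gamma> r \<noteq> r" "\<And>r. r < a \<Longrightarrow> \<gamma> r \<in> B \<longleftrightarrow> r \<in> B"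
    and dead2: "\<And>r r' s s'. even m \<Longrightarrow> r < a \<Longrightarrow> r' < a \<Longrightarrow> s < a \<Longrightarrow> s' < a \<Longrightarrow>
       \<Phi> False False r s = \<Phi> True False r' s' \<Longrightarrow> \<Phi> False True r s' = \<Phi> True True r' s \<Longrightarrow> False"
    and cycles: "\<And>q b c. prime q \<Longrightarrow> q dvd m \<Longrightarrow> odd q \<Longrightarrow>
       no_cycle q a (\<Phi> b c) \<or>
       (q = int a \<and> (odd m \<longrightarrow> q \<ge> 7 \<and> card B = 2) \<and> (\<exists>\<pi>. inj_on \<pi> {..<a} \<and> (\<forall>r<a. \<forall>s<a. \<Phi> b c r s = (\<pi> r + s) mod a)))"
    and odd_const: "\<And>b c b' c'. odd m \<Longrightarrow> \<Phi> b c = \<Phi> b' c'"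
    and K: "\<And>r r' s. odd m \<Longrightarrow> r < a \<Longrightarrow> r \<notin> B \<Longrightarrow> r' \<in> B \<Longrightarrow> s < a \<Longrightarrow> s \<noteq> t \<Longrightarrow>
       \<not> (\<Phi> False False r s = \<Phi> False False r' t \<and> \<Phi> False False (\<gamma> r') s = \<Phi> False False (\<gamma> r) t) \<and>
       \<not> (\<Phi> False False (\<gamma> r) s = \<Phi> False False (\<gamma> r') t \<and> \<Phi> False False r' s = \<Phi> False False r t)"
begin

text \<open>For odd \<open>m\<close> the inverse of 2 modulo \<open>m\<close>, the distance that
  \<open>no_mixed\<close> forces between the two row blocks. For even \<open>m\<close> there is no
  such distance, and 0 makes \<open>\<kappa>\<close> vanish.\<close>

definition h :: int where "h = (if even m then 0 else (m + 1) div 2)"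

text \<open>
  For odd \<open>m\<close>, the two rows of a mixed \<open>2 \<times> 2\<close> subsquare are \<open>h\<close> blocks apart. The shift \<open>\<kappa>\<close> makes \<open>\<gamma>\<close> act on both or on none.
\<close>

definition \<kappa> :: "nat \<Rightarrow> int" where "\<kappa> r = (if r \<in> B then h else 0)"

definition bit :: "int \<Rightarrow> bool" where "bit i \<longleftrightarrow> digit m 2 i = 1"

definition turn :: "int \<Rightarrow> int \<Rightarrow> nat \<Rightarrow> nat" where
  "turn i y r = (if eps m (i + \<kappa> r) y then \<gamma> r else r)"

definition F :: "int \<Rightarrow> int \<Rightarrow> nat \<Rightarrow> nat \<Rightarrow> nat" where
  "F i y r = \<Phi> (bit i) (bit y) (turn i y r)"

lemma m0: "0 < m" using m by simp

lemma \<gamma>_lt: "r < a \<Longrightarrow> \<gamma> r < a" using bij_betwE[OF \<gamma>(1)] by auto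

lemma \<gamma>_inj: "r < a \<Longrightarrow> r' < a \<Longrightarrow> \<gamma> r = \<gamma> r' \<Longrightarrow> r = r'"
  using \<gamma>(1) by (simp add: bij_betw_def inj_on_def)

text \<open>\<open>\<kappa>\<close> depends on a row only through membership in \<open>B\<close>, so
  \<open>\<gamma>\<close> may be switched on for one of the two classes and off for the other. The
  result is still a permutation because \<open>\<gamma>\<close> preserves both classes.\<close>

lemma class_permutation:
  "bij_betw (\<lambda>r. if e (r \<in> B) then \<gamma> r else r) {..<a} {..<a}" (is "bij_betw ?f _ _")
proof -
  have "inj_on ?f {..<a}"
  proof (rule inj_onI)
    fix r r' assume r: "r \<in> {..<a}" "r' \<in> {..<a}" and eq: "?f r = ?f r'"
    have "?f r \<in> B \<longleftrightarrow> r \<in> B" "?f r' \<in> B \<longleftrightarrow> r' \<in> B" using r \<gamma>(3) by simp_all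
    then have "r \<in> B \<longleftrightarrow> r' \<in> B" using eq by simp
    then show "r = r'" using eq r \<gamma>_inj by (auto split: if_splits)
  qed
  moreover have "?f ` {..<a} \<subseteq> {..<a}" using \<gamma>_lt by auto
  ultimately show ?thesis unfolding bij_betw_def using endo_inj_surj[OF finite_lessThan] by blast
qed

lemma turn_bij: "bij_betw (turn i y) {..<a} {..<a}"
proof -
  have "turn i y = (\<lambda>r. if eps m (i + (if r \<in> B then h else 0)) y then \<gamma> r else r)"
    by (simp add: turn_def \<kappa>_def fun_eq_iff)
  then show ?thesis using class_permutation[of "\<lambda>b. eps m (i + (if b then h else 0)) y"] by simp
qed

lemma turn_B: "r < a \<Longrightarrow> turn i y r \<in> B \<longleftrightarrow> r \<in> B"
  using \<gamma>(3) by (simp add: turn_def)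

lemma turn_image_B: "turn i y ` B = B"
proof
  show "turn i y ` B \<subseteq> B" using turn_B B(1) by auto
  show "B \<subseteq> turn i y ` B"
  proof
    fix r assume "r \<in> B"
    then have "r \<in> turn i y ` {..<a}" using turn_bij[of i y] B(1) by (auto simp: bij_betw_def)
    then obtain r' where "r' < a" "r = turn i y r'" by auto
    then show "r \<in> turn i y ` B" using turn_B \<open>r \<in> B\<close> by blast
  qed
qed

lemma bit_mod: "even m \<Longrightarrow> bit (i mod m) = bit i"
  using digit_mod[OF m0, of 2 i] by (simp add: bit_def)

lemma \<Phi>_bit_mod: "\<Phi> (bit (i mod m)) (bit (y mod m)) = \<Phi> (bit i) (bit y)"
proof (cases "even m")
  case True then show ?thesis by (simp add: bit_mod)
qed (rule odd_const)

lemma F_mod: "F (i mod m) (y mod m) = F i y"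
proof -
  have "eps m (i mod m + \<kappa> r) y = eps m (i + \<kappa> r) y" for r
    using eps_mod(1)[OF m0, of "i mod m + \<kappa> r"] eps_mod(1)[OF m0, of "i + \<kappa> r"] by (simp add: mod_simps)
  then show ?thesis by (simp add: F_def turn_def \<Phi>_bit_mod eps_mod(2)[OF m0] fun_eq_iff)
qed

text \<open>At symbol blocks of nonzero digit every row is turned by the same map \<open>f\<close>;
  at digit 0 the active rows take the opposite choice. Blocks of the first kind determine the
  transversal almost completely, and a block of the second kind then contradicts it.\<close>

lemma no_transversal_odd:
  assumes q: "prime q" "q dvd m" "odd q"
    and \<rho>: "\<And>u. \<rho> u < a" "\<And>u. \<rho> (u + q) = \<rho> u" and \<sigma>: "\<And>u. \<sigma> u < a"
    and eq: "\<And>u v. F (i + u * (m div q)) (y + (u + v) * (m div q)) (\<rho> u) (\<sigma> v) = \<xi> (u + v :: int)"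
  shows False
proof -
  let ?g = "m div q"
  have q3: "q \<ge> 3"
  proof -
    have "q \<ge> 2" using q(1) prime_ge_2_int by blast
    moreover have "q \<noteq> 2" using q(3) by auto
    ultimately show ?thesis by simp
  qed
  have bit_const: "\<Phi> (bit (i + u * ?g)) (bit (y + w * ?g)) = \<Phi> (bit i) (bit y)" for u w
  proof (cases "even m")
    case True
    have "2 \<noteq> q" using q(3) by auto
    then show ?thesis using digit_other[OF m0 q(1,2), of 2] True by (simp add: bit_def)
  qed (rule odd_const)
  define A where "A = \<Phi> (bit i) (bit y)"
  have A: "square a A" unfolding A_def by (rule sq)
  obtain w0 where w0: "digit m q (y + w0 * ?g) = 0"
    using digit_hit[OF m0 q(1,2), of 0 y] q3 by auto
  define base where "base r = parity_except m q (i + \<kappa> r) y" for r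
  define act where "act u r \<longleftrightarrow> 2 * digit m q (i + \<kappa> r + u * ?g) + 1 < q" for u r
  have turn_eq: "turn (i + u * ?g) (y + w * ?g) r = (if base r \<noteq> (act u r \<and> q dvd w - w0) then \<gamma> r else r)" for u w r
  proof -
    have "digit m q (y + w * ?g) = 0 \<longleftrightarrow> q dvd w - w0" using digit_eq_iff[OF m0 q(1,2), of y w w0] w0 by simp
    moreover have "i + u * ?g + \<kappa> r = i + \<kappa> r + u * ?g" by simp
    ultimately have "eps m (i + u * ?g + \<kappa> r) (y + w * ?g) \<longleftrightarrow> base r \<noteq> (act u r \<and> q dvd w - w0)"
      unfolding eps_split[OF m0 q] base_def act_def active_def
      by (simp only: parity_except_step[OF m0 q(1,2)])
    then show ?thesis by (simp add: turn_def)
  qed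
  define f where "f r = (if base r then \<gamma> r else r)" for r
  have f: "bij_betw f {..<a} {..<a}"
  proof -
    have "f = (\<lambda>r. if parity_except m q (i + (if r \<in> B then h else 0)) y then \<gamma> r else r)"
      by (simp add: f_def base_def \<kappa>_def fun_eq_iff)
    then show ?thesis using class_permutation[of "\<lambda>b. parity_except m q (i + (if b then h else 0)) y"] by simp
  qed
  have f_lt: "f r < a" if "r < a" for r using \<gamma>_lt that by (simp add: f_def)
  define f' where "f' u r = (if base r \<noteq> act u r then \<gamma> r else r)" for u r
  have f'_lt: "f' u r < a" if "r < a" for u r using \<gamma>_lt that by (simp add: f'_def)
  have f'_eq: "f' u r = f r \<longleftrightarrow> \<not> act u r" if "r < a" for u r
    using \<gamma>(2)[OF that] by (auto simp: f_def f'_def)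
  have main: "A (f (\<rho> u)) (\<sigma> (w - u)) = \<xi> w" if "\<not> q dvd w - w0" for u w
    using eq[of u "w - u"] that turn_eq[of u w "\<rho> u"] by (simp add: F_def bit_const A_def f_def)
  have special: "A (f' u (\<rho> u)) (\<sigma> (w0 - u)) = \<xi> w0" for u
    using eq[of u "w0 - u"] turn_eq[of u w0 "\<rho> u"] by (simp add: F_def bit_const A_def f'_def)
  \<comment> \<open>\<open>q \<ge> 3\<close> makes the digits of the blocks \<open>w0 + 1\<close>
    and \<open>w0 + 2\<close> nonzero. Indexed this way, column \<open>s u\<close> meets row
    \<open>r u\<close> in \<open>x\<close> and row \<open>r (u + 1)\<close> in \<open>x'\<close>,
    which is the situation of \<open>no_cycle\<close>.\<close>
  define x x' where "x = \<xi> (w0 + 1)" and "x' = \<xi> (w0 + 2)"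
  have nd: "\<not> q dvd 1" "\<not> q dvd 2" using q3 by (auto dest: zdvd_imp_le)
  define s where "s u = \<sigma> (w0 + 1 - u)" for u
  define r where "r u = f (\<rho> u)" for u
  have sh: "w0 + 2 - (u + 1) = w0 + 1 - u" for u by simp
  have rs: "r u < a" "s u < a" "A (r u) (s u) = x" "A (r (u + 1)) (s u) = x'" "r (u + q) = r u" for u
    using main[of "w0 + 1" u] main[of "w0 + 2" "u + 1", unfolded sh] nd f_lt[OF \<rho>(1)] \<sigma> \<rho>(2)
    by (simp_all add: r_def s_def x_def x'_def)
  have act_ex: "\<exists>u. act u r" "\<exists>u. \<not> act u r" for r
  proof -
    obtain u where "digit m q (i + \<kappa> r + u * ?g) = 0" using digit_hit[OF m0 q(1,2), of 0 "i + \<kappa> r"] q3 by auto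
    then have "act u r" using q3 by (simp add: act_def)
    then show "\<exists>u. act u r" by blast
    obtain u where "digit m q (i + \<kappa> r + u * ?g) = q - 1" using digit_hit[OF m0 q(1,2), of "q - 1" "i + \<kappa> r"] q3 by auto
    then have "\<not> act u r" using q3 by (simp add: act_def)
    then show "\<exists>u. \<not> act u r" by blast
  qed
  show False
  proof (cases "x = x'")
    case True
    \<comment> \<open>Equal symbols force one row and one column throughout. At \<open>w0\<close>
      that column would show the same symbol in the active and the inactive version of the row,
      although \<open>\<gamma>\<close> moves it.\<close>
    have "r (u + 1) = r u" for u using squareD(3)[OF A, of "r (u + 1)" "r u" "s u"] rs[of u] rs[of "u + 1"] True by simp
    then have "r (int n) = r 0 \<and> r (- int n) = r 0" for n
    proof (induction n)
      case (Suc n)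
      have "r (int n + 1) = r (int n)" "r (- int n - 1 + 1) = r (- int n - 1)" by (rule Suc(2))+
      moreover have "- int (Suc n) = - int n - 1" "int (Suc n) = int n + 1" by simp_all
      ultimately show ?case using Suc(1)[OF Suc(2)] by (metis diff_add_cancel)
    qed simp
    then have "r u = r 0" for u by (metis int_cases2)
    then have fc: "f (\<rho> u) = f (\<rho> 0)" for u by (simp add: r_def)
    have "\<rho> u = \<rho> 0" for u using f fc[of u] \<rho>(1) by (simp add: bij_betw_def inj_on_def)
    then have \<rho>c: "\<rho> u = \<rho> 0" for u .
    have sc: "s u = s 0" for u
      using squareD(2)[OF A, of "r 0" "s u" "s 0"] rs[of u] rs[of 0] fc[of u] by (simp add: r_def)
    have "\<sigma> v = s (w0 + 1 - v)" for v by (simp add: s_def)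
    then have "\<sigma> v = s 0" for v using sc[of "w0 + 1 - v"] by metis
    then have c: "A (f' u (\<rho> 0)) (s 0) = \<xi> w0" for u using special[of u] \<rho>c[of u] by simp
    obtain u u' where u: "act u (\<rho> 0)" "\<not> act u' (\<rho> 0)" using act_ex by blast
    have "f' u (\<rho> 0) = f' u' (\<rho> 0)"
      using squareD(3)[OF A f'_lt f'_lt, of "\<rho> 0" "\<rho> 0" "s 0" u u'] c[of u] c[of u'] rs(2)[of 0] \<rho>(1) by simp
    then show False using u \<gamma>(2)[OF \<rho>(1)[of 0]] by (auto simp: f'_def split: if_splits)
  next
    case False
    \<comment> \<open>A genuine cycle leaves only the cyclic alternative in \<open>cycles\<close>,
      with \<open>q = a\<close>. There \<open>p u\<close>, the image of row \<open>r u\<close> under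
      \<open>\<pi>\<close>, grows by \<open>d\<close> at each step modulo \<open>q\<close>.\<close>
    have "\<not> no_cycle q a A"
      using rs False unfolding no_cycle_def by blast
    then obtain \<pi> where qa: "q = int a" and od: "odd m \<Longrightarrow> q \<ge> 7 \<and> card B = 2" and \<pi>: "inj_on \<pi> {..<a}"
      and lin: "\<And>r s. r < a \<Longrightarrow> s < a \<Longrightarrow> A r s = (\<pi> r + s) mod a"
      using cycles[OF q, of "bit i" "bit y"] unfolding A_def by blast
    have lin': "q dvd int (\<pi> r) + int s - int (A r s)" if "r < a" "s < a" for r s
    proof -
      have "int (A r s) = (int (\<pi> r) + int s) mod q" unfolding qa lin[OF that] by (simp add: zmod_int)
      then show ?thesis by (simp add: mod_eq_dvd_iff[symmetric])
    qed
    define p where "p u = int (\<pi> (r u))" for u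
    define d where "d = int x' - int x"
    have step: "q dvd p (u + 1) - p u - d" for u
    proof -
      have "q dvd int (\<pi> (r (u + 1))) + int (s u) - int x'" "q dvd int (\<pi> (r u)) + int (s u) - int x"
        using lin'[OF rs(1,2), of "u + 1" u] lin'[OF rs(1,2), of u u] rs(3,4)[of u] by simp_all
      then have "q dvd (int (\<pi> (r (u + 1))) + int (s u) - int x') - (int (\<pi> (r u)) + int (s u) - int x)"
        by (rule dvd_diff)
      then show ?thesis by (simp add: p_def d_def algebra_simps)
    qed
    have affine: "q dvd p (u + int n) - p u - int n * d" for u n
    proof (induction n)
      case (Suc n)
      have "q dvd (p (u + int n + 1) - p (u + int n) - d) + (p (u + int n) - p u - int n * d)"
        using step Suc by (rule dvd_add)
      then show ?case by (simp add: algebra_simps)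
    qed simp
    have s_lin: "q dvd p u + int (s u) - int x" for u
      using lin'[OF rs(1,2), of u u] rs(3)[of u] by (simp add: p_def)
    \<comment> \<open>Measured by \<open>\<pi>\<close>, the rows \<open>f' u (\<rho> u)\<close> and
      \<open>f (\<rho> u)\<close> differ by an amount that does not depend on \<open>u\<close>. An
      inactive \<open>u\<close> makes it 0, and an active one then contradicts that
      \<open>\<gamma>\<close> moves every row.\<close>
    have sp: "q dvd int (\<pi> (f' u (\<rho> u))) - p u - (int (\<xi> w0) - int x + d)" for u
    proof -
      have e: "\<sigma> (w0 - u) = s (u + 1)" by (simp add: s_def)
      have 1: "q dvd int (\<pi> (f' u (\<rho> u))) + int (s (u + 1)) - int (\<xi> w0)"
        using lin'[OF f'_lt[OF \<rho>(1)] rs(2), of u u "u + 1"] special[of u] e by simp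
      have "q dvd (int (\<pi> (f' u (\<rho> u))) + int (s (u + 1)) - int (\<xi> w0)) - (p (u + 1) + int (s (u + 1)) - int x)
        + (p (u + 1) - p u - d)"
        using dvd_add[OF dvd_diff[OF 1 s_lin[of "u + 1"]] step[of u]] .
      then show ?thesis by (simp add: algebra_simps)
    qed
    have x_lt: "x < a" "x' < a" using squareD(1)[OF A rs(1,2)] rs(3,4) by metis+
    have nqd: "\<not> q dvd d"
    proof
      assume "q dvd d"
      then have "int x' mod q = int x mod q" by (simp add: mod_eq_dvd_iff d_def)
      then show False using x_lt qa False by simp
    qed
    have inj: "q dvd u - v" if e: "\<rho> u = \<rho> v" and "u \<ge> v" for u v
    proof -
      have "p u = p v" using e by (simp add: p_def r_def)
      then have "q dvd (u - v) * d" using affine[of v "nat (u - v)"] \<open>u \<ge> v\<close> by simp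
      then show ?thesis using q(1) nqd by (simp add: prime_dvd_mult_iff)
    qed
    have inj': "q dvd u - v" if "\<rho> u = \<rho> v" for u v
      using inj[of u v] inj[of v u] that by (cases "u \<ge> v") (auto simp: dvd_diff_commute)
    have not_both: False if u: "act u (\<rho> u)" and v: "\<not> act v (\<rho> v)" for u v
    proof -
      have \<pi>_inj: "r = r'" if "r < a" "r' < a" "q dvd int (\<pi> r) - int (\<pi> r')" for r r'
      proof -
        have "A r 0 = A r' 0"
        proof -
          have "(int (\<pi> r)) mod int a = int (\<pi> r') mod int a" using that(3) qa by (simp add: mod_eq_dvd_iff)
          then show ?thesis using lin[of r 0] lin[of r' 0] that(1,2) a by (metis add_0_right gr0I less_zeroE zmod_int of_nat_eq_iff less_trans)
        qed
        then show ?thesis using squareD(3)[OF A that(1,2)] a by (metis gr0I less_zeroE)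
      qed
      have "f' v (\<rho> v) = f (\<rho> v)" using f'_eq[OF \<rho>(1)] v by blast
      then have "q dvd - (int (\<xi> w0) - int x + d)" using sp[of v] by (simp add: p_def r_def)
      then have "q dvd int (\<xi> w0) - int x + d" by (simp only: dvd_minus_iff)
      then have "q dvd int (\<pi> (f' u (\<rho> u))) - int (\<pi> (f (\<rho> u)))"
        using dvd_add[OF sp[of u], of "int (\<xi> w0) - int x + d"] by (simp add: p_def r_def)
      then have "f' u (\<rho> u) = f (\<rho> u)" using \<pi>_inj[OF f'_lt[OF \<rho>(1)] f_lt[OF \<rho>(1)]] by blast
      then show False using f'_eq[OF \<rho>(1)] u by blast
    qed
    show False
    proof (cases "even m")
      case True
      \<comment> \<open>With \<open>h = 0\<close> activity depends on \<open>u\<close> alone, and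
        both kinds of \<open>u\<close> occur.\<close>
      then have "act u r = act u 0" for u r by (simp add: act_def \<kappa>_def h_def)
      then show False using act_ex[of 0] not_both by blast
    next
      case odd: False
      have q7: "q \<ge> 7" and cB: "card B = 2" using od odd by auto
      \<comment> \<open>For odd \<open>m\<close> activity is shifted on rows in \<open>B\<close>, so
        rows outside \<open>B\<close> are sought. Different classes of \<open>u\<close> modulo
        \<open>q\<close> have different rows and \<open>B\<close> has two elements, so one of any
        three digits belongs to such a row. For \<open>q \<ge> 7\<close> the digits 0, 1, 2 are
        active and the last three are not.\<close>
      have three: "\<exists>u. \<rho> u \<notin> B \<and> digit m q (i + u * ?g) \<in> {e, e + 1, e + 2}" if e: "0 \<le> e" "e + 2 < q" for e
      proof -
        obtain u1 where u1: "digit m q (i + u1 * ?g) = e" by (rule digit_hit[OF m0 q(1,2), of e i]) (use e in auto)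
        obtain u2 where u2: "digit m q (i + u2 * ?g) = e + 1" by (rule digit_hit[OF m0 q(1,2), of "e + 1" i]) (use e in auto)
        obtain u3 where u3: "digit m q (i + u3 * ?g) = e + 2" by (rule digit_hit[OF m0 q(1,2), of "e + 2" i]) (use e in auto)
        have ne: "\<rho> u1 \<noteq> \<rho> u2" "\<rho> u1 \<noteq> \<rho> u3" "\<rho> u2 \<noteq> \<rho> u3"
          using inj'[of u1 u2] inj'[of u1 u3] inj'[of u2 u3] u1 u2 u3
            digit_eq_iff[OF m0 q(1,2), of i u1 u2] digit_eq_iff[OF m0 q(1,2), of i u1 u3] digit_eq_iff[OF m0 q(1,2), of i u2 u3]
          by auto
        have "\<not> {\<rho> u1, \<rho> u2, \<rho> u3} \<subseteq> B"
        proof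
          assume "{\<rho> u1, \<rho> u2, \<rho> u3} \<subseteq> B"
          moreover have "finite B" using B(1) finite_subset by blast
          ultimately have "card {\<rho> u1, \<rho> u2, \<rho> u3} \<le> card B" by (rule card_mono[rotated])
          then show False using ne cB by simp
        qed
        then show ?thesis using u1 u2 u3 by auto
      qed
      obtain u where u: "\<rho> u \<notin> B" "digit m q (i + u * ?g) \<in> {0, 1, 2}" using three[of 0] q7 by auto
      obtain v where v: "\<rho> v \<notin> B" "digit m q (i + v * ?g) \<in> {q - 3, q - 3 + 1, q - 3 + 2}" using three[of "q - 3"] q7 by auto
      have "act u (\<rho> u)" using u q7 by (auto simp: act_def \<kappa>_def)
      moreover have "\<not> act v (\<rho> v)" using v q7 by (auto simp: act_def \<kappa>_def)
      ultimately show False using not_both by blast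
    qed
  qed
qed

text \<open>The bits of row block and symbol block run independently through all four combinations,
  while \<open>eps\<close> ignores the translation. As \<open>\<sigma>\<close> has period 2, the two
  columns change places between the two symbol blocks, which is the crossing in
  \<open>dead2\<close>.\<close>

lemma no_transversal_even:
  assumes q: "prime q" "q dvd m" "even q"
    and \<rho>: "\<And>u. \<rho> u < a" and \<sigma>: "\<And>u. \<sigma> u < a" "\<And>u. \<sigma> (u + q) = \<sigma> u" and \<xi>: "\<And>u. \<xi> (u + q) = \<xi> u"
    and eq: "\<And>u v. F (i + u * (m div q)) (y + (u + v) * (m div q)) (\<rho> u) (\<sigma> v) = \<xi> (u + v :: int)"
  shows False
proof -
  have q2: "q = 2" using q(1,3) primes_dvd_imp_eq[of 2 q] by auto
  let ?g = "m div 2"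
  have ev: "even m" using q q2 by simp
  have eqs: "F (i + u * ?g) (y + w * ?g) (\<rho> u) (\<sigma> (w - u)) = \<xi> w" for u w using eq[of u "w - u"] q2 by simp
  define e where "e = eps m i y"
  have turn_eq: "turn (i + u * ?g) (y + w * ?g) r = (if e then \<gamma> r else r)" for u w r
    using eps_step_even[OF m0 q] ev q2 by (simp add: turn_def \<kappa>_def h_def e_def)
  define r where "r u = (if e then \<gamma> (\<rho> u) else \<rho> u)" for u
  have r: "r u < a" for u using \<rho> \<gamma>_lt by (simp add: r_def)
  have val: "\<Phi> (bit (i + u * ?g)) (bit (y + w * ?g)) (r u) (\<sigma> (w - u)) = \<xi> w" for u w
    using eqs[of u w] by (simp add: F_def turn_eq r_def)
  obtain u0 where u0: "digit m 2 (i + u0 * ?g) = 0" using digit_hit[OF m0, of 2 0 i] ev by auto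
  obtain w0 where w0: "digit m 2 (y + w0 * ?g) = 0" using digit_hit[OF m0, of 2 0 y] ev by auto
  have flip: "digit m 2 (z + (u + 1) * ?g) = 1" if "digit m 2 (z + u * ?g) = 0" for z u
  proof -
    have "digit m 2 (z + (u + 1) * ?g) \<noteq> digit m 2 (z + u * ?g)"
      using digit_eq_iff[OF m0, of 2 z "u + 1" u] ev by simp
    moreover have "digit m 2 (z + (u + 1) * ?g) \<in> {0, 1}" by (auto simp: digit_def)
    ultimately show ?thesis using that by auto
  qed
  have b: "bit (i + u0 * ?g) = False" "bit (i + (u0 + 1) * ?g) = True" "bit (y + w0 * ?g) = False" "bit (y + (w0 + 1) * ?g) = True"
    using u0 w0 flip by (simp_all add: bit_def)
  have per: "\<sigma> (v + 2) = \<sigma> v" for v using \<sigma>(2) q2 by simp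
  show False
  proof (rule dead2[OF ev r[of u0] r[of "u0 + 1"] \<sigma>(1)[of "w0 - u0"] \<sigma>(1)[of "w0 - u0 - 1"]])
    show "\<Phi> False False (r u0) (\<sigma> (w0 - u0)) = \<Phi> True False (r (u0 + 1)) (\<sigma> (w0 - u0 - 1))"
      using val[of u0 w0] val[of "u0 + 1" w0] unfolding b by (simp add: algebra_simps)
    have "\<sigma> (w0 + 1 - u0) = \<sigma> (w0 - u0 - 1)" using per[of "w0 - u0 - 1"] by (simp add: algebra_simps)
    then show "\<Phi> False True (r u0) (\<sigma> (w0 - u0 - 1)) = \<Phi> True True (r (u0 + 1)) (\<sigma> (w0 - u0))"
      using val[of u0 "w0 + 1"] val[of "u0 + 1" "w0 + 1"] unfolding b by simp
  qed
qed

lemma twisted: "twisted_product m a F B t X"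
proof
  show "1 < m" "2 < a" "t < a" "B \<subseteq> {..<a}" "B \<noteq> {}" "B \<noteq> {..<a}" using m a t B by auto
  show "square a (F i y)" for i y
    using square_permute_rows[OF sq turn_bij, of "bit i" "bit y" i y] by (simp add: F_def[abs_def])
  show "subfree a (F i y)" for i y
    using subfree_permute_rows[OF sf turn_bij, of "bit i" "bit y" i y] by (simp add: F_def[abs_def])
  show "(\<lambda>r. F i y r t) ` B = X" for i y
  proof -
    have "(\<lambda>r. F i y r t) ` B = (\<lambda>r. \<Phi> (bit i) (bit y) r t) ` turn i y ` B" by (simp add: F_def image_image)
    then show ?thesis by (simp add: turn_image_B X)
  qed
next
  fix q i j \<rho> \<sigma> \<xi>
  assume q: "prime q" "q dvd m" and \<rho>: "\<And>k. \<rho> k < a" and \<sigma>: "\<And>k. \<sigma> k < a"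
    and eq: "\<And>u v. F ((i + u * (m div q)) mod m) ((i + j + (u + v) * (m div q)) mod m)
           (\<rho> ((i + u * (m div q)) mod m)) (\<sigma> ((j + v * (m div q)) mod m)) =
         \<xi> ((i + j + (u + v) * (m div q)) mod m)"
  have qm: "q * (m div q) = m" using q(2) by simp
  have per: "(z + (u + q) * (m div q)) mod m = (z + u * (m div q)) mod m" for z u
  proof -
    have "z + (u + q) * (m div q) = z + u * (m div q) + q * (m div q)" by (simp add: algebra_simps)
    then show ?thesis unfolding qm by (simp only: mod_add_self2)
  qed
  note eq' = eq[unfolded F_mod]
  show False
  proof (cases "odd q")
    case True
    show False
      by (rule no_transversal_odd[OF q True, of "\<lambda>u. \<rho> ((i + u * (m div q)) mod m)" "\<lambda>v. \<sigma> ((j + v * (m div q)) mod m)"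
            i "i + j" "\<lambda>w. \<xi> ((i + j + w * (m div q)) mod m)"]) (simp_all add: \<rho> \<sigma> per eq')
  next
    case False
    then have "even q" by simp
    show False
      by (rule no_transversal_even[OF q \<open>even q\<close>, of "\<lambda>u. \<rho> ((i + u * (m div q)) mod m)" "\<lambda>v. \<sigma> ((j + v * (m div q)) mod m)"
            "\<lambda>w. \<xi> ((i + j + w * (m div q)) mod m)" i "i + j"]) (simp_all add: \<rho> \<sigma> per eq')
  qed
next
  fix i y r r' s
  assume od: "odd m" and r: "r < a" "r \<notin> B" and r': "r' \<in> B" and s: "s < a" "s \<noteq> t"
    and 1: "F i ((y + (m + 1) div 2) mod m) r s = F ((i - (m + 1) div 2) mod m) ((y + (m + 1) div 2) mod m) r' t"
    and 2: "F ((i - (m + 1) div 2) mod m) y r' s = F i y r t"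
  have r'a: "r' < a" using r' B by auto
  have hh: "(m + 1) div 2 = h" using od by (simp add: h_def)
  have Fr: "F i' y' r s = \<Phi> False False (if eps m i' y' then \<gamma> r else r) s" for i' y' s
    using odd_const[OF od, of "bit i'" "bit y'" False False] r by (simp add: F_def turn_def \<kappa>_def)
  have Fr': "F (i - h) y' r' s = \<Phi> False False (if eps m i y' then \<gamma> r' else r') s" for y' s
    using odd_const[OF od, of "bit (i - h)" "bit y'" False False] r' by (simp add: F_def turn_def \<kappa>_def)
  have e1: "\<Phi> False False (if eps m i (y + h) then \<gamma> r else r) s = \<Phi> False False (if eps m i (y + h) then \<gamma> r' else r') t"
    using 1 F_mod[of "i - h" "y + h"] F_mod[of i "y + h"] unfolding hh
    by (simp only: Fr Fr' eps_mod(2)[OF m0])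
  have e2: "\<Phi> False False (if eps m i y then \<gamma> r' else r') s = \<Phi> False False (if eps m i y then \<gamma> r else r) t"
  proof -
    have "F ((i - h) mod m) y = F (i - h) y" using F_mod[of "(i - h) mod m" y] F_mod[of "i - h" y] by simp
    then show ?thesis using 2 unfolding hh by (simp only: Fr Fr')
  qed
  have same: False if "z < a" "z' < a" "z \<noteq> z'" "\<Phi> False False z s = \<Phi> False False z' t" "\<Phi> False False z' s = \<Phi> False False z t" for z z'
  proof (rule subfree_no_intercalate[OF sf[of False False] a that(1-3) s(1) t s(2) that(4) that(5)[symmetric]])
    show "\<Phi> False False z s \<noteq> \<Phi> False False z t" using squareD(2)[OF sq that(1) s(1) t] s(2) by blast
  qed
  have ne: "r \<noteq> r'" "\<gamma> r \<noteq> \<gamma> r'" using r r' \<gamma>_inj[OF r(1) r'a] by auto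
  \<comment> \<open>Within each symbol block, \<open>\<kappa>\<close> lets \<open>\<gamma>\<close>
    act on both rows or on neither. If the two blocks agree, the four cells form a 2 x 2 subsquare
    of \<open>\<Phi>\<close>; if they disagree, \<open>K\<close> applies.\<close>
  show False
    using e1 e2 K[OF od r r' s] same[OF r(1) r'a ne(1)] same[OF \<gamma>_lt[OF r(1)] \<gamma>_lt[OF r'a] ne(2)]
    by (cases "eps m i (y + h)"; cases "eps m i y") auto
qed

theorem N_infinity_pattern: "has_N_infinity (nat m * a)"
  by (rule twisted_product.N_infinity_exists[OF twisted])

end

section \<open>Prime order factors\<close>

lemma subfree_N_infinity:
  assumes sq: "square a G" and sf: "subfree a G"
  shows "has_N_infinity a"
proof (rule N_infinityI[of a "{..<a}" "{..<a}" G])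
  show "latin_on a {..<a} {..<a} G"
    by (rule latin_onI[of _ _ _ "{..<a}"]) (use sq in \<open>auto simp: square_def\<close>)
next
  fix k R C assume RC: "R \<subseteq> {..<a}" "C \<subseteq> {..<a}" and lat: "latin_on k R C G" and k: "2 \<le> k" "k < a"
  from latin_on_bij[OF lat] obtain N where N: "card R = k" "card C = k" "finite N" "card N = k" "\<forall>r\<in>R. bij_betw (G r) C N"
    by blast
  have "\<forall>r\<in>R. \<forall>s\<in>C. G r s \<in> N" using N(5) by (auto simp: bij_betw_def)
  then have "card C < 2 \<or> a \<le> card C"
    using sf[unfolded subfree_def, rule_format, of R C N] RC N by simp
  then show False using N k by simp
qed

lemma endo_bij: "inj_on f {..<a} \<Longrightarrow> (\<And>r. r < a \<Longrightarrow> f r < a) \<Longrightarrow> bij_betw f {..<a} {..<a :: nat}"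
  unfolding bij_betw_def using endo_inj_surj[OF finite_lessThan, of f a] by auto

definition cyclic :: "nat \<Rightarrow> nat \<Rightarrow> nat \<Rightarrow> nat" where
  "cyclic a r s = (r + s) mod a"

lemma cyclic_dvd: "int a dvd int r + int s - int (cyclic a r s)"
  by (simp add: cyclic_def zmod_int mod_eq_dvd_iff[symmetric])

lemma nat_mod_unique: "r < a \<Longrightarrow> r' < a \<Longrightarrow> int a dvd int r - int r' \<Longrightarrow> r = r'"
  by (metis mod_eq_dvd_iff mod_less of_nat_eq_iff zmod_int)

lemma cyclic_square: "0 < a \<Longrightarrow> square a (cyclic a)"
proof -
  assume a: "0 < a"
  have "inj_on (cyclic a r) {..<a}" for r
  proof (rule inj_onI)
    fix s s' assume s: "s \<in> {..<a}" "s' \<in> {..<a}" and eq: "cyclic a r s = cyclic a r s'"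
    have "int a dvd (int r + int s - int (cyclic a r s)) - (int r + int s' - int (cyclic a r s'))"
      by (intro dvd_diff[OF cyclic_dvd cyclic_dvd])
    then have "int a dvd int s - int s'" using eq by simp
    then show "s = s'" using s nat_mod_unique by simp
  qed
  then have b: "bij_betw (cyclic a r) {..<a} {..<a}" for r
    by (rule endo_bij) (use a in \<open>simp_all add: cyclic_def\<close>)
  have "(\<lambda>r. cyclic a r s) = cyclic a s" for s by (simp add: cyclic_def add.commute fun_eq_iff)
  then show ?thesis using b by (simp add: square_def)
qed

text \<open>Modulo \<open>p\<close>, the column set of a subsquare has the difference of two of its
  rows as a period. For prime \<open>p\<close> this forces period 1, so that all columns belong to
  the subsquare.\<close>

lemma cyclic_subfree:
  assumes p: "prime p"
  shows "subfree p (cyclic p)"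
  unfolding subfree_def
proof (intro allI impI)
  fix R C N :: "nat set" assume R: "R \<subseteq> {..<p}" and C: "C \<subseteq> {..<p}" and N: "finite N"
    and RC: "card R = card C" and NC: "card N = card C" and v: "\<forall>r\<in>R. \<forall>s\<in>C. cyclic p r s \<in> N"
  have p0: "0 < p" using p prime_gt_0_nat by blast
  have sq: "square p (cyclic p)" by (rule cyclic_square[OF p0])
  show "card C < 2 \<or> p \<le> card C"
  proof (rule ccontr)
    assume "\<not> ?thesis"
    then have k: "\<not> p \<le> card C" and k2: "2 \<le> card C" by simp_all
    have finC: "finite C" using C finite_subset by blast
    obtain r where r: "r \<in> R" using RC k2 by fastforce
    have "\<not> R \<subseteq> {r}" using RC k2 card_mono[of "{r}" R] by auto
    then obtain r' where r': "r' \<in> R" "r' \<noteq> r" by blast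
    define Cs where "Cs = {z :: int. nat (z mod int p) \<in> C}"
    define Ns where "Ns = {z :: int. nat (z mod int p) \<in> N}"
    have shift: "z \<in> Cs \<longleftrightarrow> z + int r \<in> Ns" if r: "r \<in> R" for z r
    proof -
      have rp: "r < p" using r R by auto
      have inj: "inj_on (cyclic p r) C" using squareD(2)[OF sq rp] C by (meson inj_onI lessThan_iff subsetD)
      have im: "cyclic p r ` C = N"
        by (rule card_subset_eq[OF N]) (use v r inj NC card_image[OF inj] in auto)
      have val: "cyclic p r (nat (z mod int p)) = nat ((z + int r) mod int p)"
      proof -
        have "int (cyclic p r (nat (z mod int p))) = (int r + z mod int p) mod int p"
          using p0 by (simp add: cyclic_def zmod_int)
        also have "\<dots> = (z + int r) mod int p" by (simp add: mod_simps add.commute)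
        finally show ?thesis by simp
      qed
      have lt: "nat (z mod int p) < p" using p0 by (simp add: nat_less_iff)
      show ?thesis
      proof
        assume "z \<in> Cs"
        then show "z + int r \<in> Ns" using v r val unfolding Cs_def Ns_def by (metis mem_Collect_eq)
      next
        assume "z + int r \<in> Ns"
        then have "cyclic p r (nat (z mod int p)) \<in> cyclic p r ` C" using val im by (simp add: Ns_def)
        then obtain s where "s \<in> C" "cyclic p r (nat (z mod int p)) = cyclic p r s" by blast
        then show "z \<in> Cs" using squareD(2)[OF sq rp lt, of s] C by (auto simp: Cs_def)
      qed
    qed
    have per: "period Cs (int r - int r')"
    proof -
      have "y \<in> Cs \<longleftrightarrow> y + (int r - int r') \<in> Cs" for y
        using shift[OF r, of y] shift[OF r'(1), of "y + (int r - int r')"] by simp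
      then show ?thesis by (simp add: period_def)
    qed
    have perp: "period Cs (int p)" by (simp add: period_def Cs_def)
    have nd: "\<not> int p dvd int r - int r'" using nat_mod_unique[of r p r'] r r' R by auto
    obtain q where q: "prime q" "q dvd int p" "period Cs (int p div q)"
      using period_prime[OF per nd _ perp] p0 by auto
    have "prime (int p)" using p by simp
    then have "q = int p" using q(1,2) primes_dvd_imp_eq by blast
    then have per1: "period Cs 1" using q(3) p0 by simp
    obtain s where "s \<in> C" using k2 by fastforce
    then have s: "int s \<in> Cs" using C by (auto simp: Cs_def)
    have all: "z \<in> Cs" for z
      using closed_pred_all[OF per1, of "int s" z] s periodD[OF per1] by (metis diff_add_cancel zero_less_one)
    have "{..<p} \<subseteq> C"
    proof
      fix z assume "z \<in> {..<p}"
      then show "z \<in> C" using all[of "int z"] by (simp add: Cs_def)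
    qed
    then have "p \<le> card C" using card_mono[OF finC, of "{..<p}"] by simp
    then show False using k by simp
  qed
qed

text \<open>Each step from \<open>x\<close> to \<open>x'\<close> changes \<open>\<pi>\<close> of the
  row by \<open>x' - x\<close> modulo \<open>p\<close>. Closing after \<open>q\<close> steps would
  make \<open>p\<close> divide \<open>q * (x' - x)\<close>.\<close>

lemma cyclic_no_cycle:
  assumes p: "prime p" and q: "prime q" "q \<noteq> int p" and \<pi>: "\<And>r. r < p \<Longrightarrow> \<pi> r < p"
  shows "no_cycle q p (\<lambda>r. cyclic p (\<pi> r))"
  unfolding no_cycle_def
proof (intro allI impI)
  fix x x' and \<rho> \<sigma> :: "int \<Rightarrow> nat" assume x: "x \<noteq> x'"
    and all: "\<forall>u. \<rho> u < p \<and> \<sigma> u < p \<and> cyclic p (\<pi> (\<rho> u)) (\<sigma> u) = x \<and> cyclic p (\<pi> (\<rho> (u + 1))) (\<sigma> u) = x' \<and> \<rho> (u + q) = \<rho> u"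
  have p0: "0 < p" using p prime_gt_0_nat by blast
  have step: "int p dvd int (\<pi> (\<rho> (u + 1))) - int (\<pi> (\<rho> u)) - (int x' - int x)" for u
  proof -
    have "int p dvd (int (\<pi> (\<rho> (u + 1))) + int (\<sigma> u) - int x') - (int (\<pi> (\<rho> u)) + int (\<sigma> u) - int x)"
      using dvd_diff[OF cyclic_dvd[of p "\<pi> (\<rho> (u + 1))" "\<sigma> u"] cyclic_dvd[of p "\<pi> (\<rho> u)" "\<sigma> u"]] all by simp
    then show ?thesis by (simp add: algebra_simps)
  qed
  have aff: "int p dvd int (\<pi> (\<rho> (int n))) - int (\<pi> (\<rho> 0)) - int n * (int x' - int x)" for n
  proof (induction n)
    case (Suc n)
    have "int p dvd (int (\<pi> (\<rho> (int n + 1))) - int (\<pi> (\<rho> (int n))) - (int x' - int x)) + (int (\<pi> (\<rho> (int n))) - int (\<pi> (\<rho> 0)) - int n * (int x' - int x))"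
      using step Suc by (rule dvd_add)
    then show ?case by (simp add: algebra_simps)
  qed simp
  have "\<rho> (0 + q) = \<rho> 0" using all by blast
  moreover have "int (nat q) = q" using q(1) prime_gt_0_int[of q] by simp
  ultimately have "int p dvd - (q * (int x' - int x))" using aff[of "nat q"] by simp
  then have "int p dvd q * (int x' - int x)" by (simp only: dvd_minus_iff)
  moreover have "\<not> int p dvd q" using p q by (metis primes_dvd_imp_eq prime_nat_int_transfer)
  ultimately have "int p dvd int x' - int x" using p by (simp add: prime_dvd_mult_iff)
  moreover have "x < p" "x' < p" using all p0 by (auto simp: cyclic_def)
  ultimately show False using nat_mod_unique[of x' p x] x by auto
qed

lemma N_infinity_prime:
  assumes "prime p"
  shows "has_N_infinity p"
  using subfree_N_infinity[OF cyclic_square cyclic_subfree[OF assms]] prime_gt_0_nat[OF assms] by blast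

lemma cyclic_cycles:
  assumes p: "prime p" and q: "prime q" and \<pi>: "bij_betw \<pi> {..<p} {..<p}"
  shows "no_cycle q p (\<lambda>r. cyclic p (\<pi> r)) \<or>
    q = int p \<and> (\<exists>\<tau>. inj_on \<tau> {..<p} \<and> (\<forall>r<p. \<forall>s<p. cyclic p (\<pi> r) s = (\<tau> r + s) mod p))"
proof (cases "q = int p")
  case True
  moreover have "inj_on \<pi> {..<p}" using \<pi> by (simp add: bij_betw_def)
  ultimately show ?thesis by (auto simp: cyclic_def)
next
  case False
  then show ?thesis using cyclic_no_cycle[OF p q] bij_betwE[OF \<pi>] by auto
qed

theorem N_infinity_prime_odd:
  assumes p: "prime p" "p \<ge> 7" and m: "odd m" "1 < m"
  shows "has_N_infinity (nat m * p)"
proof -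
  \<comment> \<open>In the cyclic square \<open>K\<close> amounts to \<open>r + \<gamma> r\<close>
    not being 1 modulo \<open>p\<close> outside \<open>B\<close>, as 1 is the sum for both rows of
    \<open>B\<close>. The successor map gives \<open>2 * r + 1\<close>, which is harmless, but
    closing the cycle from \<open>p - 1\<close> to 2 would give \<open>p + 1\<close>. Hence 2 and 3
    are swapped and the remaining cycle closes at 4.\<close>
  define \<gamma> where "\<gamma> r = (if r = 1 then 0 else if r = 3 then 2 else if r = p - 1 then 4 else r + 1)" for r :: nat
  have p0: "0 < p" using p by simp
  interpret pattern m p "\<lambda>_ _. cyclic p" \<gamma> "{0, 1}" 0 "{0, 1}"
  proof
    show "1 < m" by (rule m)
    show "2 < p" "0 < p" "{0, 1} \<subseteq> {..<p}" using p by auto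
    have "2 \<in> {..<p}" using p by auto
    then show "{0, 1} \<noteq> {..<p}" by (metis empty_iff insert_iff numeral_2_eq_2 One_nat_def Suc_inject nat.distinct(1))
    show "square p (cyclic p)" "subfree p (cyclic p)" using cyclic_square[OF p0] cyclic_subfree[OF p(1)] .
    show "(\<lambda>r. cyclic p r 0) ` {0, 1} = {0, 1}" using p by (auto simp: cyclic_def)
    show "bij_betw \<gamma> {..<p} {..<p}"
    proof (rule endo_bij)
      show "inj_on \<gamma> {..<p}" using p by (auto simp: inj_on_def \<gamma>_def split: if_splits)
    qed (use p in \<open>auto simp: \<gamma>_def\<close>)
    show "\<gamma> r \<noteq> r" if "r < p" for r using p that by (auto simp: \<gamma>_def)
    show "\<gamma> r \<in> {0, 1} \<longleftrightarrow> r \<in> {0, 1}" if "r < p" for r using p that by (auto simp: \<gamma>_def)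
  next
    fix q b c assume "prime q" "q dvd m" "odd q"
    then show "no_cycle q p (cyclic p) \<or>
       (q = int p \<and> (odd m \<longrightarrow> q \<ge> 7 \<and> card {0 :: nat, 1} = 2) \<and>
        (\<exists>\<pi>. inj_on \<pi> {..<p} \<and> (\<forall>r<p. \<forall>s<p. cyclic p r s = (\<pi> r + s) mod p)))"
      using cyclic_cycles[OF p(1), of q "\<lambda>r. r"] p(2) by (auto simp: bij_betw_def)
  next
    fix r r' s assume r: "r < p" "r \<notin> {0, 1}" and r': "r' \<in> {0, 1 :: nat}" and s: "s < p"
    have r2: "r \<ge> 2" using r by auto
    have sum': "int r' + int (\<gamma> r') = 1" using r' p by (auto simp: \<gamma>_def)
    have nd: "\<not> int p dvd int r + int (\<gamma> r) - 1"
    proof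
      assume d: "int p dvd int r + int (\<gamma> r) - 1"
      consider "r = 2 \<or> r = 3" | "r = p - 1" "r \<noteq> 3" | "r \<noteq> 3" "r \<noteq> p - 1" by blast
      then show False
      proof cases
        case 1
        then have "int p dvd 4" using d p by (auto simp: \<gamma>_def split: if_splits)
        then show False using p by (auto dest: zdvd_imp_le)
      next
        case 2
        then have "int r + int (\<gamma> r) - 1 = int p + 2" using p by (simp add: \<gamma>_def)
        then have "int p dvd 2" using d by (metis dvd_add_right_iff dvd_refl)
        then show False using p by (auto dest: zdvd_imp_le)
      next
        case 3
        then have "int r + int (\<gamma> r) - 1 = 2 * int r" using r2 by (simp add: \<gamma>_def)
        then have "int p dvd 2 * int r" using d by (simp only:)
        then have "int p dvd 2 \<or> int p dvd int r" using p(1) by (simp add: prime_dvd_mult_iff)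
        then show False using p r r2 by (auto dest!: zdvd_imp_le)
      qed
    qed
    have c0: "cyclic p z 0 = z" if "z < p" for z using that by (simp add: cyclic_def)
    have \<gamma>lt: "\<gamma> z < p" if "z < p" for z using p that by (auto simp: \<gamma>_def)
    have r'p: "r' < p" using r' p by auto
    have a1: False if "cyclic p r s = r'" "cyclic p (\<gamma> r') s = \<gamma> r"
    proof -
      have "int p dvd (int r + int s - int r') - (int (\<gamma> r') + int s - int (\<gamma> r))"
        using dvd_diff[OF cyclic_dvd[of p r s] cyclic_dvd[of p "\<gamma> r'" s]] that by simp
      moreover have "(int r + int s - int r') - (int (\<gamma> r') + int s - int (\<gamma> r)) = int r + int (\<gamma> r) - 1" using sum' by simp
      ultimately show False using nd by simp
    qed
    have a2: False if "cyclic p (\<gamma> r) s = \<gamma> r'" "cyclic p r' s = r"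
    proof -
      have "int p dvd (int (\<gamma> r) + int s - int (\<gamma> r')) - (int r' + int s - int r)"
        using dvd_diff[OF cyclic_dvd[of p "\<gamma> r" s] cyclic_dvd[of p r' s]] that by simp
      moreover have "(int (\<gamma> r) + int s - int (\<gamma> r')) - (int r' + int s - int r) = int r + int (\<gamma> r) - 1" using sum' by simp
      ultimately show False using nd by simp
    qed
    show "\<not> (cyclic p r s = cyclic p r' 0 \<and> cyclic p (\<gamma> r') s = cyclic p (\<gamma> r) 0) \<and>
       \<not> (cyclic p (\<gamma> r) s = cyclic p (\<gamma> r') 0 \<and> cyclic p r' s = cyclic p r 0)"
      using a1 a2 c0[OF r(1)] c0[OF r'p] c0[OF \<gamma>lt[OF r(1)]] c0[OF \<gamma>lt[OF r'p]] by auto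
  qed (use m in auto)
  show ?thesis by (rule N_infinity_pattern)
qed

theorem N_infinity_prime_even:
  assumes p: "prime p" "p \<ge> 5" and m: "even m" "1 < m"
  shows "has_N_infinity (nat m * p)"
proof -
  \<comment> \<open>A transposition on \<open>B = {1, p - 1}\<close> and the cycle 0, 2, 3, ...,
    \<open>p - 2\<close> on the rest, so no row is fixed. \<open>B\<close> is closed under negation
    and avoids 0 and 2, so that \<open>\<nu>\<close> and \<open>\<beta>\<close> preserve it.\<close>
  define \<gamma> where "\<gamma> r = (if r = 1 then p - 1 else if r = p - 1 then 1 else if r = 0 then 2 else if r = p - 2 then 0 else r + 1)" for r :: nat
  \<comment> \<open>Adding the two equations in \<open>dead2\<close> cancels the columns and leaves
    \<open>r + \<nu> r = r' + \<beta> r'\<close> modulo \<open>p\<close>. The left side is 0 since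
    \<open>\<nu>\<close> is negation; the right side is \<open>2 * r'\<close>, or 2 for the rows
    that \<open>\<beta>\<close> swaps. Moving 0 is what keeps it from vanishing.\<close>
  define \<beta> where "\<beta> r = (if r = 0 then 2 else if r = 2 then 0 else r)" for r :: nat
  define \<nu> where "\<nu> r = (if r = 0 then 0 else p - r)" for r :: nat
  define \<Pi> where "\<Pi> b c = (if \<not> c then (\<lambda>r. r) else if b then \<beta> else \<nu>)" for b c
  have p0: "0 < p" using p by simp
  have \<beta>: "bij_betw \<beta> {..<p} {..<p}"
    by (rule endo_bij) (use p in \<open>auto simp: inj_on_def \<beta>_def split: if_splits\<close>)
  have \<nu>: "bij_betw \<nu> {..<p} {..<p}"
    by (rule endo_bij) (use p in \<open>auto simp: inj_on_def \<nu>_def split: if_splits\<close>)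
  have \<Pi>: "bij_betw (\<Pi> b c) {..<p} {..<p}" for b c using \<beta> \<nu> by (simp add: \<Pi>_def bij_betw_def)
  interpret pattern m p "\<lambda>b c r. cyclic p (\<Pi> b c r)" \<gamma> "{1, p - 1}" 0 "{1, p - 1}"
  proof
    show "1 < m" by (rule m)
    show "2 < p" "0 < p" "{1, p - 1} \<subseteq> {..<p}" using p by auto
    have "0 \<in> {..<p}" "0 \<notin> {1, p - 1}" using p by auto
    then show "{1, p - 1} \<noteq> {..<p}" by blast
    show "square p (\<lambda>r. cyclic p (\<Pi> b c r))" for b c by (rule square_permute_rows[OF cyclic_square[OF p0] \<Pi>])
    show "subfree p (\<lambda>r. cyclic p (\<Pi> b c r))" for b c by (rule subfree_permute_rows[OF cyclic_subfree[OF p(1)] \<Pi>])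
    show "(\<lambda>r. cyclic p (\<Pi> b c r) 0) ` {1, p - 1} = {1, p - 1}" for b c
      using p by (auto simp: cyclic_def \<Pi>_def \<beta>_def \<nu>_def)
    show "bij_betw \<gamma> {..<p} {..<p}"
    proof (rule endo_bij)
      show "inj_on \<gamma> {..<p}" 
        by (rule inj_on_inverseI[where g = "\<lambda>r. if r = p - 1 then 1 else if r = 1 then p - 1 else if r = 2 then 0 else if r = 0 then p - 2 else r - 1"])
          (use p in \<open>auto simp: \<gamma>_def\<close>)
    qed (use p in \<open>auto simp: \<gamma>_def\<close>)
    show "\<gamma> r \<noteq> r" if "r < p" for r using p that by (auto simp: \<gamma>_def)
    show "\<gamma> r \<in> {1, p - 1} \<longleftrightarrow> r \<in> {1, p - 1}" if "r < p" for r using p that by (auto simp: \<gamma>_def)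
  next
    fix r r' s s' assume "r < p" and r': "r' < p"
      and 1: "cyclic p (\<Pi> False False r) s = cyclic p (\<Pi> True False r') s'"
      and 2: "cyclic p (\<Pi> False True r) s' = cyclic p (\<Pi> True True r') s"
    have e1: "int p dvd (int r + int s) - (int r' + int s')"
      using dvd_diff[OF cyclic_dvd[of p r s] cyclic_dvd[of p r' s']] 1 by (simp add: \<Pi>_def algebra_simps)
    have "int p dvd (int (\<nu> r) + int s') - (int (\<beta> r') + int s)"
      using dvd_diff[OF cyclic_dvd[of p "\<nu> r" s'] cyclic_dvd[of p "\<beta> r'" s]] 2 by (simp add: \<Pi>_def algebra_simps)
    then have "int p dvd ((int r + int s) - (int r' + int s')) + ((int (\<nu> r) + int s') - (int (\<beta> r') + int s))"
      by (rule dvd_add[OF e1])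
    then have "int p dvd (int r + int (\<nu> r)) - (int r' + int (\<beta> r'))" by (simp add: algebra_simps)
    moreover have "int p dvd int r + int (\<nu> r)" using \<open>r < p\<close> by (simp add: \<nu>_def)
    ultimately have d: "int p dvd int r' + int (\<beta> r')" by (metis dvd_diff_right_iff)
    show False
    proof (cases "r' = 0 \<or> r' = 2")
      case True
      then have "int p dvd 2" using d by (auto simp: \<beta>_def)
      then show False using p by (auto dest: zdvd_imp_le)
    next
      case False
      then have "int p dvd 2 * int r'" using d by (simp add: \<beta>_def)
      then have "int p dvd 2 \<or> int p dvd int r'" using p(1) by (simp add: prime_dvd_mult_iff)
      then show False using p r' False by (auto dest!: zdvd_imp_le)
    qed
  next
    fix q b c assume "prime q" "q dvd m" "odd q"
    then show "no_cycle q p (\<lambda>r. cyclic p (\<Pi> b c r)) \<or>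
       (q = int p \<and> (odd m \<longrightarrow> q \<ge> 7 \<and> card {1, p - 1} = 2) \<and>
        (\<exists>\<pi>. inj_on \<pi> {..<p} \<and> (\<forall>r<p. \<forall>s<p. cyclic p (\<Pi> b c r) s = (\<pi> r + s) mod p)))"
      using cyclic_cycles[OF p(1) _ \<Pi>, of q b c] m(1) by auto
  qed (use m in auto)
  show ?thesis by (rule N_infinity_pattern)
qed

section \<open>Verification of explicit squares\<close>

text \<open>Tables are indexed by integers, whose numerals the simplifier evaluates without converting \<open>1\<close> to \<open>Suc 0\<close>.\<close>

type_synonym table = "int \<Rightarrow> int \<Rightarrow> int"

definition lookup :: "int list list \<Rightarrow> table" where
  "lookup M r s = M ! nat r ! nat s"

text \<open>Simplification splits this single equation between matrices into one rewrite rule per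
  cell, so the table is afterwards evaluated without indexing into lists. The last two premises only
  check the shape of \<open>M\<close>.\<close>

lemma lookup_eqs:
  assumes f: "f = lookup M" and D: "D = map int [0..<a]"
    and len: "list_all2 (\<lambda>_ _. True) D M" "list_all (list_all2 (\<lambda>_ _. True) D) M"
  shows "map (\<lambda>r. map (f r) D) D = M"
proof (rule nth_equalityI)
  have M: "length M = a" using list_all2_lengthD[OF len(1)] D by simp
  then show "length (map (\<lambda>r. map (f r) D) D) = length M" by (simp add: D)
  fix i assume "i < length (map (\<lambda>r. map (f r) D) D)"
  then have i: "i < a" using D by simp
  then have "list_all2 (\<lambda>_ _. True) D (M ! i)" using len(2) M by (simp add: list_all_length)
  then have "length (M ! i) = a" using D by (auto dest: list_all2_lengthD)
  then have "map (f (int i)) D = M ! i"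
    using D f by (intro nth_equalityI) (simp_all add: lookup_def)
  then show "map (\<lambda>r. map (f r) D) D ! i = M ! i" using i D by simp
qed

definition nat_square :: "table \<Rightarrow> nat \<Rightarrow> nat \<Rightarrow> nat" where
  "nat_square T r s = nat (T (int r) (int s))"

fun exceeds :: "nat \<Rightarrow> 'a list \<Rightarrow> bool" where
  "exceeds n [] = False"
| "exceeds 0 (x # xs) = True"
| "exceeds (Suc n) (x # xs) = exceeds n xs"

text \<open>\<open>Q\<close> collects the orbit so far, and the counter bounds its length. Started
  with counter \<open>h\<close> and list \<open>[r]\<close>, it ends with \<open>h + 1\<close> rows;
  testing \<open>distinct\<close> then makes it unnecessary to prove that an orbit cannot repeat
  before it closes.\<close>

fun walk :: "nat \<Rightarrow> (int \<Rightarrow> int) \<Rightarrow> (int list \<Rightarrow> bool) \<Rightarrow> int \<Rightarrow> int \<Rightarrow> int list \<Rightarrow> bool" where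
  "walk 0 f P r z Q = distinct Q"
| "walk (Suc n) f P r z Q = (if z < r then True else if z = r then P Q else walk n f P r (f z) (z # Q))"

fun no_return :: "nat \<Rightarrow> (int \<Rightarrow> int) \<Rightarrow> int \<Rightarrow> int \<Rightarrow> bool" where
  "no_return 0 f r z = (z \<noteq> r)"
| "no_return (Suc n) f r z = (if z < r then True else no_return n f r (f z))"

lemma exceeds_numeral: "exceeds (numeral k) (x # xs) = exceeds (pred_numeral k) xs"
  by (simp add: numeral_eq_Suc)

lemma walk_numeral:
  "walk (numeral k) f P r z Q = (if z < r then True else if z = r then P Q else walk (pred_numeral k) f P r (f z) (z # Q))"
  by (simp add: numeral_eq_Suc)

lemma no_return_numeral:
  "no_return (numeral k) f r z = (if z < r then True else no_return (pred_numeral k) f r (f z))"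
  by (simp add: numeral_eq_Suc)

lemma exceeds_iff: "exceeds n xs \<longleftrightarrow> n < length xs"
  by (induction n xs rule: exceeds.induct) auto

text \<open>One round of closure: columns of \<open>x\<close> in the rows \<open>Q\<close>, then
  symbols, columns and rows, all of which a subsquare containing \<open>x\<close> and
  \<open>Q\<close> must contain. \<open>remdups\<close> turns list length into cardinality, and each
  stage is tested before the next to keep the lists short.\<close>

definition refuted :: "nat \<Rightarrow> table \<Rightarrow> table \<Rightarrow> table \<Rightarrow> int \<Rightarrow> int \<Rightarrow> int list \<Rightarrow> bool" where
  "refuted h T V W x r Q = (let K = map (V x) Q in
     if list_ex (\<lambda>r. list_ex (\<lambda>s. T r s < x) K) Q then True
     else let N = remdups (concat (map (\<lambda>r. map (T r) K) Q)) in
       if exceeds h N then True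
       else let C = remdups (concat (map (\<lambda>x. map (V x) Q) N)) in
         if exceeds h C then True
         else let S = remdups (concat (map (\<lambda>x. map (W x) C) N)) in
           if list_ex (\<lambda>r'. r' < r) S then True else exceeds h S)"

text \<open>\<open>V x r\<close> is the column of symbol \<open>x\<close> in row \<open>r\<close>, and \<open>W x s\<close> is its row in column \<open>s\<close>.\<close>

definition inverse_tables :: "int \<Rightarrow> int list \<Rightarrow> table \<Rightarrow> table \<Rightarrow> table \<Rightarrow> bool" where
  "inverse_tables a D T V W \<longleftrightarrow> list_all (\<lambda>x. list_all (\<lambda>r.
     0 \<le> V x r \<and> V x r < a \<and> T r (V x r) = x \<and> 0 \<le> W x r \<and> W x r < a \<and> T (W x r) r = x) D) D"

definition col :: "int list \<Rightarrow> table \<Rightarrow> table" where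
  "col D T x r = the (find (\<lambda>s. T r s = x) D)"

definition row :: "int list \<Rightarrow> table \<Rightarrow> table" where
  "row D T x s = the (find (\<lambda>r. T r s = x) D)"

definition latin_check :: "int \<Rightarrow> int list \<Rightarrow> table \<Rightarrow> bool" where
  "latin_check a D T \<longleftrightarrow> list_all (\<lambda>r. distinct (map (T r) D) \<and> distinct (map (\<lambda>s. T s r) D) \<and>
     list_all (\<lambda>s. 0 \<le> T r s \<and> T r s < a) D) D"

text \<open>
  In a subsquare with least row \<open>r\<close>, least symbol \<open>x\<close> and another symbol \<open>x'\<close>, the rows are closed
  under \<open>z \<mapsto> W x' (V x z)\<close>. The orbit of \<open>r\<close> either falls below \<open>r\<close>, or has more than \<open>h\<close> elements, or
  is closed, in which case \<open>refuted\<close> looks for a symbol or row that is too small or for too large a set.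
\<close>

definition subfree_check :: "nat \<Rightarrow> int list \<Rightarrow> table \<Rightarrow> table \<Rightarrow> table \<Rightarrow> bool" where
  "subfree_check h D T V W = sorted_wrt (\<lambda>x x'.
     list_all (\<lambda>r. walk h (\<lambda>z. W x' (V x z)) (refuted h T V W x r) r (W x' (V x r)) [r]) D) D"

text \<open>A closed walk can be read from its least row, so the search may stop once it falls below
  \<open>r\<close>. Reversing the walk exchanges \<open>x\<close> and \<open>x'\<close>, so the
  pairs with \<open>x < x'\<close> suffice.\<close>

definition cycle_check :: "nat \<Rightarrow> int list \<Rightarrow> table \<Rightarrow> table \<Rightarrow> bool" where
  "cycle_check q D V W = sorted_wrt (\<lambda>x x'. list_all (\<lambda>r. no_return q (\<lambda>z. W x' (V x z)) r r) D) D"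

text \<open>Counter and list together exceed \<open>card R\<close>, so a walk inside
  \<open>R\<close> cannot run out with a list of distinct rows. It never falls below the least row
  \<open>r\<close> either, so it closes, and \<open>P\<close> holds of the orbit.\<close>

lemma walk_sound:
  assumes "walk n f P r z Q" "z \<in> R" "set Q \<subseteq> R" "card R < n + length Q"
    and R: "\<And>z. z \<in> R \<Longrightarrow> f z \<in> R" "\<And>z. z \<in> R \<Longrightarrow> r \<le> z" "finite R"
  shows "\<exists>Q. set Q \<subseteq> R \<and> P Q"
  using assms(1-4)
proof (induction n arbitrary: z Q)
  case 0
  then have "length Q \<le> card R" using R(3) card_mono distinct_card by (metis walk.simps(1))
  then show ?case using 0 by simp
next
  case (Suc n)
  show ?case
  proof (cases "z = r")
    case True
    then have "P Q" using Suc.prems by simp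
    then show ?thesis using Suc.prems by blast
  next
    case False
    then have "walk n f P r (f z) (z # Q)" using Suc.prems R(2)[of z] by (simp split: if_splits)
    then show ?thesis using Suc.IH[of "f z" "z # Q"] Suc.prems R(1)[of z] by simp
  qed
qed

section \<open>Soundness of the checks for tables with inverses\<close>

locale tables =
  fixes a :: nat and D :: "int list" and T V W :: table
  assumes D: "D = map int [0..<a]" and inv: "inverse_tables (int a) D T V W"
begin

abbreviation I :: "int set" where "I \<equiv> {0..<int a}"

lemma set_D: "set D = I"
proof -
  have "int ` {0..<a} = {0..<int a}" by (simp add: image_int_atLeastLessThan)
  then show ?thesis by (simp add: D)
qed

lemma VW: "x \<in> I \<Longrightarrow> r \<in> I \<Longrightarrow> V x r \<in> I \<and> T r (V x r) = x \<and> W x r \<in> I \<and> T (W x r) r = x"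
  using inv unfolding inverse_tables_def list_all_iff set_D by simp

lemma surj_inj: "I \<subseteq> f ` I \<Longrightarrow> inj_on f I \<and> f ` I = I"
proof -
  assume s: "I \<subseteq> f ` I"
  have "card (f ` I) \<le> card I" by (rule card_image_le) simp
  then have "f ` I = I" using card_seteq[of "f ` I" I] s by simp
  then show ?thesis by (simp add: eq_card_imp_inj_on)
qed

lemma row_onto: "r \<in> I \<Longrightarrow> inj_on (T r) I \<and> T r ` I = I"
proof (rule surj_inj, rule subsetI)
  fix x assume "r \<in> I" "x \<in> I"
  then show "x \<in> T r ` I" using VW[of x r] by (metis imageI)
qed

lemma col_onto: "s \<in> I \<Longrightarrow> inj_on (\<lambda>r. T r s) I \<and> (\<lambda>r. T r s) ` I = I"
proof (rule surj_inj, rule subsetI)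
  fix x assume "s \<in> I" "x \<in> I"
  then show "x \<in> (\<lambda>r. T r s) ` I" using VW[of x s] by (metis (mono_tags, lifting) imageI)
qed

lemma T_in: "r \<in> I \<Longrightarrow> s \<in> I \<Longrightarrow> T r s \<in> I"
  using row_onto by blast

lemma V_eq: "r \<in> I \<Longrightarrow> s \<in> I \<Longrightarrow> V (T r s) r = s"
  using row_onto VW[OF T_in, of r s r] by (metis inj_onD)

lemma W_eq: "r \<in> I \<Longrightarrow> s \<in> I \<Longrightarrow> W (T r s) s = r"
  using col_onto[of s] VW[OF T_in, of r s s] by (metis (no_types, lifting) inj_onD)

text \<open>Once the entries of \<open>T\<close> are inserted, these are rewrite rules for
  \<open>V\<close> and \<open>W\<close> at numerals; the checks then run without searching.\<close>

lemma inverse_facts: "list_all (\<lambda>r. list_all (\<lambda>s. V (T r s) r = s \<and> W (T r s) s = r) D) D"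
  unfolding list_all_iff set_D using V_eq W_eq by blast

lemma int_I: "r < a \<Longrightarrow> int r \<in> I"
  by simp

lemma int_nat_square: "r < a \<Longrightarrow> s < a \<Longrightarrow> int (nat_square T r s) = T (int r) (int s)"
  using T_in[OF int_I int_I, of r s] by (simp add: nat_square_def)

lemma square: "square a (nat_square T)"
  unfolding square_def
proof (intro conjI allI impI)
  fix r assume r: "r < a"
  show "bij_betw (nat_square T r) {..<a} {..<a}"
  proof (rule endo_bij)
    show "inj_on (nat_square T r) {..<a}"
    proof (rule inj_onI)
      fix s s' assume s: "s \<in> {..<a}" "s' \<in> {..<a}" and "nat_square T r s = nat_square T r s'"
      then have "T (int r) (int s) = T (int r) (int s')" using int_nat_square r by (metis lessThan_iff)
      then show "s = s'" using row_onto[OF int_I[OF r]] s by (auto dest: inj_onD)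
    qed
    show "nat_square T r s < a" if "s < a" for s
      using T_in[OF int_I[OF r] int_I[OF that]] int_nat_square[OF r that] by simp
  qed
next
  fix s assume s: "s < a"
  show "bij_betw (\<lambda>r. nat_square T r s) {..<a} {..<a}"
  proof (rule endo_bij)
    show "inj_on (\<lambda>r. nat_square T r s) {..<a}"
    proof (rule inj_onI)
      fix r r' assume r: "r \<in> {..<a}" "r' \<in> {..<a}" and "nat_square T r s = nat_square T r' s"
      then have "T (int r) (int s) = T (int r') (int s)" using int_nat_square s by (metis lessThan_iff)
      then show "r = r'" using col_onto[OF int_I[OF s]] r by (auto dest: inj_onD)
    qed
    show "nat_square T r s < a" if "r < a" for r
      using T_in[OF int_I[OF that] int_I[OF s]] int_nat_square[OF that s] by simp
  qed
qed

lemma sorted_wrt_D: "sorted_wrt P D \<Longrightarrow> x \<in> I \<Longrightarrow> x' \<in> I \<Longrightarrow> x < x' \<Longrightarrow> P x x'"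
  using sorted_wrt_nth_less[of P D "nat x" "nat x'"] by (simp add: D)

lemma no_sub:
  assumes check: "subfree_check (a div 2) D T V W"
    and R: "R \<subseteq> I" and C: "C \<subseteq> I" and N: "finite N" and cR: "card R = card C" and cN: "card N = card C"
    and v: "\<And>r s. r \<in> R \<Longrightarrow> s \<in> C \<Longrightarrow> T r s \<in> N" and k: "2 \<le> card C" "card C < a"
  shows False
proof -
  let ?h = "a div 2"
  have fin: "finite R" "finite C" using R C finite_subset by blast+
  have rowN: "T r ` C = N" if "r \<in> R" for r
  proof (rule card_subset_eq[OF N])
    have "inj_on (T r) C" using row_onto[of r] that R C by (meson inj_on_subset subsetD)
    then show "card (T r ` C) = card N" using cN by (simp add: card_image)
  qed (use v that in auto)
  have colN: "(\<lambda>r. T r s) ` R = N" if "s \<in> C" for s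
  proof (rule card_subset_eq[OF N])
    have "inj_on (\<lambda>r. T r s) R" using col_onto[of s] that R C by (meson inj_on_subset subsetD)
    then show "card ((\<lambda>r. T r s) ` R) = card N" using cR cN by (simp add: card_image)
  qed (use v that in auto)
  have V_C: "V x r \<in> C" if xr: "x \<in> N" "r \<in> R" for x r
  proof -
    obtain s where "s \<in> C" "x = T r s" using rowN[OF xr(2)] xr(1) by blast
    then show ?thesis using V_eq[of r s] xr(2) R C by (metis subsetD)
  qed
  have W_R: "W x s \<in> R" if xs: "x \<in> N" "s \<in> C" for x s
  proof -
    obtain r where "r \<in> R" "x = T r s" using colN[OF xs(2)] xs(1) by blast
    then show ?thesis using W_eq[of r s] xs(2) R C by (metis subsetD)
  qed
  have "R \<noteq> {}" "C \<noteq> {}" "N \<noteq> {}" using k cR cN by auto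
  obtain r1 where "r1 \<in> R" using \<open>R \<noteq> {}\<close> by blast
  have NI: "N \<subseteq> I"
  proof -
    have "T r1 ` C \<subseteq> I" using T_in \<open>r1 \<in> R\<close> R C by blast
    then show ?thesis using rowN[OF \<open>r1 \<in> R\<close>] by simp
  qed
  \<comment> \<open>In a row \<open>r0\<close> outside \<open>R\<close>, each symbol of
    \<open>N\<close> stands in a column outside \<open>C\<close>, because inside \<open>C\<close>
    its cell belongs to a row of \<open>R\<close>. So \<open>N\<close> injects into the complement
    of \<open>C\<close>.\<close>
  have half: "card C \<le> ?h"
  proof -
    have "\<not> I \<subseteq> R" using card_mono[OF fin(1), of I] cR k by auto
    then obtain r0 where r0: "r0 \<in> I" "r0 \<notin> R" by blast
    have inj: "inj_on (\<lambda>x. V x r0) N"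
    proof (rule inj_onI)
      fix x y assume "x \<in> N" "y \<in> N" "V x r0 = V y r0"
      then show "x = y" using VW[of x r0] VW[of y r0] NI r0 by (metis subsetD)
    qed
    have "V x r0 \<in> I - C" if x: "x \<in> N" for x
    proof -
      have x': "V x r0 \<in> I" "T r0 (V x r0) = x" using VW[of x r0] x NI r0 by auto
      moreover have "V x r0 \<notin> C"
      proof
        assume c: "V x r0 \<in> C"
        then have "W x (V x r0) \<in> R" using W_R x by blast
        moreover have "W x (V x r0) = r0" using W_eq[OF r0(1) x'(1)] x'(2) by simp
        ultimately show False using r0 by simp
      qed
      ultimately show ?thesis by blast
    qed
    then have "card N \<le> card (I - C)" using inj by (intro card_inj_on_le) auto
    also have "\<dots> = a - card C" using C fin by (simp add: card_Diff_subset)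
    finally show ?thesis using cN by linarith
  qed
  define x where "x = Min N"
  define r where "r = Min R"
  have x: "x \<in> N" "\<And>y. y \<in> N \<Longrightarrow> x \<le> y" using N \<open>N \<noteq> {}\<close> by (auto simp: x_def)
  have r: "r \<in> R" "\<And>y. y \<in> R \<Longrightarrow> r \<le> y" using fin \<open>R \<noteq> {}\<close> by (auto simp: r_def)
  have "\<not> N \<subseteq> {x}" using card_mono[of "{x}" N] cN k by auto
  then obtain x' where x': "x' \<in> N" "x' \<noteq> x" by blast
  then have "x < x'" using x(2)[of x'] by simp
  let ?f = "\<lambda>z. W x' (V x z)"
  have f: "?f z \<in> R" if "z \<in> R" for z using V_C W_R x x' that by blast
  have "list_all (\<lambda>r. walk ?h ?f (refuted ?h T V W x r) r (?f r) [r]) D"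
    using sorted_wrt_D[OF check[unfolded subfree_check_def], of x x'] x x' NI \<open>x < x'\<close> by blast
  moreover have "r \<in> set D" using r R set_D by blast
  ultimately have wk: "walk ?h ?f (refuted ?h T V W x r) r (?f r) [r]" by (simp add: list_all_iff)
  have "\<exists>Q. set Q \<subseteq> R \<and> refuted ?h T V W x r Q"
    by (rule walk_sound[OF wk f[OF r(1)]]) (use r f fin half cR in auto)
  then obtain Q where Q: "set Q \<subseteq> R" "refuted ?h T V W x r Q" by blast
  define K where "K = map (V x) Q"
  define N' where "N' = remdups (concat (map (\<lambda>r. map (T r) K) Q))"
  define C' where "C' = remdups (concat (map (\<lambda>x. map (V x) Q) N'))"
  define S where "S = remdups (concat (map (\<lambda>x. map (W x) C') N'))"
  have K: "set K \<subseteq> C" using V_C x Q by (auto simp: K_def)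
  have N': "set N' \<subseteq> N" using v K Q by (auto simp: N'_def)
  have C': "set C' \<subseteq> C" using V_C N' Q by (auto simp: C'_def)
  have S: "set S \<subseteq> R" using W_R N' C' by (auto simp: S_def)
  have 1: "\<not> list_ex (\<lambda>r. list_ex (\<lambda>s. T r s < x) K) Q"
    using v K Q x(2) by (fastforce simp: list_ex_iff)
  have 2: "\<not> exceeds ?h N'"
    using card_mono[OF N N'] distinct_card[of N'] half cN by (simp add: exceeds_iff N'_def)
  have 3: "\<not> exceeds ?h C'"
    using card_mono[OF fin(2) C'] distinct_card[of C'] half by (simp add: exceeds_iff C'_def)
  have 4: "\<not> exceeds ?h S"
    using card_mono[OF fin(1) S] distinct_card[of S] half cR by (simp add: exceeds_iff S_def)
  have 5: "\<not> list_ex (\<lambda>r'. r' < r) S" using S r(2) by (fastforce simp: list_ex_iff)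
  show False
    using Q(2) 1 2 3 4 5
    unfolding refuted_def Let_def K_def[symmetric] N'_def[symmetric] C'_def[symmetric] S_def[symmetric] by simp
qed

lemma subfree:
  assumes "subfree_check (a div 2) D T V W"
  shows "subfree a (nat_square T)"
  unfolding subfree_def
proof (intro allI impI, rule ccontr)
  fix R C N :: "nat set" assume R: "R \<subseteq> {..<a}" and C: "C \<subseteq> {..<a}" and N: "finite N"
    and c: "card R = card C" "card N = card C" and v: "\<forall>r\<in>R. \<forall>s\<in>C. nat_square T r s \<in> N"
    and k: "\<not> (card C < 2 \<or> a \<le> card C)"
  have ci: "card (int ` A) = card A" for A :: "nat set" by (simp add: card_image)
  have "T r s \<in> int ` N" if mem: "r \<in> int ` R" "s \<in> int ` C" for r s
  proof -
    obtain r' s' where rs: "r = int r'" "r' \<in> R" "s = int s'" "s' \<in> C" using mem by blast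
    then have "r' < a" "s' < a" using R C by auto
    then have "T r s = int (nat_square T r' s')" using int_nat_square[of r' s'] rs by simp
    then show ?thesis using v rs by blast
  qed
  moreover have "int ` R \<subseteq> I" "int ` C \<subseteq> I" using R C by auto
  ultimately show False
    using no_sub[OF assms, of "int ` R" "int ` C" "int ` N"] N c k by (simp add: ci)
qed

lemma no_return_sound:
  assumes "no_return n f r (\<rho> u)" "\<rho> (u + int n) = r" "\<And>u. r \<le> \<rho> u" "\<And>u. f (\<rho> u) = \<rho> (u + 1)"
  shows False
  using assms(1,2)
proof (induction n arbitrary: u)
  case (Suc n)
  then have "no_return n f r (\<rho> (u + 1))" using assms(3)[of u] assms(4) by (simp add: not_less[symmetric])
  moreover have "\<rho> (u + 1 + int n) = r" using Suc(3) by (simp add: algebra_simps)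
  ultimately show ?case by (rule Suc(1))
qed simp

lemma no_cycle:
  assumes check: "cycle_check q D V W"
  shows "no_cycle (int q) a (nat_square T)"
proof -
  have ordered: False if x: "x < x'" and all: "\<And>u::int. \<rho> u < a \<and> \<sigma> u < a \<and> nat_square T (\<rho> u) (\<sigma> u) = x \<and>
     nat_square T (\<rho> (u + 1)) (\<sigma> u) = x' \<and> \<rho> (u + int q) = \<rho> u" for x x' and \<rho> \<sigma> :: "int \<Rightarrow> nat"
  proof -
    have T1: "T (int (\<rho> u)) (int (\<sigma> u)) = int x" "T (int (\<rho> (u + 1))) (int (\<sigma> u)) = int x'" for u
      using all[of u] all[of "u + 1"] int_nat_square by metis+
    let ?f = "\<lambda>z. W (int x') (V (int x) z)"
    have f: "?f (int (\<rho> u)) = int (\<rho> (u + 1))" for u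
      using V_eq[of "int (\<rho> u)" "int (\<sigma> u)"] W_eq[of "int (\<rho> (u + 1))" "int (\<sigma> u)"] T1[of u] all[of u] all[of "u + 1"] by simp
    have xI: "int x \<in> I" "int x' \<in> I"
      using T_in[of "int (\<rho> 0)" "int (\<sigma> 0)"] T_in[of "int (\<rho> 1)" "int (\<sigma> 0)"] T1[of 0] all[of 0] all[of 1] by simp_all
    obtain u0 where u0: "\<And>u. \<rho> u0 \<le> \<rho> u" using ex_has_least_nat[of "\<lambda>_. True" _ \<rho>] by blast
    have "list_all (\<lambda>r. no_return q ?f r r) D"
      using sorted_wrt_D[OF check[unfolded cycle_check_def] xI] x by simp
    moreover have "int (\<rho> u0) \<in> set D" using all[of u0] by (simp add: set_D)
    ultimately have "no_return q ?f (int (\<rho> u0)) (int (\<rho> u0))" by (simp add: list_all_iff)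
    then show False
      using no_return_sound[of q ?f "int (\<rho> u0)" "\<lambda>u. int (\<rho> u)" u0] f u0 all by simp
  qed
  show ?thesis
    unfolding no_cycle_def
  proof (intro allI impI)
    fix x x' and \<rho> \<sigma> :: "int \<Rightarrow> nat" assume "x \<noteq> x'"
      and all: "\<forall>u. \<rho> u < a \<and> \<sigma> u < a \<and> nat_square T (\<rho> u) (\<sigma> u) = x \<and>
       nat_square T (\<rho> (u + 1)) (\<sigma> u) = x' \<and> \<rho> (u + int q) = \<rho> u"
    show False
    proof (cases "x < x'")
      case True
      then show False using ordered[of x x' \<rho> \<sigma>] all by blast
    next
      case False
      then have "x' < x" using \<open>x \<noteq> x'\<close> by simp
      moreover have "\<rho> (- u) < a \<and> \<sigma> (- u - 1) < a \<and> nat_square T (\<rho> (- u)) (\<sigma> (- u - 1)) = x' \<and>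
        nat_square T (\<rho> (- (u + 1))) (\<sigma> (- u - 1)) = x \<and> \<rho> (- (u + int q)) = \<rho> (- u)" for u
        using all[rule_format, of "- u"] all[rule_format, of "- u - 1"] all[rule_format, of "- (u + int q)"] by simp
      ultimately show False using ordered[of x' x "\<lambda>u. \<rho> (- u)" "\<lambda>u. \<sigma> (- u - 1)"] by blast
    qed
  qed
qed

end

lemma find_inj:
  assumes surj: "{0..<int a} \<subseteq> f ` {0..<int a}" and D: "set D = {0..<int a}" and x: "x \<in> {0..<int a}"
  shows "the (find (\<lambda>s. f s = x) D) \<in> {0..<int a} \<and> f (the (find (\<lambda>s. f s = x) D)) = x"
proof (cases "find (\<lambda>s. f s = x) D")
  case None
  moreover have "\<exists>s\<in>set D. f s = x" using surj x unfolding D by blast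
  ultimately show ?thesis by (auto simp: find_None_iff)
next
  case (Some s)
  then have "s \<in> set D" "f s = x" by (auto simp: find_Some_iff)
  then show ?thesis using Some D by simp
qed

lemma tables_of_latin:
  assumes D: "D = map int [0..<a]" and latin: "latin_check (int a) D T"
  shows "tables a D T (col D T) (row D T)"
proof
  let ?I = "{0..<int a}"
  have set_D: "set D = ?I" using D by (simp add: image_int_atLeastLessThan)
  have l: "inj_on (T r) ?I" "inj_on (\<lambda>s. T s r) ?I" "\<And>s. s \<in> ?I \<Longrightarrow> T r s \<in> ?I" if "r \<in> ?I" for r
    using latin that unfolding latin_check_def list_all_iff set_D by (simp_all add: distinct_map set_D)
  have onto: "?I \<subseteq> f ` ?I" if "inj_on f ?I" "\<And>s. s \<in> ?I \<Longrightarrow> f s \<in> ?I" for f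
  proof -
    have "f ` ?I \<subseteq> ?I" using that(2) by blast
    then show ?thesis using endo_inj_surj[OF _ _ that(1)] by simp
  qed
  show "inverse_tables (int a) D T (col D T) (row D T)"
    unfolding inverse_tables_def list_all_iff set_D
  proof (intro ballI)
    fix x r assume x: "x \<in> ?I" and r: "r \<in> ?I"
    have "col D T x r \<in> ?I \<and> T r (col D T x r) = x"
      unfolding col_def by (rule find_inj[OF onto[OF l(1)[OF r] l(3)[OF r]] set_D x])
    moreover have "row D T x r \<in> ?I \<and> T (row D T x r) r = x"
      unfolding row_def by (rule find_inj[OF onto[OF l(2)[OF r] l(3)[OF _ r]] set_D x])
    ultimately show "0 \<le> col D T x r \<and> col D T x r < int a \<and> T r (col D T x r) = x \<and>
      0 \<le> row D T x r \<and> row D T x r < int a \<and> T (row D T x r) r = x" by simp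
  qed
qed (rule D)

text \<open>All explicit squares use \<open>B = {0, 1}\<close> and \<open>t = 0\<close>, hence the
  comparison with 2. On a finite set surjectivity gives bijectivity.\<close>

definition row_permutation :: "int list \<Rightarrow> (int \<Rightarrow> int) \<Rightarrow> bool" where
  "row_permutation D g \<longleftrightarrow> list_all (\<lambda>r. list_ex (\<lambda>r'. g r' = r) D \<and> g r \<noteq> r \<and> (g r < 2 \<longleftrightarrow> r < 2)) D"

definition mixed_check :: "int list \<Rightarrow> table \<Rightarrow> (int \<Rightarrow> int) \<Rightarrow> bool" where
  "mixed_check D T g \<longleftrightarrow> list_all (\<lambda>r. r < 2 \<or> list_all (\<lambda>s. s = 0 \<or> list_all (\<lambda>r'.
     (T r s = T r' 0 \<longrightarrow> T (g r') s \<noteq> T (g r) 0) \<and> (T (g r) s = T (g r') 0 \<longrightarrow> T r' s \<noteq> T r 0)) [0, 1]) D) D"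

definition quad :: "'a \<Rightarrow> 'a \<Rightarrow> 'a \<Rightarrow> 'a \<Rightarrow> bool \<Rightarrow> bool \<Rightarrow> 'a" where
  "quad u v w z b c = (if b then if c then z else w else if c then v else u)"

text \<open>The column \<open>s'\<close> in \<open>dead2\<close> is determined by the first
  equation, as the place of the symbol of cell \<open>(r, s)\<close> in row \<open>r'\<close> of
  \<open>T True False\<close>; \<open>V\<close> is to be its column table. This saves one
  loop.\<close>

definition dead_check :: "int list \<Rightarrow> (bool \<Rightarrow> bool \<Rightarrow> table) \<Rightarrow> table \<Rightarrow> bool" where
  "dead_check D T V \<longleftrightarrow> list_all (\<lambda>r. list_all (\<lambda>r'. list_all (\<lambda>s.
     T False True r (V (T False False r s) r') \<noteq> T True True r' s) D) D) D"

context tables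
begin

definition \<gamma> :: "(int \<Rightarrow> int) \<Rightarrow> nat \<Rightarrow> nat" where "\<gamma> g r = nat (g (int r))"

lemma \<gamma>:
  assumes "row_permutation D g"
  shows "bij_betw (\<gamma> g) {..<a} {..<a}" "\<And>r. r < a \<Longrightarrow> \<gamma> g r \<noteq> r" "\<And>r. r < a \<Longrightarrow> \<gamma> g r \<in> {0, 1} \<longleftrightarrow> r \<in> {0, 1}"
    "\<And>r. r < a \<Longrightarrow> int (\<gamma> g r) = g (int r) \<and> \<gamma> g r < a"
proof -
  have p: "\<And>r. r \<in> I \<Longrightarrow> (\<exists>r'\<in>I. g r' = r) \<and> g r \<noteq> r \<and> (g r < 2 \<longleftrightarrow> r < 2)"
    using assms unfolding row_permutation_def list_all_iff list_ex_iff set_D by blast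
  then have "I \<subseteq> g ` I" by blast
  then have g: "inj_on g I" "g ` I = I" using surj_inj by blast+
  have gI: "g (int r) \<in> I" if "r < a" for r using g(2) int_I[OF that] by blast
  show e: "int (\<gamma> g r) = g (int r) \<and> \<gamma> g r < a" if "r < a" for r
    using gI[OF that] by (auto simp: \<gamma>_def)
  show "bij_betw (\<gamma> g) {..<a} {..<a}"
  proof (rule endo_bij)
    show "inj_on (\<gamma> g) {..<a}"
    proof (rule inj_onI)
      fix r r' assume r: "r \<in> {..<a}" "r' \<in> {..<a}" and "\<gamma> g r = \<gamma> g r'"
      then have "g (int r) = g (int r')" using e by (metis lessThan_iff)
      then show "r = r'" using g(1) r by (auto dest: inj_onD)
    qed
  qed (use e in blast)
  show "\<gamma> g r \<noteq> r" if "r < a" for r using e[OF that] p[OF int_I[OF that]] by auto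
  show "\<gamma> g r \<in> {0, 1} \<longleftrightarrow> r \<in> {0, 1}" if "r < a" for r
  proof -
    have "int (\<gamma> g r) < 2 \<longleftrightarrow> int r < 2" using e[OF that] p[OF int_I[OF that]] by simp
    then show ?thesis by auto
  qed
qed

lemma first_column:
  assumes "{T 0 0, T 1 0} = {0, 1}" "2 < a"
  shows "(\<lambda>r. nat_square T r 0) ` {0, 1} = {0, 1}"
proof -
  have "nat ` {T 0 0, T 1 0} = nat ` {0, 1}" using assms(1) by simp
  then show ?thesis by (simp add: nat_square_def)
qed

theorem N_infinity_odd:
  assumes sub: "subfree_check (a div 2) D T V W" and perm: "row_permutation D g"
    and mixed: "mixed_check D T g"
    and m: "odd m" "1 < m" and a: "2 < a"
    and cyc: "\<And>q. prime q \<Longrightarrow> q dvd m \<Longrightarrow> cycle_check (nat q) D V W"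
  shows "has_N_infinity (nat m * a)"
proof -
  interpret pattern m a "\<lambda>_ _. nat_square T" "\<gamma> g" "{0, 1}" 0 "(\<lambda>r. nat_square T r 0) ` {0, 1}"
  proof
    show "1 < m" by (rule m)
    show "2 < a" "0 < a" "{0, 1} \<subseteq> {..<a}" using a by auto
    have "2 \<in> {..<a}" "2 \<notin> {0, 1 :: nat}" using a by auto
    then show "{0, 1} \<noteq> {..<a}" by blast
    show "square a (nat_square T)" by (rule square)
    show "subfree a (nat_square T)" by (rule subfree[OF sub])
    show "bij_betw (\<gamma> g) {..<a} {..<a}" "\<And>r. r < a \<Longrightarrow> \<gamma> g r \<noteq> r"
      "\<And>r. r < a \<Longrightarrow> \<gamma> g r \<in> {0, 1} \<longleftrightarrow> r \<in> {0, 1}" by (rule \<gamma>[OF perm]; assumption)+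
  next
    fix q b c assume q: "prime q" "q dvd m"
    then have "no_cycle (int (nat q)) a (nat_square T)" by (intro no_cycle cyc)
    then show "no_cycle q a (nat_square T) \<or> (q = int a \<and> (odd m \<longrightarrow> q \<ge> 7 \<and> card {0 :: nat, 1} = 2) \<and>
        (\<exists>\<pi>. inj_on \<pi> {..<a} \<and> (\<forall>r<a. \<forall>s<a. nat_square T r s = (\<pi> r + s) mod a)))"
      using prime_gt_0_int[OF q(1)] by simp
  next
    fix r r' s assume r: "r < a" "r \<notin> {0, 1}" and r': "r' \<in> {0, 1 :: nat}" and s: "s < a" "s \<noteq> 0"
    have r'a: "r' < a" using r' a by auto
    have "int r \<in> set D" "int s \<in> set D" using r s by (simp_all add: set_D)
    moreover have "\<not> int r < 2" "int s \<noteq> 0" using r s by auto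
    moreover have "int r' \<in> set [0, 1]" using r' by auto
    ultimately have k: "(T (int r) (int s) = T (int r') 0 \<longrightarrow> T (g (int r')) (int s) \<noteq> T (g (int r)) 0) \<and>
      (T (g (int r)) (int s) = T (g (int r')) 0 \<longrightarrow> T (int r') (int s) \<noteq> T (int r) 0)"
      using mixed unfolding mixed_check_def list_all_iff by blast
    have conv: "nat_square T z w = nat_square T z' w' \<longleftrightarrow> T (int z) (int w) = T (int z') (int w')"
      if "z < a" "w < a" "z' < a" "w' < a" for z w z' w' using int_nat_square that by (metis of_nat_eq_iff)
    have g: "\<gamma> g r < a" "\<gamma> g r' < a" "int (\<gamma> g r) = g (int r)" "int (\<gamma> g r') = g (int r')"
      using \<gamma>(4)[OF perm] r(1) r'a by blast+
    show "\<not> (nat_square T r s = nat_square T r' 0 \<and> nat_square T (\<gamma> g r') s = nat_square T (\<gamma> g r) 0) \<and>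
       \<not> (nat_square T (\<gamma> g r) s = nat_square T (\<gamma> g r') 0 \<and> nat_square T r' s = nat_square T r 0)"
      using k a r(1) r'a s(1) g by (simp add: conv)
  qed (use m in auto)
  show ?thesis by (rule N_infinity_pattern)
qed

end

theorem N_infinity_even:
  fixes T V W :: "bool \<Rightarrow> bool \<Rightarrow> table"
  assumes tab: "\<And>b c. tables a D (T b c) (V b c) (W b c)"
    and sub: "\<And>b c. subfree_check (a div 2) D (T b c) (V b c) (W b c)" and perm: "row_permutation D g"
    and first: "\<And>b c. {T b c 0 0, T b c 1 0} = {0, 1}" and dead: "dead_check D T (V True False)"
    and m: "even m" "1 < m" and a: "2 < a"
    and cyc: "\<And>q b c. prime q \<Longrightarrow> q dvd m \<Longrightarrow> odd q \<Longrightarrow> cycle_check (nat q) D (V b c) (W b c)"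
  shows "has_N_infinity (nat m * a)"
proof -
  interpret tab: tables a D "T b c" "V b c" "W b c" for b c by (rule tab)
  interpret pattern m a "\<lambda>b c. nat_square (T b c)" "tab.\<gamma> g" "{0, 1}" 0 "{0, 1}"
  proof
    show "1 < m" by (rule m)
    show "2 < a" "0 < a" "{0, 1} \<subseteq> {..<a}" using a by auto
    have "2 \<in> {..<a}" "2 \<notin> {0, 1 :: nat}" using a by auto
    then show "{0, 1} \<noteq> {..<a}" by blast
    show "square a (nat_square (T b c))" for b c by (rule tab.square)
    show "subfree a (nat_square (T b c))" for b c by (rule tab.subfree[OF sub])
    show "(\<lambda>r. nat_square (T b c) r 0) ` {0, 1} = {0, 1}" for b c by (rule tab.first_column[OF first a])
    show "bij_betw (tab.\<gamma> g) {..<a} {..<a}" "\<And>r. r < a \<Longrightarrow> tab.\<gamma> g r \<noteq> r"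
      "\<And>r. r < a \<Longrightarrow> tab.\<gamma> g r \<in> {0, 1} \<longleftrightarrow> r \<in> {0, 1}" by (rule tab.\<gamma>[OF perm]; assumption)+
  next
    fix r r' s s' assume lt: "r < a" "r' < a" "s < a" "s' < a"
      and 1: "nat_square (T False False) r s = nat_square (T True False) r' s'"
      and 2: "nat_square (T False True) r s' = nat_square (T True True) r' s"
    have "T False False (int r) (int s) = T True False (int r') (int s')" using 1 lt tab.int_nat_square by metis
    then have "V True False (T False False (int r) (int s)) (int r') = int s'"
      using tab.V_eq[of "int r'" "int s'" True False] lt by simp
    moreover have "int r \<in> set D" "int r' \<in> set D" "int s \<in> set D" using lt by (simp_all add: tab.set_D)
    ultimately have "T False True (int r) (int s') \<noteq> T True True (int r') (int s)"
      using dead unfolding dead_check_def list_all_iff by metis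
    moreover have "T False True (int r) (int s') = T True True (int r') (int s)" using 2 lt tab.int_nat_square by metis
    ultimately show False by blast
  next
    fix q b c assume q: "prime q" "q dvd m" "odd q"
    then have "no_cycle (int (nat q)) a (nat_square (T b c))" by (intro tab.no_cycle cyc)
    then show "no_cycle q a (nat_square (T b c)) \<or> (q = int a \<and> (odd m \<longrightarrow> q \<ge> 7 \<and> card {0 :: nat, 1} = 2) \<and>
        (\<exists>\<pi>. inj_on \<pi> {..<a} \<and> (\<forall>r<a. \<forall>s<a. nat_square (T b c) r s = (\<pi> r + s) mod a)))"
      using prime_gt_0_int[OF q(1)] by simp
  qed (use m in auto)
  show ?thesis by (rule N_infinity_pattern)
qed

section \<open>Explicit squares\<close>

abbreviation dom8 :: "int list" where
  "dom8 \<equiv> [0,1,2,3,4,5,6,7]"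

lemma dom8: "dom8 = map int [0..<8]"
  by (simp add: upt_rec)

definition sq8 :: table where
  "sq8 = lookup
   [[2,0,3,6,7,1,4,5],
    [1,3,5,2,6,7,0,4],
    [7,1,4,0,5,2,6,3],
    [6,5,1,3,4,0,2,7],
    [0,7,6,1,3,4,5,2],
    [4,6,2,7,1,5,3,0],
    [3,4,0,5,2,6,7,1],
    [5,2,7,4,0,3,1,6]]"

definition "col8 = col dom8 sq8"

definition "row8 = row dom8 sq8"

lemmas sq8_simps = lookup_eqs[OF sq8_def dom8, simplified list.map list.inject list.rel_inject list.pred_inject simp_thms]

interpretation sq8: tables 8 dom8 sq8 col8 row8
  unfolding col8_def row8_def by (rule tables_of_latin[OF dom8]) (simp add: latin_check_def sq8_simps)

lemmas sq8_inverse = sq8.inverse_facts[simplified list.pred_inject sq8_simps simp_thms]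

lemma sq8_subfree: "subfree_check (8 div 2) dom8 sq8 col8 row8"
  by (simp add: subfree_check_def refuted_def Let_def walk_numeral exceeds_numeral sq8_simps sq8_inverse)

section \<open>Squares of orders 9, 15, 18 and 25 for odd multipliers\<close>

abbreviation dom9 :: "int list" where
  "dom9 \<equiv> [0,1,2,3,4,5,6,7,8]"

lemma dom9: "dom9 = map int [0..<9]"
  by (simp add: upt_rec)

definition sq9 :: table where
  "sq9 = lookup
   [[6,8,2,3,5,1,4,0,7],
    [1,3,4,6,8,5,0,7,2],
    [4,1,5,2,7,6,8,3,0],
    [7,2,1,0,3,4,5,6,8],
    [2,4,0,5,1,7,6,8,3],
    [8,0,7,4,2,3,1,5,6],
    [0,7,3,1,6,8,2,4,5],
    [3,5,6,8,4,0,7,2,1],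
    [5,6,8,7,0,2,3,1,4]]"

definition "col9 = col dom9 sq9"

definition "row9 = row dom9 sq9"

lemmas sq9_simps = lookup_eqs[OF sq9_def dom9, simplified list.map list.inject list.rel_inject list.pred_inject simp_thms]

interpretation sq9: tables 9 dom9 sq9 col9 row9
  unfolding col9_def row9_def by (rule tables_of_latin[OF dom9]) (simp add: latin_check_def sq9_simps)

lemmas sq9_inverse = sq9.inverse_facts[simplified list.pred_inject sq9_simps simp_thms]

lemma sq9_subfree: "subfree_check (9 div 2) dom9 sq9 col9 row9"
  by (simp add: subfree_check_def refuted_def Let_def walk_numeral exceeds_numeral sq9_simps sq9_inverse)

lemma sq9_cycle3: "cycle_check 3 dom9 col9 row9"
  by (simp add: cycle_check_def no_return_numeral sq9_inverse)

definition perm9 :: "int \<Rightarrow> int" where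
  "perm9 r = [1,0,4,6,7,8,2,5,3] ! nat r"

lemma perm9: "row_permutation dom9 perm9"
  by (simp add: row_permutation_def perm9_def)

lemma sq9_mixed: "mixed_check dom9 sq9 perm9"
  by (simp add: mixed_check_def perm9_def sq9_simps)

abbreviation dom15 :: "int list" where
  "dom15 \<equiv> [0,1,2,3,4,5,6,7,8,9,10,11,12,13,14]"

lemma dom15: "dom15 = map int [0..<15]"
  by (simp add: upt_rec)

definition sq15 :: table where
  "sq15 = lookup
   [[12,1,13,6,8,14,7,0,3,11,9,2,10,5,4],
    [5,13,2,14,7,9,0,8,1,4,12,10,3,11,6],
    [7,6,14,3,0,8,10,1,9,2,5,13,11,4,12],
    [13,8,7,0,4,1,9,11,2,10,3,6,14,12,5],
    [6,14,9,8,1,5,2,10,12,3,11,4,7,0,13],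
    [14,7,0,10,9,2,6,3,11,13,4,12,5,8,1],
    [2,0,8,1,11,10,3,7,4,12,14,5,13,6,9],
    [10,3,1,9,2,12,11,4,8,5,13,0,6,14,7],
    [8,11,4,2,10,3,13,12,5,9,6,14,1,7,0],
    [1,9,12,5,3,11,4,14,13,6,10,7,0,2,8],
    [9,2,10,13,6,4,12,5,0,14,7,11,8,1,3],
    [4,10,3,11,14,7,5,13,6,1,0,8,12,9,2],
    [3,5,11,4,12,0,8,6,14,7,2,1,9,13,10],
    [11,4,6,12,5,13,1,9,7,0,8,3,2,10,14],
    [0,12,5,7,13,6,14,2,10,8,1,9,4,3,11]]"

definition "col15 = col dom15 sq15"

definition "row15 = row dom15 sq15"

lemmas sq15_simps = lookup_eqs[OF sq15_def dom15, simplified list.map list.inject list.rel_inject list.pred_inject simp_thms]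

interpretation sq15: tables 15 dom15 sq15 col15 row15
  unfolding col15_def row15_def by (rule tables_of_latin[OF dom15]) (simp add: latin_check_def sq15_simps)

lemmas sq15_inverse = sq15.inverse_facts[simplified list.pred_inject sq15_simps simp_thms]

lemma sq15_subfree: "subfree_check (15 div 2) dom15 sq15 col15 row15"
  by (simp add: subfree_check_def refuted_def Let_def walk_numeral exceeds_numeral sq15_simps sq15_inverse)

lemma sq15_cycle3: "cycle_check 3 dom15 col15 row15"
  by (simp add: cycle_check_def no_return_numeral sq15_inverse)

lemma sq15_cycle5: "cycle_check 5 dom15 col15 row15"
  by (simp add: cycle_check_def no_return_numeral sq15_inverse)

definition perm15 :: "int \<Rightarrow> int" where
  "perm15 r = [1,0,14,9,13,10,7,12,5,11,6,8,3,4,2] ! nat r"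

lemma perm15: "row_permutation dom15 perm15"
  by (simp add: row_permutation_def perm15_def)

lemma sq15_mixed: "mixed_check dom15 sq15 perm15"
  by (simp add: mixed_check_def perm15_def sq15_simps)

abbreviation dom18 :: "int list" where
  "dom18 \<equiv> [0,1,2,3,4,5,6,7,8,9,10,11,12,13,14,15,16,17]"

lemma dom18: "dom18 = map int [0..<18]"
  by (simp add: upt_rec)

definition sq18 :: table where
  "sq18 = lookup
   [[11,0,4,7,12,5,13,2,6,10,8,16,14,15,1,17,9,3],
    [8,13,2,6,0,14,7,15,4,5,12,1,9,16,17,3,10,11],
    [6,1,15,4,8,2,16,0,17,13,7,14,3,11,9,10,5,12],
    [10,8,3,17,6,1,4,9,2,14,15,0,16,5,13,11,12,7],
    [4,12,1,5,10,8,3,6,11,0,16,17,2,9,7,15,13,14],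
    [13,6,14,3,7,12,1,5,8,16,2,9,10,4,11,0,17,15],
    [1,15,8,16,5,0,14,3,7,17,9,4,11,12,6,13,2,10],
    [0,3,17,1,9,7,2,16,5,12,10,11,6,13,14,8,15,4],
    [7,2,5,10,3,11,0,4,9,6,14,12,13,8,15,16,1,17],
    [12,10,9,15,4,16,5,8,14,3,1,13,17,6,2,7,11,0],
    [16,14,12,11,17,6,9,7,1,2,5,3,15,10,8,4,0,13],
    [3,9,16,14,13,10,8,11,0,15,4,7,5,17,12,1,6,2],
    [2,5,11,9,16,15,12,1,13,4,17,6,0,7,10,14,3,8],
    [15,4,7,13,11,9,17,14,3,1,6,10,8,2,0,12,16,5],
    [5,17,6,0,15,13,11,10,16,7,3,8,12,1,4,2,14,9],
    [9,7,10,8,2,17,15,13,12,11,0,5,1,14,3,6,4,16],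
    [14,11,0,12,1,4,10,17,15,9,13,2,7,3,16,5,8,6],
    [17,16,13,2,14,3,6,12,10,8,11,15,4,0,5,9,7,1]]"

definition "col18 = col dom18 sq18"

definition "row18 = row dom18 sq18"

lemmas sq18_simps = lookup_eqs[OF sq18_def dom18, simplified list.map list.inject list.rel_inject list.pred_inject simp_thms]

interpretation sq18: tables 18 dom18 sq18 col18 row18
  unfolding col18_def row18_def by (rule tables_of_latin[OF dom18]) (simp add: latin_check_def sq18_simps)

lemmas sq18_inverse = sq18.inverse_facts[simplified list.pred_inject sq18_simps simp_thms]

lemma sq18_subfree: "subfree_check (18 div 2) dom18 sq18 col18 row18"
  by (simp add: subfree_check_def refuted_def Let_def walk_numeral exceeds_numeral sq18_simps sq18_inverse)

lemma sq18_cycle3: "cycle_check 3 dom18 col18 row18"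
  by (simp add: cycle_check_def no_return_numeral sq18_inverse)

definition perm18 :: "int \<Rightarrow> int" where
  "perm18 r = [1,0,13,12,16,15,17,10,7,14,11,8,5,9,6,4,3,2] ! nat r"

lemma perm18: "row_permutation dom18 perm18"
  by (simp add: row_permutation_def perm18_def)

lemma sq18_mixed: "mixed_check dom18 sq18 perm18"
  by (simp add: mixed_check_def perm18_def sq18_simps)

abbreviation dom25 :: "int list" where
  "dom25 \<equiv> [0,1,2,3,4,5,6,7,8,9,10,11,12,13,14,15,16,17,18,19,20,21,22,23,24]"

lemma dom25: "dom25 = map int [0..<25]"
  by (simp add: upt_rec)

definition sq25 :: table where
  "sq25 = lookup
   [[19,7,13,24,22,21,18,20,8,4,9,15,14,16,11,5,23,1,3,17,12,10,2,6,0],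
    [1,20,8,14,0,23,22,19,21,9,5,10,16,15,17,12,6,24,2,4,18,13,11,3,7],
    [8,2,21,9,15,1,24,23,20,22,10,6,11,17,16,18,13,7,0,3,5,19,14,12,4],
    [5,9,3,22,10,16,2,0,24,21,23,11,7,12,18,17,19,14,8,1,4,6,20,15,13],
    [14,6,10,4,23,11,17,3,1,0,22,24,12,8,13,19,18,20,15,9,2,5,7,21,16],
    [17,15,7,11,5,24,12,18,4,2,1,23,0,13,9,14,20,19,21,16,10,3,6,8,22],
    [23,18,16,8,12,6,0,13,19,5,3,2,24,1,14,10,15,21,20,22,17,11,4,7,9],
    [10,24,19,17,9,13,7,1,14,20,6,4,3,0,2,15,11,16,22,21,23,18,12,5,8],
    [9,11,0,20,18,10,14,8,2,15,21,7,5,4,1,3,16,12,17,23,22,24,19,13,6],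
    [7,10,12,1,21,19,11,15,9,3,16,22,8,6,5,2,4,17,13,18,24,23,0,20,14],
    [15,8,11,13,2,22,20,12,16,10,4,17,23,9,7,6,3,5,18,14,19,0,24,1,21],
    [22,16,9,12,14,3,23,21,13,17,11,5,18,24,10,8,7,4,6,19,15,20,1,0,2],
    [3,23,17,10,13,15,4,24,22,14,18,12,6,19,0,11,9,8,5,7,20,16,21,2,1],
    [2,4,24,18,11,14,16,5,0,23,15,19,13,7,20,1,12,10,9,6,8,21,17,22,3],
    [4,3,5,0,19,12,15,17,6,1,24,16,20,14,8,21,2,13,11,10,7,9,22,18,23],
    [24,5,4,6,1,20,13,16,18,7,2,0,17,21,15,9,22,3,14,12,11,8,10,23,19],
    [20,0,6,5,7,2,21,14,17,19,8,3,1,18,22,16,10,23,4,15,13,12,9,11,24],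
    [0,21,1,7,6,8,3,22,15,18,20,9,4,2,19,23,17,11,24,5,16,14,13,10,12],
    [13,1,22,2,8,7,9,4,23,16,19,21,10,5,3,20,24,18,12,0,6,17,15,14,11],
    [12,14,2,23,3,9,8,10,5,24,17,20,22,11,6,4,21,0,19,13,1,7,18,16,15],
    [16,13,15,3,24,4,10,9,11,6,0,18,21,23,12,7,5,22,1,20,14,2,8,19,17],
    [18,17,14,16,4,0,5,11,10,12,7,1,19,22,24,13,8,6,23,2,21,15,3,9,20],
    [21,19,18,15,17,5,1,6,12,11,13,8,2,20,23,0,14,9,7,24,3,22,16,4,10],
    [11,22,20,19,16,18,6,2,7,13,12,14,9,3,21,24,1,15,10,8,0,4,23,17,5],
    [6,12,23,21,20,17,19,7,3,8,14,13,15,10,4,22,0,2,16,11,9,1,5,24,18]]"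

definition "col25 = col dom25 sq25"

definition "row25 = row dom25 sq25"

lemmas sq25_simps = lookup_eqs[OF sq25_def dom25, simplified list.map list.inject list.rel_inject list.pred_inject simp_thms]

interpretation sq25: tables 25 dom25 sq25 col25 row25
  unfolding col25_def row25_def by (rule tables_of_latin[OF dom25]) (simp add: latin_check_def sq25_simps)

lemmas sq25_inverse = sq25.inverse_facts[simplified list.pred_inject sq25_simps simp_thms]

lemma sq25_subfree: "subfree_check (25 div 2) dom25 sq25 col25 row25"
  by (simp add: subfree_check_def refuted_def Let_def walk_numeral exceeds_numeral sq25_simps sq25_inverse)

lemma sq25_cycle5: "cycle_check 5 dom25 col25 row25"
  by (simp add: cycle_check_def no_return_numeral sq25_inverse)

definition perm25 :: "int \<Rightarrow> int" where
  "perm25 r = [1,0,20,23,21,24,19,22,15,11,16,17,14,18,7,12,9,8,13,10,4,6,5,3,2] ! nat r"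

lemma perm25: "row_permutation dom25 perm25"
  by (simp add: row_permutation_def perm25_def)

lemma sq25_mixed: "mixed_check dom25 sq25 perm25"
  by (simp add: mixed_check_def perm25_def sq25_simps)

section \<open>Quadruples of squares of orders 12 and 16 for even multipliers\<close>

abbreviation dom12 :: "int list" where
  "dom12 \<equiv> [0,1,2,3,4,5,6,7,8,9,10,11]"

lemma dom12: "dom12 = map int [0..<12]"
  by (simp add: upt_rec)

definition sq12a :: table where
  "sq12a = lookup
   [[0,4,5,11,1,10,7,3,8,2,6,9],
    [1,11,8,2,6,3,0,4,7,9,5,10],
    [11,5,0,6,7,9,10,8,4,1,3,2],
    [10,7,6,5,2,8,3,11,1,0,9,4],
    [4,9,7,1,3,2,11,5,0,8,10,6],
    [3,0,10,8,9,4,2,7,6,5,1,11],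
    [2,8,3,7,11,0,9,1,10,6,4,5],
    [5,3,1,4,8,7,6,10,9,11,2,0],
    [8,6,4,9,0,1,5,2,11,10,7,3],
    [9,1,2,0,10,5,4,6,3,7,11,8],
    [6,10,9,3,5,11,1,0,2,4,8,7],
    [7,2,11,10,4,6,8,9,5,3,0,1]]"

definition "col12a = col dom12 sq12a"

definition "row12a = row dom12 sq12a"

lemmas sq12a_simps = lookup_eqs[OF sq12a_def dom12, simplified list.map list.inject list.rel_inject list.pred_inject simp_thms]

interpretation sq12a: tables 12 dom12 sq12a col12a row12a
  unfolding col12a_def row12a_def by (rule tables_of_latin[OF dom12]) (simp add: latin_check_def sq12a_simps)

lemmas sq12a_inverse = sq12a.inverse_facts[simplified list.pred_inject sq12a_simps simp_thms]

lemma sq12a_subfree: "subfree_check (12 div 2) dom12 sq12a col12a row12a"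
  by (simp add: subfree_check_def refuted_def Let_def walk_numeral exceeds_numeral sq12a_simps sq12a_inverse)

lemma sq12a_cycle3: "cycle_check 3 dom12 col12a row12a"
  by (simp add: cycle_check_def no_return_numeral sq12a_inverse)

definition sq12b :: table where
  "sq12b = lookup
   [[0,10,5,9,3,11,6,7,8,1,2,4],
    [1,3,0,8,2,7,10,5,6,4,9,11],
    [10,7,11,0,6,4,5,2,1,9,8,3],
    [6,5,1,7,11,2,4,0,3,8,10,9],
    [9,1,4,6,8,3,7,11,0,2,5,10],
    [2,4,8,5,10,9,11,1,7,6,3,0],
    [3,11,2,4,7,8,0,9,5,10,1,6],
    [5,9,7,3,4,1,2,6,10,0,11,8],
    [4,8,10,1,0,5,9,3,2,11,6,7],
    [8,0,9,11,5,6,1,10,4,3,7,2],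
    [7,2,6,10,9,0,3,8,11,5,4,1],
    [11,6,3,2,1,10,8,4,9,7,0,5]]"

definition "col12b = col dom12 sq12b"

definition "row12b = row dom12 sq12b"

lemmas sq12b_simps = lookup_eqs[OF sq12b_def dom12, simplified list.map list.inject list.rel_inject list.pred_inject simp_thms]

interpretation sq12b: tables 12 dom12 sq12b col12b row12b
  unfolding col12b_def row12b_def by (rule tables_of_latin[OF dom12]) (simp add: latin_check_def sq12b_simps)

lemmas sq12b_inverse = sq12b.inverse_facts[simplified list.pred_inject sq12b_simps simp_thms]

lemma sq12b_subfree: "subfree_check (12 div 2) dom12 sq12b col12b row12b"
  by (simp add: subfree_check_def refuted_def Let_def walk_numeral exceeds_numeral sq12b_simps sq12b_inverse)

lemma sq12b_cycle3: "cycle_check 3 dom12 col12b row12b"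
  by (simp add: cycle_check_def no_return_numeral sq12b_inverse)

definition sq12c :: table where
  "sq12c = lookup
   [[1,4,2,9,10,0,5,8,11,6,3,7],
    [0,9,4,7,3,8,2,11,10,1,6,5],
    [10,5,0,3,9,11,8,6,1,7,2,4],
    [4,7,6,5,11,10,0,1,2,9,8,3],
    [6,11,8,2,0,7,4,5,9,3,10,1],
    [3,8,7,1,2,5,9,0,6,10,4,11],
    [9,6,1,8,4,3,7,10,5,2,11,0],
    [11,10,3,6,8,2,1,7,0,4,5,9],
    [2,3,11,4,7,1,10,9,8,5,0,6],
    [8,1,10,0,5,4,6,3,7,11,9,2],
    [5,0,9,11,1,6,3,2,4,8,7,10],
    [7,2,5,10,6,9,11,4,3,0,1,8]]"

definition "col12c = col dom12 sq12c"

definition "row12c = row dom12 sq12c"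

lemmas sq12c_simps = lookup_eqs[OF sq12c_def dom12, simplified list.map list.inject list.rel_inject list.pred_inject simp_thms]

interpretation sq12c: tables 12 dom12 sq12c col12c row12c
  unfolding col12c_def row12c_def by (rule tables_of_latin[OF dom12]) (simp add: latin_check_def sq12c_simps)

lemmas sq12c_inverse = sq12c.inverse_facts[simplified list.pred_inject sq12c_simps simp_thms]

lemma sq12c_subfree: "subfree_check (12 div 2) dom12 sq12c col12c row12c"
  by (simp add: subfree_check_def refuted_def Let_def walk_numeral exceeds_numeral sq12c_simps sq12c_inverse)

lemma sq12c_cycle3: "cycle_check 3 dom12 col12c row12c"
  by (simp add: cycle_check_def no_return_numeral sq12c_inverse)

definition sq12d :: table where
  "sq12d = lookup
   [[0,4,11,5,8,10,2,9,1,7,6,3],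
    [1,9,8,6,5,4,0,2,7,10,3,11],
    [11,6,5,7,0,9,4,3,10,8,1,2],
    [10,7,2,0,1,6,3,5,4,11,9,8],
    [2,11,1,3,6,8,9,4,0,5,7,10],
    [9,3,7,8,4,2,11,10,5,6,0,1],
    [3,10,4,1,9,5,8,7,11,0,2,6],
    [7,5,3,2,11,1,10,8,6,9,4,0],
    [8,1,0,4,3,7,6,11,9,2,10,5],
    [5,8,10,9,2,0,7,6,3,1,11,4],
    [6,0,9,11,10,3,5,1,2,4,8,7],
    [4,2,6,10,7,11,1,0,8,3,5,9]]"

definition "col12d = col dom12 sq12d"

definition "row12d = row dom12 sq12d"

lemmas sq12d_simps = lookup_eqs[OF sq12d_def dom12, simplified list.map list.inject list.rel_inject list.pred_inject simp_thms]

interpretation sq12d: tables 12 dom12 sq12d col12d row12d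
  unfolding col12d_def row12d_def by (rule tables_of_latin[OF dom12]) (simp add: latin_check_def sq12d_simps)

lemmas sq12d_inverse = sq12d.inverse_facts[simplified list.pred_inject sq12d_simps simp_thms]

lemma sq12d_subfree: "subfree_check (12 div 2) dom12 sq12d col12d row12d"
  by (simp add: subfree_check_def refuted_def Let_def walk_numeral exceeds_numeral sq12d_simps sq12d_inverse)

lemma sq12d_cycle3: "cycle_check 3 dom12 col12d row12d"
  by (simp add: cycle_check_def no_return_numeral sq12d_inverse)

text \<open>\<open>sq12a\<close> serves twice: alone with this permutation for odd multiples of 12,
  where \<open>mixed_check\<close> matters, and with \<open>swap12\<close> inside the quadruple for
  even multiples.\<close>

definition perm12a :: "int \<Rightarrow> int" where
  "perm12a r = [1,0,9,10,6,11,4,8,5,7,3,2] ! nat r"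

lemma perm12a: "row_permutation dom12 perm12a"
  by (simp add: row_permutation_def perm12a_def)

lemma sq12a_mixed: "mixed_check dom12 sq12a perm12a"
  by (simp add: mixed_check_def perm12a_def sq12a_simps)

definition swap12 :: "int \<Rightarrow> int" where
  "swap12 r = [1,0,3,2,5,4,7,6,9,8,11,10] ! nat r"

lemma swap12: "row_permutation dom12 swap12"
  by (simp add: row_permutation_def swap12_def)

lemma quad12_dead: "dead_check dom12 (quad sq12a sq12b sq12c sq12d) col12c"
  by (simp add: dead_check_def quad_def sq12a_simps sq12b_simps sq12d_simps sq12c_inverse)

abbreviation dom16 :: "int list" where
  "dom16 \<equiv> [0,1,2,3,4,5,6,7,8,9,10,11,12,13,14,15]"

lemma dom16: "dom16 = map int [0..<16]"
  by (simp add: upt_rec)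

definition sq16a :: table where
  "sq16a = lookup
   [[1,6,4,11,9,5,3,13,14,10,7,15,0,2,12,8],
    [0,10,1,8,2,15,9,7,5,13,12,11,14,6,3,4],
    [6,0,5,10,1,11,12,2,9,15,14,8,3,4,7,13],
    [14,11,9,3,7,4,8,10,12,6,1,13,5,15,0,2],
    [3,14,2,6,10,7,15,12,8,5,9,0,1,13,4,11],
    [8,3,15,9,5,2,13,14,6,7,4,10,12,11,1,0],
    [13,8,11,12,4,14,0,5,1,3,6,7,2,10,9,15],
    [15,1,7,0,13,12,6,4,2,11,8,5,9,3,14,10],
    [11,7,3,14,8,9,5,15,13,1,0,2,4,12,10,6],
    [10,2,8,7,15,1,14,6,11,12,3,4,13,0,5,9],
    [7,12,6,5,0,13,10,1,3,4,15,9,11,8,2,14],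
    [12,5,13,4,6,8,11,9,0,2,10,14,7,1,15,3],
    [4,15,12,2,11,6,1,0,7,9,13,3,10,14,8,5],
    [5,13,14,1,3,0,4,11,10,8,2,12,15,9,6,7],
    [9,4,10,13,14,3,2,8,15,0,5,1,6,7,11,12],
    [2,9,0,15,12,10,7,3,4,14,11,6,8,5,13,1]]"

definition "col16a = col dom16 sq16a"

definition "row16a = row dom16 sq16a"

lemmas sq16a_simps = lookup_eqs[OF sq16a_def dom16, simplified list.map list.inject list.rel_inject list.pred_inject simp_thms]

interpretation sq16a: tables 16 dom16 sq16a col16a row16a
  unfolding col16a_def row16a_def by (rule tables_of_latin[OF dom16]) (simp add: latin_check_def sq16a_simps)

lemmas sq16a_inverse = sq16a.inverse_facts[simplified list.pred_inject sq16a_simps simp_thms]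

lemma sq16a_subfree: "subfree_check (16 div 2) dom16 sq16a col16a row16a"
  by (simp add: subfree_check_def refuted_def Let_def walk_numeral exceeds_numeral sq16a_simps sq16a_inverse)

definition sq16b :: table where
  "sq16b = lookup
   [[0,15,12,10,4,2,5,8,14,3,1,9,6,7,13,11],
    [1,8,2,13,14,10,3,4,5,11,12,0,15,9,7,6],
    [9,13,14,3,11,6,0,2,4,15,8,7,1,5,10,12],
    [3,0,9,15,12,4,11,7,10,6,2,13,8,14,5,1],
    [7,6,0,12,5,11,8,14,2,4,9,15,10,1,3,13],
    [15,2,5,6,13,9,10,1,3,0,14,8,7,11,12,4],
    [10,14,1,7,3,12,6,9,11,13,4,2,0,15,8,5],
    [8,7,15,4,1,5,13,11,12,10,0,3,14,2,6,9],
    [4,1,10,14,2,13,15,6,7,5,3,11,9,12,0,8],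
    [5,11,7,0,15,14,12,3,6,1,10,4,13,8,9,2],
    [13,12,4,5,8,7,2,15,0,9,6,1,3,10,11,14],
    [14,3,13,9,6,0,1,12,8,2,7,5,11,4,15,10],
    [6,9,11,2,7,3,14,10,13,8,5,12,4,0,1,15],
    [11,10,8,1,0,15,4,5,9,12,13,6,2,3,14,7],
    [12,4,6,11,9,8,7,0,1,14,15,10,5,13,2,3],
    [2,5,3,8,10,1,9,13,15,7,11,14,12,6,4,0]]"

definition "col16b = col dom16 sq16b"

definition "row16b = row dom16 sq16b"

lemmas sq16b_simps = lookup_eqs[OF sq16b_def dom16, simplified list.map list.inject list.rel_inject list.pred_inject simp_thms]

interpretation sq16b: tables 16 dom16 sq16b col16b row16b
  unfolding col16b_def row16b_def by (rule tables_of_latin[OF dom16]) (simp add: latin_check_def sq16b_simps)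

lemmas sq16b_inverse = sq16b.inverse_facts[simplified list.pred_inject sq16b_simps simp_thms]

lemma sq16b_subfree: "subfree_check (16 div 2) dom16 sq16b col16b row16b"
  by (simp add: subfree_check_def refuted_def Let_def walk_numeral exceeds_numeral sq16b_simps sq16b_inverse)

definition sq16c :: table where
  "sq16c = lookup
   [[1,14,11,2,9,0,5,7,3,6,12,15,10,4,13,8],
    [0,6,14,3,11,13,10,2,15,9,1,7,4,8,12,5],
    [6,3,7,15,0,14,11,13,8,12,4,9,2,5,1,10],
    [12,8,2,4,14,1,15,5,13,7,10,0,6,3,9,11],
    [10,13,3,0,5,15,8,12,2,1,6,14,9,11,4,7],
    [13,2,12,6,4,7,14,9,11,3,15,5,1,10,8,0],
    [8,1,15,10,3,6,4,11,5,2,14,13,0,9,7,12],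
    [2,11,0,9,13,10,6,8,12,15,7,4,5,14,3,1],
    [7,4,1,12,10,5,9,3,14,13,0,8,15,6,11,2],
    [3,15,5,1,2,9,12,4,10,14,8,11,7,0,6,13],
    [14,9,4,13,7,2,0,1,6,10,11,12,8,15,5,3],
    [11,0,10,8,12,4,3,15,9,5,13,1,14,7,2,6],
    [5,12,9,7,6,11,2,14,4,8,3,10,13,1,0,15],
    [15,10,13,5,8,3,1,6,7,0,9,2,11,12,14,4],
    [4,5,8,14,1,12,7,10,0,11,2,6,3,13,15,9],
    [9,7,6,11,15,8,13,0,1,4,5,3,12,2,10,14]]"

definition "col16c = col dom16 sq16c"

definition "row16c = row dom16 sq16c"

lemmas sq16c_simps = lookup_eqs[OF sq16c_def dom16, simplified list.map list.inject list.rel_inject list.pred_inject simp_thms]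

interpretation sq16c: tables 16 dom16 sq16c col16c row16c
  unfolding col16c_def row16c_def by (rule tables_of_latin[OF dom16]) (simp add: latin_check_def sq16c_simps)

lemmas sq16c_inverse = sq16c.inverse_facts[simplified list.pred_inject sq16c_simps simp_thms]

lemma sq16c_subfree: "subfree_check (16 div 2) dom16 sq16c col16c row16c"
  by (simp add: subfree_check_def refuted_def Let_def walk_numeral exceeds_numeral sq16c_simps sq16c_inverse)

definition sq16d :: table where
  "sq16d = lookup
   [[1,11,14,15,5,9,0,7,12,2,4,10,3,8,13,6],
    [0,14,5,2,9,13,15,1,10,6,12,11,7,3,4,8],
    [11,12,4,3,6,14,2,10,13,7,0,8,5,9,15,1],
    [15,3,13,5,4,10,11,0,1,12,9,2,8,6,7,14],
    [4,0,7,14,2,8,9,12,3,10,15,6,13,5,1,11],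
    [9,1,2,0,15,3,13,8,11,4,5,14,6,12,10,7],
    [8,15,10,6,14,7,1,2,0,13,11,3,9,4,5,12],
    [5,7,12,13,8,4,10,6,9,0,3,15,1,14,11,2],
    [3,13,1,9,12,6,5,11,2,8,14,4,15,7,0,10],
    [12,6,15,8,0,2,7,14,5,11,10,13,4,1,9,3],
    [6,10,3,7,13,12,14,4,8,15,1,9,11,0,2,5],
    [13,4,11,12,1,5,3,15,14,9,8,7,2,10,6,0],
    [2,8,6,4,10,11,12,5,7,3,13,1,0,15,14,9],
    [10,5,9,11,3,0,6,13,4,1,7,12,14,2,8,15],
    [14,2,8,10,7,1,4,9,15,5,6,0,12,11,3,13],
    [7,9,0,1,11,15,8,3,6,14,2,5,10,13,12,4]]"

definition "col16d = col dom16 sq16d"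

definition "row16d = row dom16 sq16d"

lemmas sq16d_simps = lookup_eqs[OF sq16d_def dom16, simplified list.map list.inject list.rel_inject list.pred_inject simp_thms]

interpretation sq16d: tables 16 dom16 sq16d col16d row16d
  unfolding col16d_def row16d_def by (rule tables_of_latin[OF dom16]) (simp add: latin_check_def sq16d_simps)

lemmas sq16d_inverse = sq16d.inverse_facts[simplified list.pred_inject sq16d_simps simp_thms]

lemma sq16d_subfree: "subfree_check (16 div 2) dom16 sq16d col16d row16d"
  by (simp add: subfree_check_def refuted_def Let_def walk_numeral exceeds_numeral sq16d_simps sq16d_inverse)

definition swap16 :: "int \<Rightarrow> int" where
  "swap16 r = [1,0,3,2,5,4,7,6,9,8,11,10,13,12,15,14] ! nat r"

lemma swap16: "row_permutation dom16 swap16"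
  by (simp add: row_permutation_def swap16_def)

lemma quad16_dead: "dead_check dom16 (quad sq16a sq16b sq16c sq16d) col16c"
  by (simp add: dead_check_def quad_def sq16a_simps sq16b_simps sq16d_simps sq16c_inverse)

section \<open>All orders\<close>

lemma prime_nat_of_int: "prime q \<Longrightarrow> q dvd int k \<Longrightarrow> prime (nat q) \<and> nat q dvd k \<and> int (nat q) = q"
  using prime_gt_0_int[of q] by (metis int_dvd_int_iff int_nat_eq order_less_imp_le prime_nat_int_transfer)

lemma (in tables) N_infinity_odd_multiple:
  assumes sub: "subfree_check (a div 2) D T V W" and perm: "row_permutation D g" and mixed: "mixed_check D T g"
    and k: "odd k" and a: "2 < a" and cyc: "\<And>q. prime q \<Longrightarrow> q dvd k \<Longrightarrow> cycle_check q D V W"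
  shows "has_N_infinity (k * a)"
proof (cases "k = 1")
  case True
  then show ?thesis using subfree_N_infinity[OF square subfree[OF sub]] by simp
next
  case False
  have "k \<noteq> 0" using k by (metis even_zero)
  then have "1 < int k" using False by simp
  moreover have "odd (int k)" using k by simp
  moreover have "cycle_check (nat q) D V W" if "prime q" "q dvd int k" for q
    using cyc prime_nat_of_int[OF that] by blast
  ultimately show ?thesis using N_infinity_odd[OF sub perm mixed, of "int k"] a by simp
qed

lemma N_infinity_12_even:
  assumes k: "even k" "0 < k" and q: "\<And>q :: nat. prime q \<Longrightarrow> q dvd k \<Longrightarrow> q = 2 \<or> q = 3"
  shows "has_N_infinity (k * 12)"
proof -
  let ?T = "quad sq12a sq12b sq12c sq12d" and ?V = "quad col12a col12b col12c col12d"
    and ?W = "quad row12a row12b row12c row12d"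
  have "has_N_infinity (nat (int k) * 12)"
  proof (rule N_infinity_even[where T = ?T and V = ?V and W = ?W and D = dom12 and g = swap12])
    fix b c
    show "tables 12 dom12 (?T b c) (?V b c) (?W b c)"
      using sq12a.tables_axioms sq12b.tables_axioms sq12c.tables_axioms sq12d.tables_axioms
      by (cases b; cases c) (simp_all only: quad_def if_True if_False)
    show "subfree_check (12 div 2) dom12 (?T b c) (?V b c) (?W b c)"
      using sq12a_subfree sq12b_subfree sq12c_subfree sq12d_subfree
      by (cases b; cases c) (simp_all only: quad_def if_True if_False)
    show "{?T b c 0 0, ?T b c 1 0} = {0, 1}"
      by (auto simp: quad_def sq12a_simps sq12b_simps sq12c_simps sq12d_simps)
    show "cycle_check (nat q) dom12 (?V b c) (?W b c)"
      if "prime q" "q dvd int k" "odd q" for q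
    proof -
      have "prime (nat q)" "nat q dvd k" "odd (nat q)"
        using prime_nat_of_int[OF that(1,2)] that(3) by (auto, metis even_of_nat)
      then have "nat q = 3" using q[of "nat q"] by auto
      then show ?thesis
        using sq12a_cycle3 sq12b_cycle3 sq12c_cycle3 sq12d_cycle3
      by (cases b; cases c) (simp_all only: quad_def if_True if_False)
    qed
  next
    show "dead_check dom12 ?T (?V True False)"
      using quad12_dead by (simp add: quad_def[of _ _ _ _ True False])
  qed (use k swap12 in auto)
  then show ?thesis by simp
qed

lemma N_infinity_16_even:
  assumes k: "even k" "0 < k" and q: "\<And>q :: nat. prime q \<Longrightarrow> q dvd k \<Longrightarrow> q = 2"
  shows "has_N_infinity (k * 16)"
proof -
  let ?T = "quad sq16a sq16b sq16c sq16d" and ?V = "quad col16a col16b col16c col16d"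
    and ?W = "quad row16a row16b row16c row16d"
  have "has_N_infinity (nat (int k) * 16)"
  proof (rule N_infinity_even[where T = ?T and V = ?V and W = ?W and D = dom16 and g = swap16])
    fix b c
    show "tables 16 dom16 (?T b c) (?V b c) (?W b c)"
      using sq16a.tables_axioms sq16b.tables_axioms sq16c.tables_axioms sq16d.tables_axioms
      by (cases b; cases c) (simp_all only: quad_def if_True if_False)
    show "subfree_check (16 div 2) dom16 (?T b c) (?V b c) (?W b c)"
      using sq16a_subfree sq16b_subfree sq16c_subfree sq16d_subfree
      by (cases b; cases c) (simp_all only: quad_def if_True if_False)
    show "{?T b c 0 0, ?T b c 1 0} = {0, 1}"
      by (auto simp: quad_def sq16a_simps sq16b_simps sq16c_simps sq16d_simps)
    show "cycle_check (nat q) dom16 (?V b c) (?W b c)"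
      if "prime q" "q dvd int k" "odd q" for q
    proof -
      have "prime (nat q)" "nat q dvd k" "odd (nat q)"
        using prime_nat_of_int[OF that(1,2)] that(3) by (auto, metis even_of_nat)
      then show ?thesis using q[of "nat q"] by auto
    qed
  next
    show "dead_check dom16 ?T (?V True False)"
      using quad16_dead by (simp add: quad_def[of _ _ _ _ True False])
  qed (use k swap16 in auto)
  then show ?thesis by simp
qed

lemma prime_lt_7: "prime (q :: nat) \<Longrightarrow> q < 7 \<Longrightarrow> q = 2 \<or> q = 3 \<or> q = 5"
proof -
  assume q: "prime q" "q < 7"
  then have "q \<ge> 2" using prime_ge_2_nat by blast
  then have "q \<in> {2, 3, 4, 5, 6}" using q(2) by auto
  moreover have "q \<noteq> 4" "q \<noteq> 6" using q(1) primes_dvd_imp_eq[of 2 q] by auto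
  ultimately show ?thesis by blast
qed

theorem theorem3p1:
  fixes n :: nat
  assumes "n > 0" and "n \<notin> {4, 6}"
  shows "\<exists>L :: nat \<Rightarrow> nat \<Rightarrow> nat. N_infinity n L"
proof (cases "\<exists>p. prime p \<and> 7 \<le> p \<and> p dvd n")
  case True
  then obtain p k where p: "prime p" "7 \<le> p" and n: "n = k * p" by (auto simp: dvd_def mult.commute)
  have k0: "k > 0" using assms(1) n by simp
  consider "k = 1" | "even k" | "odd k" "k \<noteq> 1" by blast
  then show ?thesis
  proof cases
    case 1
    then show ?thesis using N_infinity_prime[OF p(1)] n by simp
  next
    case 2
    then have "even (int k)" "1 < int k" using k0 by auto
    then show ?thesis using N_infinity_prime_even[of p "int k"] p n by simp
  next
    case 3
    then have "odd (int k)" "1 < int k" using k0 by auto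
    then show ?thesis using N_infinity_prime_odd[of p "int k"] p n by simp
  qed
next
  case False
  have small: "q = 2 \<or> q = 3 \<or> q = 5" if "prime q" "q dvd n" for q
    using prime_lt_7[OF that(1)] False that by (meson not_less)
  show ?thesis
  proof (cases "5 dvd n")
    case True
    then obtain k where n: "n = k * 5" by (auto simp: dvd_def mult.commute)
    have k0: "k > 0" using assms(1) n by simp
    show ?thesis
    proof (cases "even k")
      case True
      then have "even (int k)" "1 < int k" using k0 by auto
      moreover have "prime (5 :: nat)" by simp
      ultimately show ?thesis using N_infinity_prime_even[of 5 "int k"] n by simp
    next
      case odd_k: False
      have pk: "q = 3 \<or> q = 5" if "prime q" "q dvd k" for q
        using small[OF that(1)] that(2) n odd_k by auto
      \<comment> \<open>The odd cofactor has prime factors 3 and 5 only. A factor 3 leads to order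
        15; otherwise the cofactor is a power of 5.\<close>
      consider "k = 1" | "3 dvd k" | "\<not> 3 dvd k" "5 dvd k"
        using prime_factor_nat[of k] pk by blast
      then show ?thesis
      proof cases
        case 1
        have "prime (5 :: nat)" by simp
        then show ?thesis using N_infinity_prime n 1 by simp
      next
        case 2
        then obtain j where j: "k = j * 3" by (auto simp: dvd_def mult.commute)
        have "has_N_infinity (j * 15)"
        proof (rule sq15.N_infinity_odd_multiple[OF sq15_subfree perm15 sq15_mixed])
          show "cycle_check q dom15 col15 row15" if "prime q" "q dvd j" for q
            using pk[OF that(1)] that(2) j sq15_cycle3 sq15_cycle5 by auto
        qed (use odd_k j in auto)
        then show ?thesis using n j by (simp add: mult.assoc)
      next
        case 3
        then obtain j where j: "k = j * 5" by (auto simp: dvd_def mult.commute)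
        have "has_N_infinity (j * 25)"
        proof (rule sq25.N_infinity_odd_multiple[OF sq25_subfree perm25 sq25_mixed])
          show "cycle_check q dom25 col25 row25" if "prime q" "q dvd j" for q
          proof -
            have "q dvd k" using that(2) j by simp
            then have "q = 5" using pk[OF that(1)] 3 by auto
            then show ?thesis by (simp only: sq25_cycle5)
          qed
        qed (use odd_k j in auto)
        then show ?thesis using n j by (simp add: mult.assoc)
      qed
    qed
  next
    case not5: False
    have p23: "q = 2 \<or> q = 3" if "prime q" "q dvd n" for q using small[OF that] not5 that(2) by auto
    show ?thesis
    proof (cases "3 dvd n")
      case True
      then obtain k where n: "n = k * 3" by (auto simp: dvd_def mult.commute)
      have k0: "k > 0" using assms(1) n by simp
      have only3: "q = 3" if "prime q" "q dvd j" "j dvd n" "odd j" for q j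
        using p23[OF that(1) dvd_trans[OF that(2,3)]] that(2,4) by (auto dest: dvd_trans)
      \<comment> \<open>Multiples of 24 are even multiples of 12. Otherwise \<open>n\<close> is an
        odd multiple of 12, 6 or 3, and the last two reduce to 18 and 9 unless \<open>n\<close> is 6
        or 3.\<close>
      consider "8 dvd k" | "4 dvd k" "\<not> 8 dvd k" | "2 dvd k" "\<not> 4 dvd k" | "odd k" by blast
      then show ?thesis
      proof cases
        case 1
        then obtain l where l: "k = l * 8" by (auto simp: dvd_def mult.commute)
        have "has_N_infinity ((l * 2) * 12)"
        proof (rule N_infinity_12_even)
          show "q = 2 \<or> q = 3" if "prime q" "q dvd l * 2" for q
          proof (rule p23[OF that(1)])
            have "n = (l * 2) * 12" using n l by simp
            then show "q dvd n" using that(2) by (metis dvd_mult2)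
          qed
        qed (use k0 l in auto)
        then show ?thesis using n l by (simp add: mult.assoc)
      next
        case 2
        then obtain l where l: "k = l * 4" by (auto simp: dvd_def mult.commute)
        have odd_l: "odd l"
        proof
          assume "even l"
          then have "8 dvd k" using l by (auto elim!: evenE)
          then show False using 2 by simp
        qed
        have "has_N_infinity (l * 12)"
        proof (rule sq12a.N_infinity_odd_multiple[OF sq12a_subfree perm12a sq12a_mixed odd_l])
          show "cycle_check q dom12 col12a row12a" if "prime q" "q dvd l" for q
          proof -
            have "l dvd n" using n l by simp
            then have "q = 3" using only3[OF that _ odd_l] by blast
            then show ?thesis by (simp only: sq12a_cycle3)
          qed
        qed simp
        then show ?thesis using n l by (simp add: mult.assoc)
      next
        case 3
        then obtain l where l: "k = l * 2" by (auto simp: dvd_def mult.commute)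
        have odd_l: "odd l"
        proof
          assume "even l"
          then have "4 dvd k" using l by (auto elim!: evenE)
          then show False using 3 by simp
        qed
        have "l \<noteq> 1" using assms(2) n l by auto
        then obtain q where "prime q" "q dvd l" using prime_factor_nat by blast
        moreover have "l dvd n" using n l by simp
        ultimately have "3 dvd l" using only3 odd_l by blast
        then obtain j where j: "l = j * 3" by (auto simp: dvd_def mult.commute)
        then have odd_j: "odd j" using odd_l by auto
        have "has_N_infinity (j * 18)"
        proof (rule sq18.N_infinity_odd_multiple[OF sq18_subfree perm18 sq18_mixed odd_j])
          show "cycle_check q dom18 col18 row18" if "prime q" "q dvd j" for q
          proof -
            have "j dvd n" using n l j by simp
            then have "q = 3" using only3[OF that _ odd_j] by blast
            then show ?thesis by (simp only: sq18_cycle3)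
          qed
        qed simp
        then show ?thesis using n l j by (simp add: mult.assoc)
      next
        case 4
        show ?thesis
        proof (cases "k = 1")
          case True
          have "prime (3 :: nat)" by simp
          then show ?thesis using N_infinity_prime n True by simp
        next
          case False
          then obtain q where "prime q" "q dvd k" using prime_factor_nat by blast
          moreover have "k dvd n" using n by simp
          ultimately have "3 dvd k" using only3 4 by blast
          then obtain j where j: "k = j * 3" by (auto simp: dvd_def mult.commute)
          then have odd_j: "odd j" using 4 by auto
          have "has_N_infinity (j * 9)"
          proof (rule sq9.N_infinity_odd_multiple[OF sq9_subfree perm9 sq9_mixed odd_j])
            show "cycle_check q dom9 col9 row9" if "prime q" "q dvd j" for q
            proof -
              have "j dvd n" using n j by simp
              then have "q = 3" using only3[OF that _ odd_j] by blast
              then show ?thesis by (simp only: sq9_cycle3)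
            qed
          qed simp
          then show ?thesis using n j by (simp add: mult.assoc)
        qed
      qed
    next
      case not3: False
      have p2: "q = 2" if "prime q" "q dvd n" for q using p23[OF that] not3 that(2) by auto
      have two: "2 dvd k" if "k \<noteq> 1" "k dvd n" for k
      proof -
        obtain q where q: "prime q" "q dvd k" using prime_factor_nat[OF \<open>k \<noteq> 1\<close>] by blast
        then have "q = 2" using p2 dvd_trans[OF q(2) \<open>k dvd n\<close>] by blast
        then show ?thesis using q(2) by simp
      qed
      have sq1: "square 1 (\<lambda>_ _. 0)" "subfree 1 (\<lambda>_ _. 0)"
        by (auto simp: square_def bij_betw_def subfree_def lessThan_Suc)
      consider "n \<in> {1, 2, 8, 16}" | "32 dvd n"
      proof -
        have "n \<in> {1, 2, 8, 16}" if "\<not> 32 dvd n"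
        proof (rule ccontr)
          assume c: "n \<notin> {1, 2, 8, 16}"
          \<comment> \<open>Factors 2 are split off one at a time, which can only stop at 1, 2, 4, 8
            or 16; the order 4 is excluded by assumption.\<close>
          have half: "\<exists>l. n = l * (2 * c)" if "n = k * c" "k \<noteq> 1" for k c
          proof -
            have "2 dvd k" using two[OF that(2)] that(1) by simp
            then obtain l where "k = 2 * l" by blast
            then show ?thesis using that(1) by auto
          qed
          obtain k1 where k1: "n = k1 * 2" using half[of n 1] c by auto
          obtain k2 where k2: "n = k2 * 4" using half[OF k1] c k1 by auto
          obtain k3 where k3: "n = k3 * 8" using half[OF k2] assms(2) k2 by auto
          obtain k4 where k4: "n = k4 * 16" using half[OF k3] c k3 by auto
          obtain k5 where "n = k5 * 32" using half[OF k4] c k4 by auto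
          then show False using \<open>\<not> 32 dvd n\<close> by simp
        qed
        then show thesis using that by blast
      qed
      then show ?thesis
      proof cases
        case 1
        have "prime (2 :: nat)" by simp
        then show ?thesis
          using 1 subfree_N_infinity[OF sq1] N_infinity_prime
            subfree_N_infinity[OF sq8.square sq8.subfree[OF sq8_subfree]]
            subfree_N_infinity[OF sq16a.square sq16a.subfree[OF sq16a_subfree]] by blast
      next
        case 2
        then obtain l where l: "n = l * 32" by (auto simp: dvd_def mult.commute)
        have "has_N_infinity ((l * 2) * 16)"
        proof (rule N_infinity_16_even)
          show "q = 2" if "prime q" "q dvd l * 2" for q
          proof (rule p2[OF that(1)])
            have "n = (l * 2) * 16" using l by simp
            then show "q dvd n" using that(2) by (metis dvd_mult2)
          qed
        qed (use assms(1) l in auto)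
        then show ?thesis using l by (simp add: mult.assoc)
      qed
    qed
  qed
qed

end
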